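(* Let $R$ be a commutative ring and $M$ a finitely generated flat $R$-module. If there exists a subset $S$ of $R$ such that $M\otimes_{R}S^{(-1)}R$ is a projective $S^{(-1)}R$-module, then $M$ is a projective $R$-module.
   Context: All rings are commutative (with identity). For a subset $S$ of a ring $R$ (an arbitrary subset), the pointwise localization of $R$ with respect to $S$ is the $R$-algebra $S^{(-1)}R := R[x_{s} : s\in S]/I$, where $R[x_s : s\in S]$ is the polynomial ring in indeterminates indexed by $S$ and $I$ is the ideal generated by all elements of the form $s x_{s}^{2}-x_{s}$ and $s^{2}x_{s}-s$ with $s\in S$. *)

theory Defs
  imports "HOL-Algebra.Algebra"
begin

section \<open>Modules over a commutative ring\<close>

text \<open>
  Modules are records of the library type for modules, whose fields \<open>mult\<close> and \<open>one\<close> play no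
  role in the locale for modules; they are left \<open>undefined\<close> below whenever the module is not
  at the same time an algebra.
\<close>

definition module_hom ::
  "('r, 'x) ring_scheme \<Rightarrow> ('r, 'm, 'y) module_scheme \<Rightarrow> ('r, 'n, 'z) module_scheme \<Rightarrow> ('m \<Rightarrow> 'n) set"
  where "module_hom R M N =
    {h \<in> carrier M \<rightarrow> carrier N.
       (\<forall>x\<in>carrier M. \<forall>y\<in>carrier M. h (x \<oplus>\<^bsub>M\<^esub> y) = h x \<oplus>\<^bsub>N\<^esub> h y) \<and>
       (\<forall>r\<in>carrier R. \<forall>x\<in>carrier M. h (r \<odot>\<^bsub>M\<^esub> x) = r \<odot>\<^bsub>N\<^esub> h x)}"

definition generated_submodule ::
  "('r, 'x) ring_scheme \<Rightarrow> ('r, 'm, 'y) module_scheme \<Rightarrow> 'm set \<Rightarrow> 'm set"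
  where "generated_submodule R M G = \<Inter>{N. submodule N R M \<and> G \<subseteq> N}"

definition finitely_generated_module ::
  "('r, 'x) ring_scheme \<Rightarrow> ('r, 'm, 'y) module_scheme \<Rightarrow> bool"
  where "finitely_generated_module R M \<longleftrightarrow> module R M \<and>
    (\<exists>G. finite G \<and> G \<subseteq> carrier M \<and> generated_submodule R M G = carrier M)"

definition quotient_module :: "('r, 'm, 'y) module_scheme \<Rightarrow> 'm set \<Rightarrow> ('r, 'm set) module"
  where "quotient_module M N =
    \<lparr>carrier = a_rcosets\<^bsub>M\<^esub> N, monoid.mult = undefined, one = undefined, ring.zero = N, add = set_add M,
     smult = (\<lambda>r C. \<Union>x\<in>C. N +>\<^bsub>M\<^esub> (r \<odot>\<^bsub>M\<^esub> x))\<rparr>"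

definition free_module :: "('r, 'x) ring_scheme \<Rightarrow> 'i set \<Rightarrow> ('r, 'i \<Rightarrow> 'r) module"
  where "free_module R I =
    \<lparr>carrier = {p. (\<forall>i\<in>I. p i \<in> carrier R) \<and> (\<forall>i. i \<notin> I \<longrightarrow> p i = \<zero>\<^bsub>R\<^esub>) \<and> finite {i. p i \<noteq> \<zero>\<^bsub>R\<^esub>}},
     monoid.mult = undefined, one = undefined,
     ring.zero = (\<lambda>i. \<zero>\<^bsub>R\<^esub>),
     add = (\<lambda>p q i. p i \<oplus>\<^bsub>R\<^esub> q i),
     smult = (\<lambda>r p i. r \<otimes>\<^bsub>R\<^esub> p i)\<rparr>"

definition free_basis :: "('r, 'x) ring_scheme \<Rightarrow> 'i \<Rightarrow> ('i \<Rightarrow> 'r)"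
  where "free_basis R i = (\<lambda>j. if j = i then \<one>\<^bsub>R\<^esub> else \<zero>\<^bsub>R\<^esub>)"


section \<open>Tensor products\<close>

type_synonym ('r, 'm, 'n) tensor = "('m \<times> 'n \<Rightarrow> 'r) set"

definition tensor_free ::
  "('r, 'x) ring_scheme \<Rightarrow> ('r, 'm, 'y) module_scheme \<Rightarrow> ('r, 'n, 'z) module_scheme
    \<Rightarrow> ('r, 'm \<times> 'n \<Rightarrow> 'r) module"
  where "tensor_free R M N = free_module R (carrier M \<times> carrier N)"

definition tensor_relations ::
  "('r, 'x) ring_scheme \<Rightarrow> ('r, 'm, 'y) module_scheme \<Rightarrow> ('r, 'n, 'z) module_scheme
    \<Rightarrow> ('m \<times> 'n \<Rightarrow> 'r) set"
  where "tensor_relations R M N =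
    (let F = tensor_free R M N; e = (\<lambda>m n. free_basis R (m, n)) in
      generated_submodule R F
       ({e (m \<oplus>\<^bsub>M\<^esub> m') n \<ominus>\<^bsub>F\<^esub> (e m n \<oplus>\<^bsub>F\<^esub> e m' n) | m m' n.
           m \<in> carrier M \<and> m' \<in> carrier M \<and> n \<in> carrier N} \<union>
        {e m (n \<oplus>\<^bsub>N\<^esub> n') \<ominus>\<^bsub>F\<^esub> (e m n \<oplus>\<^bsub>F\<^esub> e m n') | m n n'.
           m \<in> carrier M \<and> n \<in> carrier N \<and> n' \<in> carrier N} \<union>
        {e (r \<odot>\<^bsub>M\<^esub> m) n \<ominus>\<^bsub>F\<^esub> (r \<odot>\<^bsub>F\<^esub> e m n) | r m n.
           r \<in> carrier R \<and> m \<in> carrier M \<and> n \<in> carrier N} \<union>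
        {e m (r \<odot>\<^bsub>N\<^esub> n) \<ominus>\<^bsub>F\<^esub> (r \<odot>\<^bsub>F\<^esub> e m n) | r m n.
           r \<in> carrier R \<and> m \<in> carrier M \<and> n \<in> carrier N}))"

definition tensor_product ::
  "('r, 'x) ring_scheme \<Rightarrow> ('r, 'm, 'y) module_scheme \<Rightarrow> ('r, 'n, 'z) module_scheme
    \<Rightarrow> ('r, ('r, 'm, 'n) tensor) module"
  where "tensor_product R M N = quotient_module (tensor_free R M N) (tensor_relations R M N)"

definition pure_tensor ::
  "('r, 'x) ring_scheme \<Rightarrow> ('r, 'm, 'y) module_scheme \<Rightarrow> ('r, 'n, 'z) module_scheme
    \<Rightarrow> 'm \<Rightarrow> 'n \<Rightarrow> ('r, 'm, 'n) tensor"
  where "pure_tensor R M N m n = tensor_relations R M N +>\<^bsub>tensor_free R M N\<^esub> free_basis R (m, n)"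

text \<open>
  The map induced by \<open>f\<close> and \<open>g\<close> on tensor products with target \<open>M' \<otimes> N'\<close>: the class of
  \<open>p = \<Sum> p(m,n) (m,n)\<close> goes to \<open>\<Sum> p(m,n) (f m \<otimes> g n)\<close>.  The union only serves to drop the
  choice of the representative \<open>p\<close>, as in the multiplication of a quotient ring: for linear
  \<open>f\<close> and \<open>g\<close> all its members are the same coset.
\<close>
definition tensor_map ::
  "('r, 'x) ring_scheme \<Rightarrow> ('r, 'm2, 'y) module_scheme \<Rightarrow> ('r, 'n2, 'z) module_scheme
    \<Rightarrow> ('m1 \<Rightarrow> 'm2) \<Rightarrow> ('n1 \<Rightarrow> 'n2) \<Rightarrow> ('r, 'm1, 'n1) tensor \<Rightarrow> ('r, 'm2, 'n2) tensor"
  where "tensor_map R M' N' f g C =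
    (let T = tensor_product R M' N' in
      \<Union>p\<in>C. \<Oplus>\<^bsub>T\<^esub>i\<in>{i. p i \<noteq> \<zero>\<^bsub>R\<^esub>}. p i \<odot>\<^bsub>T\<^esub> pure_tensor R M' N' (f (fst i)) (g (snd i)))"

text \<open>
  The \<open>A\<close>-module \<open>M \<otimes>\<^sub>R A\<close> for an \<open>R\<close>-algebra \<open>A\<close>, with \<open>a (m \<otimes> b) = m \<otimes> (a b)\<close>.
\<close>
definition base_change ::
  "('r, 'x) ring_scheme \<Rightarrow> ('r, 'm, 'y) module_scheme \<Rightarrow> ('r, 'a, 'z) module_scheme
    \<Rightarrow> ('a, ('r, 'm, 'a) tensor) module"
  where "base_change R M A =
    (let T = tensor_product R M A in
     \<lparr>carrier = carrier T, monoid.mult = undefined, one = undefined, ring.zero = ring.zero T, add = add T,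
      smult = (\<lambda>a. tensor_map R M A (\<lambda>m. m) (\<lambda>b. a \<otimes>\<^bsub>A\<^esub> b))\<rparr>)"


section \<open>Flat and projective modules\<close>

text \<open>
  Both notions quantify over all \<open>R\<close>-modules, which HOL can only do one carrier type at a time;
  that type is the first argument.  A flat or projective module has the property for every
  type, so a premise for one type is never stronger than the textbook notion, and a
  conclusion for an arbitrary type variable is the textbook notion.

  The type \<open>('r, 'i) coset_type\<close> contains the free module on any subset of \<open>'i\<close> and all its
  quotients, up to isomorphism.  With \<open>'i = nat\<close> these are all countably generated modules,
  in particular all ideals, which suffices to test flatness.  With \<open>'i\<close> the element type
  of \<open>P\<close> they include the canonical presentation of \<open>P\<close> by the free module on its elements,
  and splitting that one is equivalent to projectivity.
\<close>

type_synonym ('r, 'i) coset_type = "('i \<Rightarrow> 'r) set"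

definition flat_module ::
  "'u itself \<Rightarrow> ('r, 'x) ring_scheme \<Rightarrow> ('r, 'm, 'y) module_scheme \<Rightarrow> bool"
  where "flat_module U R M \<longleftrightarrow> module R M \<and>
    (\<forall>(N' :: ('r, 'u) module) (N :: ('r, 'u) module) f.
       module R N' \<and> module R N \<and> f \<in> module_hom R N' N \<and> inj_on f (carrier N') \<longrightarrow>
       inj_on (tensor_map R M N (\<lambda>m. m) f) (carrier (tensor_product R M N')))"

definition projective_module ::
  "'u itself \<Rightarrow> ('r, 'x) ring_scheme \<Rightarrow> ('r, 'p, 'y) module_scheme \<Rightarrow> bool"
  where "projective_module U R P \<longleftrightarrow> module R P \<and>
    (\<forall>(L :: ('r, 'u) module) (N :: ('r, 'u) module) g f.
       module R L \<and> module R N \<and> g \<in> module_hom R L N \<and> g ` carrier L = carrier N \<and>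
       f \<in> module_hom R P N \<longrightarrow>
       (\<exists>h\<in>module_hom R P L. \<forall>x\<in>carrier P. g (h x) = f x))"


section \<open>Pointwise localization\<close>

text \<open>
  The library provides the elements of \<open>R[x\<^sub>i : i \<in> I]\<close>, their sum and the product with an
  indeterminate; the general product is the convolution over all factorizations of a monomial.
\<close>
definition indexed_poly_ring ::
  "('r, 'x) ring_scheme \<Rightarrow> 'i set \<Rightarrow> ('i multiset \<Rightarrow> 'r) ring"
  where "indexed_poly_ring R I =
    \<lparr>carrier = ring.indexed_pset R I (carrier R),
     monoid.mult = (\<lambda>P Q m. \<Oplus>\<^bsub>R\<^esub>k\<in>{k. k \<subseteq># m}. P k \<otimes>\<^bsub>R\<^esub> Q (m - k)),
     one = ring.indexed_const R \<one>\<^bsub>R\<^esub>,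
     ring.zero = ring.indexed_const R \<zero>\<^bsub>R\<^esub>,
     add = ring.indexed_padd R\<rparr>"

definition pointwise_ideal :: "('r, 'x) ring_scheme \<Rightarrow> 'r set \<Rightarrow> ('r multiset \<Rightarrow> 'r) set"
  where "pointwise_ideal R S =
    (let P = indexed_poly_ring R S; c = ring.indexed_const R; x = ring.indexed_var R in
      Idl\<^bsub>P\<^esub> ({c s \<otimes>\<^bsub>P\<^esub> x s [^]\<^bsub>P\<^esub> (2::nat) \<ominus>\<^bsub>P\<^esub> x s | s. s \<in> S} \<union>
             {c s [^]\<^bsub>P\<^esub> (2::nat) \<otimes>\<^bsub>P\<^esub> x s \<ominus>\<^bsub>P\<^esub> c s | s. s \<in> S}))"

type_synonym 'r pointwise = "('r multiset \<Rightarrow> 'r) set"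

text \<open>
  Bundled as an \<open>R\<close>-algebra: a record for modules over \<open>R\<close> that also carries the ring structure,
  so that it serves as base ring too.
\<close>
definition pointwise_localization ::
  "('r, 'x) ring_scheme \<Rightarrow> 'r set \<Rightarrow> ('r, 'r pointwise) module"
  where "pointwise_localization R S =
    (let P = indexed_poly_ring R S; I = pointwise_ideal R S; Q = P Quot I in
     \<lparr>carrier = carrier Q, monoid.mult = monoid.mult Q, one = one Q, ring.zero = ring.zero Q, add = add Q,
      smult = (\<lambda>r C. (I +>\<^bsub>P\<^esub> ring.indexed_const R r) \<otimes>\<^bsub>Q\<^esub> C)\<rparr>)"

end

theory Submission
  imports Defs
begin

text \<open>
  Write \<open>M = F / V\<close> with \<open>F\<close> free on a finite set \<open>G\<close>, and let \<open>A = S\<^sup>(\<^sup>-\<^sup>1\<^sup>)R\<close>. By the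
  equational criterion of flatness, every finite subset of \<open>V\<close> is killed by an endomorphism \<open>\<theta>\<close>
  of \<open>F\<close> with \<open>v - \<theta> v \<in> V\<close> for all \<open>v\<close>, and \<open>M\<close> is projective as soon as one such \<open>\<theta>\<close>
  kills all of \<open>V\<close>.

  Since \<open>M \<otimes> A\<close> is projective, the kernel of \<open>A\<^sup>G \<rightarrow> M \<otimes> A\<close> is generated by finitely many
  elements of \<open>V\<close>. A \<open>\<theta>\<close> that kills those maps \<open>V\<close> into \<open>J F\<close>, where \<open>J\<close> is the kernel of
  \<open>R \<rightarrow> A\<close>. This kernel is nil, because every map from \<open>R\<close> to a field extends to \<open>A\<close>.

  Let \<open>k \<in> V\<close>, and let \<open>\<eta>\<close> kill \<open>k\<close> and the image of \<open>1 - \<theta>\<close>. Then \<open>\<theta> (1 - \<eta>)\<close> is a matrix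
  over \<open>J\<close>, hence nilpotent, and its powers agree with those of \<open>\<theta>\<close> on \<open>k\<close>. So \<open>\<theta>\<^sup>r k = 0\<close> for
  some \<open>r\<close>, and \<open>k = (1 - \<theta>\<^sup>r) k\<close> lies in the image of \<open>1 - \<theta>\<close>. Hence \<open>V\<close> is that image,
  which is finitely generated, and a single \<open>\<eta>\<close> kills it.
\<close>

section \<open>Modules\<close>

text \<open>The obstacle is that V need not be finitely generated, while flatness handles only
  finitely many relations at a time. Over A finite generation is automatic, since the kernel of a
  split surjection is the image of a projection of A^G; but the way back to R loses the ideal J.
  This ideal is nil and perhaps not nilpotent, which suffices because the matrix of one endomorphism
  has finitely many entries.

  The factor 1 - \<eta> answers a second difficulty: \<theta> is known to have coefficients in J on
  V only. As 1 - \<eta> maps all of F into V, every entry of \<theta> (1 - \<eta>) is in J. Nothing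
  is lost on k: \<eta> kills the image of 1 - \<theta>, so \<eta> \<theta> = \<eta>, and all
  \<theta>^n k stay in the kernel of \<eta>, where 1 - \<eta> is the identity. Killing the image of
  1 - \<theta> is a finite condition, as its values on the basis generate it.

  That J is nil is tested at the primes of R, where an element that lies in all of them is
  nilpotent. The two equations for x_s say that x_s is a weak inverse of s, so in a field x_s is
  forced to be 1/s, or 0 if s is 0.\<close>

lemma module_homI:
  assumes "\<And>x. x \<in> carrier M \<Longrightarrow> h x \<in> carrier N"
    and "\<And>x y. \<lbrakk>x \<in> carrier M; y \<in> carrier M\<rbrakk> \<Longrightarrow> h (x \<oplus>\<^bsub>M\<^esub> y) = h x \<oplus>\<^bsub>N\<^esub> h y"
    and "\<And>r x. \<lbrakk>r \<in> carrier R; x \<in> carrier M\<rbrakk> \<Longrightarrow> h (r \<odot>\<^bsub>M\<^esub> x) = r \<odot>\<^bsub>N\<^esub> h x"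
  shows "h \<in> module_hom R M N"
  using assms by (auto simp: module_hom_def)

lemma module_hom_closed: "\<lbrakk>h \<in> module_hom R M N; x \<in> carrier M\<rbrakk> \<Longrightarrow> h x \<in> carrier N"
  by (auto simp: module_hom_def)

lemma module_hom_add:
  "\<lbrakk>h \<in> module_hom R M N; x \<in> carrier M; y \<in> carrier M\<rbrakk> \<Longrightarrow> h (x \<oplus>\<^bsub>M\<^esub> y) = h x \<oplus>\<^bsub>N\<^esub> h y"
  by (auto simp: module_hom_def)

lemma module_hom_smult:
  "\<lbrakk>h \<in> module_hom R M N; r \<in> carrier R; x \<in> carrier M\<rbrakk> \<Longrightarrow> h (r \<odot>\<^bsub>M\<^esub> x) = r \<odot>\<^bsub>N\<^esub> h x"
  by (auto simp: module_hom_def)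

lemma module_hom_id: "(\<lambda>x. x) \<in> module_hom R M M"
  by (auto simp: module_hom_def)

lemma module_hom_comp:
  "\<lbrakk>f \<in> module_hom R L M; g \<in> module_hom R M N\<rbrakk> \<Longrightarrow> (\<lambda>x. g (f x)) \<in> module_hom R L N"
  by (auto simp: module_hom_def Pi_iff)

lemma module_hom_zero:
  assumes "module R M" "module R N" "h \<in> module_hom R M N"
  shows "h \<zero>\<^bsub>M\<^esub> = \<zero>\<^bsub>N\<^esub>"
proof -
  interpret M: module R M by fact
  interpret N: module R N by fact
  have "h (\<zero>\<^bsub>R\<^esub> \<odot>\<^bsub>M\<^esub> \<zero>\<^bsub>M\<^esub>) = \<zero>\<^bsub>R\<^esub> \<odot>\<^bsub>N\<^esub> h \<zero>\<^bsub>M\<^esub>"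
    by (rule module_hom_smult[OF assms(3)]) auto
  then show ?thesis
    using module_hom_closed[OF assms(3)] by simp
qed

lemma module_hom_uminus:
  assumes "module R M" "module R N" "h \<in> module_hom R M N" "x \<in> carrier M"
  shows "h (\<ominus>\<^bsub>M\<^esub> x) = \<ominus>\<^bsub>N\<^esub> h x"
proof -
  interpret M: module R M by fact
  interpret N: module R N by fact
  have "h (\<ominus>\<^bsub>M\<^esub> x) = h ((\<ominus>\<^bsub>R\<^esub> \<one>\<^bsub>R\<^esub>) \<odot>\<^bsub>M\<^esub> x)"
    using assms(4) by (simp add: M.smult_l_minus)
  also have "\<dots> = \<ominus>\<^bsub>N\<^esub> h x"
    using assms(3,4) by (simp add: module_hom_smult N.smult_l_minus module_hom_closed)
  finally show ?thesis .
qed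

lemma module_hom_minus:
  assumes "module R M" "module R N" "h \<in> module_hom R M N" "x \<in> carrier M" "y \<in> carrier M"
  shows "h (x \<ominus>\<^bsub>M\<^esub> y) = h x \<ominus>\<^bsub>N\<^esub> h y"
proof -
  interpret M: module R M by fact
  show ?thesis
    using assms by (simp add: a_minus_def module_hom_add module_hom_uminus)
qed

lemma module_hom_finsum:
  assumes "module R M" "module R N" "h \<in> module_hom R M N" "x \<in> A \<rightarrow> carrier M"
  shows "h (\<Oplus>\<^bsub>M\<^esub>i\<in>A. x i) = (\<Oplus>\<^bsub>N\<^esub>i\<in>A. h (x i))"
proof -
  interpret M: module R M by fact
  interpret N: module R N by fact
  show ?thesis
    using assms(4)
  proof (induction A rule: infinite_finite_induct)
    case (insert a A)
    then show ?case
      using module_hom_closed[OF assms(3)]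
      by (simp add: Pi_iff module_hom_add[OF assms(3)])
  qed (simp_all add: module_hom_zero[OF assms(1-3)])
qed

lemma submodule_vimage:
  assumes "module R M" "module R N" "h \<in> module_hom R M N" "submodule D R N"
  shows "submodule {x \<in> carrier M. h x \<in> D} R M"
proof -
  interpret M: module R M by fact
  interpret N: module R N by fact
  note D = N.submoduleE[OF assms(4)]
  have z: "\<zero>\<^bsub>N\<^esub> \<in> D"
    using assms(4) by (metis submodule.axioms(1) subgroup.one_closed monoid.simps(2))
  show ?thesis
    using assms D z
    by (intro M.submoduleI)
      (auto simp: module_hom_zero module_hom_add module_hom_smult module_hom_uminus)
qed

lemma submodule_image:
  assumes "module R M" "module R N" "h \<in> module_hom R M N"
  shows "submodule (h ` carrier M) R N"
proof -
  interpret M: module R M by fact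
  interpret N: module R N by fact
  show ?thesis
  proof (rule N.submoduleI)
    show "h ` carrier M \<subseteq> carrier N"
      using assms(3) by (auto simp: module_hom_closed)
    show "\<zero>\<^bsub>N\<^esub> \<in> h ` carrier M"
      using module_hom_zero[OF assms] by (metis M.zero_closed imageI)
  next
    fix a assume "a \<in> h ` carrier M"
    then show "\<ominus>\<^bsub>N\<^esub> a \<in> h ` carrier M"
      using module_hom_uminus[OF assms] by (auto simp: image_iff) (metis M.a_inv_closed)
  next
    fix a b assume "a \<in> h ` carrier M" "b \<in> h ` carrier M"
    then show "a \<oplus>\<^bsub>N\<^esub> b \<in> h ` carrier M"
      using module_hom_add[OF assms(3)] by (auto simp: image_iff) (metis M.add.m_closed)
  next
    fix a x assume "a \<in> carrier R" "x \<in> h ` carrier M"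
    then show "a \<odot>\<^bsub>N\<^esub> x \<in> h ` carrier M"
      using module_hom_smult[OF assms(3)] by (auto simp: image_iff) (metis M.smult_closed)
  qed
qed

lemma submodule_zero: "submodule H R M \<Longrightarrow> \<zero>\<^bsub>M\<^esub> \<in> H"
  by (metis submodule.axioms(1) subgroup.one_closed monoid.simps(2))

lemma (in module) zero_submodule: "submodule {\<zero>\<^bsub>M\<^esub>} R M"
  by (rule submoduleI) auto

lemma (in module) submodule_minus:
  "\<lbrakk>submodule H R M; a \<in> H; b \<in> H\<rbrakk> \<Longrightarrow> a \<ominus>\<^bsub>M\<^esub> b \<in> H"
  by (simp add: a_minus_def submoduleE)

lemma (in module) submodule_finsum:
  assumes "submodule H R M" "f \<in> A \<rightarrow> H"
  shows "(\<Oplus>\<^bsub>M\<^esub>i\<in>A. f i) \<in> H"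
  using assms(2)
proof (induction A rule: infinite_finite_induct)
  case (insert a A)
  then have "f a \<in> H" "f \<in> A \<rightarrow> H" and sub: "H \<subseteq> carrier M"
    using submoduleE(1)[OF assms(1)] by auto
  then show ?case
    using insert by (simp add: Pi_iff subset_iff submoduleE(5)[OF assms(1)])
qed (simp_all add: submodule_zero[OF assms(1)])

lemma (in module) generated_submodule_submodule:
  assumes "G \<subseteq> carrier M"
  shows "submodule (generated_submodule R M G) R M"
proof -
  \<comment> \<open>The family of submodules has to be nonempty, since an empty intersection would
    be the whole type.\<close>
  have c: "carrier M \<in> {N. submodule N R M \<and> G \<subseteq> N}"
    using assms carrier_is_submodule by simp
  show ?thesis
    unfolding generated_submodule_def
  proof (rule submoduleI)
    show "\<Inter>{N. submodule N R M \<and> G \<subseteq> N} \<subseteq> carrier M" using c by blast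
  qed (auto simp: submodule_zero submoduleE)
qed

lemma generated_submodule_incl: "G \<subseteq> generated_submodule R M G"
  by (auto simp: generated_submodule_def)

lemma generated_submodule_minimal:
  "\<lbrakk>submodule N R M; G \<subseteq> N\<rbrakk> \<Longrightarrow> generated_submodule R M G \<subseteq> N"
  by (auto simp: generated_submodule_def)


section \<open>Free modules\<close>

lemma free_module_simps [simp]:
  "\<zero>\<^bsub>free_module R I\<^esub> = (\<lambda>i. \<zero>\<^bsub>R\<^esub>)"
  "p \<oplus>\<^bsub>free_module R I\<^esub> q = (\<lambda>i. p i \<oplus>\<^bsub>R\<^esub> q i)"
  "r \<odot>\<^bsub>free_module R I\<^esub> p = (\<lambda>i. r \<otimes>\<^bsub>R\<^esub> p i)"
  by (simp_all add: free_module_def)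

lemma free_module_carrierI:
  assumes "\<And>i. i \<in> I \<Longrightarrow> p i \<in> carrier R" "\<And>i. i \<notin> I \<Longrightarrow> p i = \<zero>\<^bsub>R\<^esub>" "finite {i. p i \<noteq> \<zero>\<^bsub>R\<^esub>}"
  shows "p \<in> carrier (free_module R I)"
  using assms by (simp add: free_module_def)

lemma free_module_support: 
  "p \<in> carrier (free_module R I) \<Longrightarrow> finite {i. p i \<noteq> \<zero>\<^bsub>R\<^esub>}"
  "p \<in> carrier (free_module R I) \<Longrightarrow> {i. p i \<noteq> \<zero>\<^bsub>R\<^esub>} \<subseteq> I"
  by (auto simp: free_module_def)

lemma free_module_outside: "\<lbrakk>p \<in> carrier (free_module R I); i \<notin> I\<rbrakk> \<Longrightarrow> p i = \<zero>\<^bsub>R\<^esub>"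
  by (auto simp: free_module_def)

context cring
begin

text \<open>Outside \<open>I\<close> the value is zero, hence in the carrier too; coefficients can
  thus be treated alike at all indices.\<close>

lemma free_module_coeff: "p \<in> carrier (free_module R I) \<Longrightarrow> p i \<in> carrier R"
  by (cases "i \<in> I") (auto simp: free_module_def)

lemma free_module_finite_carrierI:
  assumes "finite I" "\<And>i. i \<in> I \<Longrightarrow> p i \<in> carrier R" "\<And>i. i \<notin> I \<Longrightarrow> p i = \<zero>"
  shows "p \<in> carrier (free_module R I)"
  using assms by (intro free_module_carrierI) (auto intro: finite_subset[of _ I])

lemma free_module_module: "module R (free_module R I)"
proof -
  let ?F = "free_module R I"
  note c = free_module_coeff
  have add: "p \<oplus>\<^bsub>?F\<^esub> q \<in> carrier ?F" if "p \<in> carrier ?F" "q \<in> carrier ?F" for p q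
  proof (rule free_module_carrierI)
    show "finite {i. (p \<oplus>\<^bsub>?F\<^esub> q) i \<noteq> \<zero>}"
      by (rule finite_subset[OF _ finite_UnI[OF that[THEN free_module_support(1)]]]) auto
  qed (simp_all add: c[OF that(1)] c[OF that(2)] that[THEN free_module_outside])
  have smult: "r \<odot>\<^bsub>?F\<^esub> p \<in> carrier ?F" if r: "r \<in> carrier R" and p: "p \<in> carrier ?F" for r p
  proof (rule free_module_carrierI)
    show "finite {i. (r \<odot>\<^bsub>?F\<^esub> p) i \<noteq> \<zero>}"
      by (rule finite_subset[OF _ free_module_support(1)[OF p]]) (use r in auto)
  qed (simp_all add: r c[OF p] free_module_outside[OF p])
  have "abelian_group ?F"
  proof (rule abelian_groupI)
    show "\<zero>\<^bsub>?F\<^esub> \<in> carrier ?F"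
      by (rule free_module_carrierI) auto
    fix p assume p: "p \<in> carrier ?F"
    show "\<exists>q\<in>carrier ?F. q \<oplus>\<^bsub>?F\<^esub> p = \<zero>\<^bsub>?F\<^esub>"
    proof (rule bexI)
      show "(\<ominus> \<one>) \<odot>\<^bsub>?F\<^esub> p \<in> carrier ?F"
        by (rule smult[OF _ p]) simp
      show "(\<ominus> \<one>) \<odot>\<^bsub>?F\<^esub> p \<oplus>\<^bsub>?F\<^esub> p = \<zero>\<^bsub>?F\<^esub>"
        by (simp add: c[OF p] l_minus l_neg)
    qed
    show "\<zero>\<^bsub>?F\<^esub> \<oplus>\<^bsub>?F\<^esub> p = p"
      by (simp add: c[OF p])
    fix q assume q: "q \<in> carrier ?F"
    show "p \<oplus>\<^bsub>?F\<^esub> q = q \<oplus>\<^bsub>?F\<^esub> p"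
      by (simp add: c[OF p] c[OF q] a_comm)
    fix s assume s: "s \<in> carrier ?F"
    show "p \<oplus>\<^bsub>?F\<^esub> q \<oplus>\<^bsub>?F\<^esub> s = p \<oplus>\<^bsub>?F\<^esub> (q \<oplus>\<^bsub>?F\<^esub> s)"
      by (simp add: c[OF p] c[OF q] c[OF s] a_assoc)
  qed (rule add)
  then show ?thesis
  proof (rule moduleI[OF is_cring _ smult])
    fix a b p
    assume a: "a \<in> carrier R" and b: "b \<in> carrier R" and p: "p \<in> carrier ?F"
    note [simp] = a b c[OF p]
    show "(a \<oplus> b) \<odot>\<^bsub>?F\<^esub> p = a \<odot>\<^bsub>?F\<^esub> p \<oplus>\<^bsub>?F\<^esub> b \<odot>\<^bsub>?F\<^esub> p"
      by (simp add: l_distr)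
    show "a \<otimes> b \<odot>\<^bsub>?F\<^esub> p = a \<odot>\<^bsub>?F\<^esub> (b \<odot>\<^bsub>?F\<^esub> p)"
      by (simp add: m_assoc)
  next
    fix p assume p: "p \<in> carrier ?F"
    show "\<one> \<odot>\<^bsub>?F\<^esub> p = p"
      by (simp add: c[OF p])
  next
    fix a p q
    assume a: "a \<in> carrier R" and p: "p \<in> carrier ?F" and q: "q \<in> carrier ?F"
    show "a \<odot>\<^bsub>?F\<^esub> (p \<oplus>\<^bsub>?F\<^esub> q) = a \<odot>\<^bsub>?F\<^esub> p \<oplus>\<^bsub>?F\<^esub> a \<odot>\<^bsub>?F\<^esub> q"
      by (simp add: a c[OF p] c[OF q] r_distr)
  qed
qed

lemma free_basis_carrier: "i \<in> I \<Longrightarrow> free_basis R i \<in> carrier (free_module R I)"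
  by (rule free_module_carrierI) (auto simp: free_basis_def)

lemma free_module_minus:
  assumes "p \<in> carrier (free_module R I)" "q \<in> carrier (free_module R I)"
  shows "p \<ominus>\<^bsub>free_module R I\<^esub> q = (\<lambda>i. p i \<ominus> q i)"
proof -
  interpret F: module R "free_module R I" by (rule free_module_module)
  note [simp] = free_module_coeff[OF assms(1)] free_module_coeff[OF assms(2)]
  \<comment> \<open>Negation is only characterized as the inverse for addition; as the scalar
    multiple by \<open>\<ominus> \<one>\<close> it can be computed at each index.\<close>
  have neg: "\<ominus>\<^bsub>free_module R I\<^esub> q = (\<ominus> \<one>) \<odot>\<^bsub>free_module R I\<^esub> q"
    using assms by (simp add: F.smult_l_minus del: free_module_simps)
  show ?thesis
    by (simp add: a_minus_def neg l_minus)
qed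

lemma free_module_finsum:
  assumes "x \<in> A \<rightarrow> carrier (free_module R I)"
  shows "(\<Oplus>\<^bsub>free_module R I\<^esub>k\<in>A. x k) i = (\<Oplus>k\<in>A. x k i)"
proof -
  interpret F: module R "free_module R I" by (rule free_module_module)
  show ?thesis
    using assms
  proof (induction A rule: infinite_finite_induct)
    case (insert a A)
    then have "x a \<in> carrier (free_module R I)" "x \<in> A \<rightarrow> carrier (free_module R I)"
      "(\<lambda>k. x k i) \<in> A \<rightarrow> carrier R" "x a i \<in> carrier R"
      by (auto intro: free_module_coeff)
    with insert show ?case by simp
  qed simp_all
qed

text \<open>At a given index the sum collapses to a single term. The set \<open>B\<close> may exceed
  the support because the added coefficients vanish.\<close>

lemma free_module_expand:
  assumes p: "p \<in> carrier (free_module R I)" and B: "finite B" "{i. p i \<noteq> \<zero>} \<subseteq> B" "B \<subseteq> I"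
  shows "(\<Oplus>\<^bsub>free_module R I\<^esub>i\<in>B. p i \<odot>\<^bsub>free_module R I\<^esub> free_basis R i) = p"
proof
  interpret F: module R "free_module R I" by (rule free_module_module)
  note pc [simp] = free_module_coeff[OF p]
  fix j
  have e: "(\<lambda>i. p i \<odot>\<^bsub>free_module R I\<^esub> free_basis R i) \<in> B \<rightarrow> carrier (free_module R I)"
    using B by (auto simp del: free_module_simps intro!: F.smult_closed free_basis_carrier)
  have "(\<Oplus>\<^bsub>free_module R I\<^esub>i\<in>B. p i \<odot>\<^bsub>free_module R I\<^esub> free_basis R i) j
      = (\<Oplus>i\<in>B. p i \<otimes> free_basis R i j)"
    using free_module_finsum[OF e] by simp
  also have "\<dots> = (\<Oplus>i\<in>B. if j = i then p i else \<zero>)"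
    using p by (intro finsum_cong) (auto simp: free_basis_def simp_implies_def)
  also have "\<dots> = p j"
  proof (cases "j \<in> B")
    case True
    then show ?thesis
      using B p by (intro add.finprod_singleton) auto
  next
    case False
    then have "p j = \<zero>" using B by auto
    moreover have "(\<Oplus>i\<in>B. if j = i then p i else \<zero>) = \<zero>"
      using False by (intro add.finprod_one_eqI) auto
    ultimately show ?thesis by simp
  qed
  finally show "(\<Oplus>\<^bsub>free_module R I\<^esub>i\<in>B. p i \<odot>\<^bsub>free_module R I\<^esub> free_basis R i) j = p j" .
qed

end

text \<open>Summing over the support leaves the index set implicit. It is also literally the sum
  inside \<open>tensor_map\<close>, which therefore unfolds to a lift.\<close>

definition free_lift ::
  "('r, 'x) ring_scheme \<Rightarrow> ('r, 'n, 'y) module_scheme \<Rightarrow> ('i \<Rightarrow> 'n) \<Rightarrow> ('i \<Rightarrow> 'r) \<Rightarrow> 'n"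
  where "free_lift R N w p = (\<Oplus>\<^bsub>N\<^esub>i\<in>{i. p i \<noteq> \<zero>\<^bsub>R\<^esub>}. p i \<odot>\<^bsub>N\<^esub> w i)"

context module
begin

lemma free_lift_superset:
  assumes p: "p \<in> carrier (free_module R I)" and w: "w \<in> I \<rightarrow> carrier M"
    and B: "finite B" "{i. p i \<noteq> \<zero>} \<subseteq> B" "B \<subseteq> I"
  shows "free_lift R M w p = (\<Oplus>\<^bsub>M\<^esub>i\<in>B. p i \<odot>\<^bsub>M\<^esub> w i)"
  unfolding free_lift_def
proof (rule M.add.finprod_mono_neutral_cong_left)
  show "(\<lambda>i. p i \<odot>\<^bsub>M\<^esub> w i) \<in> B \<rightarrow> carrier M"
    using B by (auto intro!: smult_closed free_module_coeff[OF p] Pi_mem[OF w])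
  show "p i \<odot>\<^bsub>M\<^esub> w i = \<zero>\<^bsub>M\<^esub>" if "i \<in> B - {i. p i \<noteq> \<zero>}" for i
    using that B by (auto intro!: smult_l_null Pi_mem[OF w])
qed (use B in auto)

lemma free_lift_hom:
  assumes w: "w \<in> I \<rightarrow> carrier M"
  shows "free_lift R M w \<in> module_hom R (free_module R I) M"
proof (rule module_homI)
  note S = free_module_support
  interpret F: module R "free_module R I" by (rule free_module_module)
  {
    fix p assume p: "p \<in> carrier (free_module R I)"
    show "free_lift R M w p \<in> carrier M"
      using S(2)[OF p] unfolding free_lift_def
      by (intro finsum_closed) (auto intro!: smult_closed free_module_coeff[OF p] Pi_mem[OF w])
  }
  {
    fix p q assume p: "p \<in> carrier (free_module R I)" and q: "q \<in> carrier (free_module R I)"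
    note [simp] = free_module_coeff[OF p] free_module_coeff[OF q]
    \<comment> \<open>The three sums run over different supports, that of the sum being possibly
      smaller than the union; they are compared over one common finite set.\<close>
    let ?B = "{i. p i \<noteq> \<zero>} \<union> {i. q i \<noteq> \<zero>}"
    have B: "finite ?B" "?B \<subseteq> I"
      using S[OF p] S[OF q] by auto
    have pq: "p \<oplus>\<^bsub>free_module R I\<^esub> q \<in> carrier (free_module R I)"
      using p q by (rule F.add.m_closed)
    have cl: "(\<lambda>i. p i \<odot>\<^bsub>M\<^esub> w i) \<in> ?B \<rightarrow> carrier M" "(\<lambda>i. q i \<odot>\<^bsub>M\<^esub> w i) \<in> ?B \<rightarrow> carrier M"
      using B by (auto intro!: smult_closed Pi_mem[OF w])
    have "free_lift R M w (p \<oplus>\<^bsub>free_module R I\<^esub> q) = (\<Oplus>\<^bsub>M\<^esub>i\<in>?B. (p i \<oplus> q i) \<odot>\<^bsub>M\<^esub> w i)"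
      by (subst free_lift_superset[OF pq w B(1) _ B(2)]) auto
    also have "\<dots> = (\<Oplus>\<^bsub>M\<^esub>i\<in>?B. p i \<odot>\<^bsub>M\<^esub> w i \<oplus>\<^bsub>M\<^esub> q i \<odot>\<^bsub>M\<^esub> w i)"
      using B cl by (intro M.add.finprod_cong') (auto intro!: smult_l_distr Pi_mem[OF w])
    also have "\<dots> = free_lift R M w p \<oplus>\<^bsub>M\<^esub> free_lift R M w q"
      using M.finsum_addf[OF cl]
      by (simp add: free_lift_superset[OF p w B(1) _ B(2)] free_lift_superset[OF q w B(1) _ B(2)])
    finally show "free_lift R M w (p \<oplus>\<^bsub>free_module R I\<^esub> q) = free_lift R M w p \<oplus>\<^bsub>M\<^esub> free_lift R M w q" .
  }
  {
    fix r p assume r: "r \<in> carrier R" and p: "p \<in> carrier (free_module R I)"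
    note [simp] = free_module_coeff[OF p]
    let ?B = "{i. p i \<noteq> \<zero>}"
    have cl: "(\<lambda>i. p i \<odot>\<^bsub>M\<^esub> w i) \<in> ?B \<rightarrow> carrier M"
      using S(2)[OF p] by (auto intro!: smult_closed Pi_mem[OF w])
    have "free_lift R M w (r \<odot>\<^bsub>free_module R I\<^esub> p) = (\<Oplus>\<^bsub>M\<^esub>i\<in>?B. (r \<otimes> p i) \<odot>\<^bsub>M\<^esub> w i)"
      by (subst free_lift_superset[OF F.smult_closed[OF r p] w S(1)[OF p] _ S(2)[OF p]]) (use r in auto)
    also have "\<dots> = (\<Oplus>\<^bsub>M\<^esub>i\<in>?B. r \<odot>\<^bsub>M\<^esub> (p i \<odot>\<^bsub>M\<^esub> w i))"
      using r S(2)[OF p] by (intro M.add.finprod_cong') (auto intro!: smult_assoc1 smult_closed Pi_mem[OF w])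
    also have "\<dots> = r \<odot>\<^bsub>M\<^esub> free_lift R M w p"
      using finsum_smult_ldistr[OF S(1)[OF p] r cl] by (simp add: free_lift_def)
    finally show "free_lift R M w (r \<odot>\<^bsub>free_module R I\<^esub> p) = r \<odot>\<^bsub>M\<^esub> free_lift R M w p" .
  }
qed

lemma free_lift_basis:
  assumes "w \<in> I \<rightarrow> carrier M" "i \<in> I"
  shows "free_lift R M w (free_basis R i) = w i"
proof -
  have "free_lift R M w (free_basis R i) = (\<Oplus>\<^bsub>M\<^esub>j\<in>{i}. free_basis R i j \<odot>\<^bsub>M\<^esub> w j)"
    using assms by (intro free_lift_superset[OF free_basis_carrier]) (auto simp: free_basis_def)
  then show ?thesis
    using assms by (auto simp: free_basis_def Pi_iff)
qed

lemma free_hom_eq_lift: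
  assumes f: "f \<in> module_hom R (free_module R I) M" and p: "p \<in> carrier (free_module R I)"
  shows "f p = free_lift R M (\<lambda>i. f (free_basis R i)) p"
proof -
  let ?F = "free_module R I" and ?B = "{i. p i \<noteq> \<zero>}"
  note [simp] = free_module_coeff[OF p]
  note S = free_module_support[OF p]
  interpret F: module R ?F by (rule free_module_module)
  have "f p = f (\<Oplus>\<^bsub>?F\<^esub>i\<in>?B. p i \<odot>\<^bsub>?F\<^esub> free_basis R i)"
    using free_module_expand[OF p S(1) _ S(2)] by simp
  also have "\<dots> = (\<Oplus>\<^bsub>M\<^esub>i\<in>?B. f (p i \<odot>\<^bsub>?F\<^esub> free_basis R i))"
    using S by (intro module_hom_finsum[OF F.module_axioms module_axioms f])
      (auto intro!: F.smult_closed free_basis_carrier simp del: free_module_simps)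
  also have "\<dots> = (\<Oplus>\<^bsub>M\<^esub>i\<in>?B. p i \<odot>\<^bsub>M\<^esub> f (free_basis R i))"
    using S
    by (intro M.add.finprod_cong')
      (auto intro!: module_hom_smult[OF f] smult_closed module_hom_closed[OF f] free_basis_carrier
        simp del: free_module_simps)
  finally show ?thesis by (simp add: free_lift_def)
qed

lemma free_hom_expand:
  assumes f: "f \<in> module_hom R (free_module R I) M" and p: "p \<in> carrier (free_module R I)"
    and "finite I"
  shows "f p = (\<Oplus>\<^bsub>M\<^esub>i\<in>I. p i \<odot>\<^bsub>M\<^esub> f (free_basis R i))"
proof -
  have "(\<lambda>i. f (free_basis R i)) \<in> I \<rightarrow> carrier M"
    by (auto intro!: module_hom_closed[OF f] free_basis_carrier)
  from free_lift_superset[OF p this assms(3) free_module_support(2)[OF p]] show ?thesis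
    by (simp add: free_hom_eq_lift[OF f p])
qed

lemma free_hom_ext:
  assumes "f \<in> module_hom R (free_module R I) M" "g \<in> module_hom R (free_module R I) M"
    and "\<And>i. i \<in> I \<Longrightarrow> f (free_basis R i) = g (free_basis R i)"
    and p: "p \<in> carrier (free_module R I)"
  shows "f p = g p"
proof -
  have "f p = free_lift R M (\<lambda>i. g (free_basis R i)) p"
    unfolding free_hom_eq_lift[OF assms(1) p] unfolding free_lift_def
    using free_module_support(2)[OF p] assms(3)
    by (intro M.add.finprod_cong')
      (auto intro!: smult_closed module_hom_closed[OF assms(2)] free_module_coeff[OF p] free_basis_carrier)
  then show ?thesis using free_hom_eq_lift[OF assms(2) p] by simp
qed

text \<open>A linear combination of elements of \<open>D\<close> stays in \<open>D\<close>. For the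
  zero submodule this says that a map vanishing on the basis vanishes, for
  \<open>linear_relations\<close> that all values of a map are relations.\<close>

lemma free_hom_vimage:
  assumes f: "f \<in> module_hom R (free_module R I) M" and D: "submodule D R M"
    and i: "\<And>i. i \<in> I \<Longrightarrow> f (free_basis R i) \<in> D" and p: "p \<in> carrier (free_module R I)"
  shows "f p \<in> D"
  unfolding free_hom_eq_lift[OF f p] free_lift_def
  using free_module_support(2)[OF p] free_module_coeff[OF p] i submoduleE(4)[OF D]
  by (intro submodule_finsum[OF D]) (auto simp: subset_iff)

end


section \<open>Quotient modules\<close>

lemma quotient_module_simps [simp]:
  "carrier (quotient_module M N) = a_rcosets\<^bsub>M\<^esub> N"
  "\<zero>\<^bsub>quotient_module M N\<^esub> = N"
  "C \<oplus>\<^bsub>quotient_module M N\<^esub> D = C <+>\<^bsub>M\<^esub> D"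
  by (simp_all add: quotient_module_def)

lemma (in abelian_group) uminus_zero: "\<ominus> \<zero> = \<zero>"
  by (simp add: a_inv_def)

lemma (in abelian_group) minus_zeroD: "\<lbrakk>x \<ominus> y = \<zero>; x \<in> carrier G; y \<in> carrier G\<rbrakk> \<Longrightarrow> x = y"
  using a_assoc[of x "\<ominus> y" y] by (simp add: a_minus_def l_neg)

context module
begin

lemma submodule_abelian_subgroup: "submodule N R M \<Longrightarrow> abelian_subgroup N M"
  by (intro abelian_subgroupI3 additive_subgroupI submodule.axioms(1) M.abelian_group_axioms)

lemma rcosets_eq: "a_rcosets\<^bsub>M\<^esub> N = (\<lambda>x. N +>\<^bsub>M\<^esub> x) ` carrier M"
  unfolding A_RCOSETS_def' a_r_coset_def' by blast

lemma coset_eq_iff: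
  assumes "submodule N R M" "x \<in> carrier M" "y \<in> carrier M"
  shows "N +>\<^bsub>M\<^esub> x = N +>\<^bsub>M\<^esub> y \<longleftrightarrow> x \<ominus>\<^bsub>M\<^esub> y \<in> N"
proof -
  interpret N: abelian_subgroup N M by (rule submodule_abelian_subgroup[OF assms(1)])
  have "N +>\<^bsub>M\<^esub> x = N +>\<^bsub>M\<^esub> y \<longleftrightarrow> x \<in> N +>\<^bsub>M\<^esub> y"
    using N.a_repr_independence'[OF _ assms(3), of x] N.a_rcos_self[OF assms(2)] by blast
  then show ?thesis
    using N.a_rcos_module[OF assms(3,2)] unfolding a_minus_def by blast
qed

lemma quotient_smult:
  assumes N: "submodule N R M" and r: "r \<in> carrier R" and x: "x \<in> carrier M"
  shows "r \<odot>\<^bsub>quotient_module M N\<^esub> (N +>\<^bsub>M\<^esub> x) = N +>\<^bsub>M\<^esub> (r \<odot>\<^bsub>M\<^esub> x)"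
proof -
  interpret N: abelian_subgroup N M by (rule submodule_abelian_subgroup[OF N])
  have "N +>\<^bsub>M\<^esub> (r \<odot>\<^bsub>M\<^esub> y) = N +>\<^bsub>M\<^esub> (r \<odot>\<^bsub>M\<^esub> x)" if "y \<in> N +>\<^bsub>M\<^esub> x" for y
  proof -
    have y: "y \<in> carrier M" "y \<ominus>\<^bsub>M\<^esub> x \<in> N"
      using N.a_elemrcos_carrier[OF x that] N.a_rcos_module_imp[OF x that] by (simp_all add: a_minus_def)
    have "r \<odot>\<^bsub>M\<^esub> y \<ominus>\<^bsub>M\<^esub> r \<odot>\<^bsub>M\<^esub> x = r \<odot>\<^bsub>M\<^esub> (y \<ominus>\<^bsub>M\<^esub> x)"
      using r x y(1) by (simp add: a_minus_def smult_r_distr smult_r_minus)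
    then show ?thesis
      using submoduleE(4)[OF N r y(2)] coset_eq_iff[OF N smult_closed[OF r y(1)] smult_closed[OF r x]]
      by simp
  qed
  \<comment> \<open>The union of a constant family over the representatives equals that constant
    only because the coset is nonempty.\<close>
  moreover have "x \<in> N +>\<^bsub>M\<^esub> x"
    using x by (rule N.a_rcos_self)
  ultimately have "(\<Union>y\<in>N +>\<^bsub>M\<^esub> x. N +>\<^bsub>M\<^esub> (r \<odot>\<^bsub>M\<^esub> y)) = N +>\<^bsub>M\<^esub> (r \<odot>\<^bsub>M\<^esub> x)"
    by blast
  then show ?thesis
    by (simp add: quotient_module_def)
qed

lemma quotient_module_module:
  assumes N: "submodule N R M"
  shows "module R (quotient_module M N)"
proof -
  interpret N: abelian_subgroup N M by (rule submodule_abelian_subgroup[OF N])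
  let ?Q = "quotient_module M N"
  have car: "\<exists>x\<in>carrier M. C = N +>\<^bsub>M\<^esub> x" if "C \<in> carrier ?Q" for C
    using that by (auto simp: rcosets_eq)
  have cl: "N +>\<^bsub>M\<^esub> x \<in> carrier ?Q" if "x \<in> carrier M" for x
    using that by (auto simp: rcosets_eq)
  have add: "(N +>\<^bsub>M\<^esub> x) \<oplus>\<^bsub>?Q\<^esub> (N +>\<^bsub>M\<^esub> y) = N +>\<^bsub>M\<^esub> (x \<oplus>\<^bsub>M\<^esub> y)"
    if "x \<in> carrier M" "y \<in> carrier M" for x y
    using N.a_rcos_sum that by simp
  have zero: "\<zero>\<^bsub>?Q\<^esub> = N +>\<^bsub>M\<^esub> \<zero>\<^bsub>M\<^esub>"
    using N.a_rcos_const[of "\<zero>\<^bsub>M\<^esub>"] submodule_zero[OF N] by simp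
  have "abelian_group ?Q"
  proof (rule abelian_groupI)
    show "\<zero>\<^bsub>?Q\<^esub> \<in> carrier ?Q"
      unfolding zero by (rule cl) simp
  next
    fix C assume "C \<in> carrier ?Q"
    then obtain x where x: "x \<in> carrier M" "C = N +>\<^bsub>M\<^esub> x" using car by blast
    show "\<zero>\<^bsub>?Q\<^esub> \<oplus>\<^bsub>?Q\<^esub> C = C"
      unfolding zero x(2) by (subst add) (use x in auto)
    have "(N +>\<^bsub>M\<^esub> (\<ominus>\<^bsub>M\<^esub> x)) \<oplus>\<^bsub>?Q\<^esub> C = \<zero>\<^bsub>?Q\<^esub>"
      unfolding zero x(2) by (subst add) (use x in \<open>auto simp: M.l_neg\<close>)
    then show "\<exists>D\<in>carrier ?Q. D \<oplus>\<^bsub>?Q\<^esub> C = \<zero>\<^bsub>?Q\<^esub>"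
      using cl[of "\<ominus>\<^bsub>M\<^esub> x"] x(1) by blast
  next
    fix C D assume C: "C \<in> carrier ?Q" and D: "D \<in> carrier ?Q"
    obtain x where x: "x \<in> carrier M" "C = N +>\<^bsub>M\<^esub> x" using car[OF C] by blast
    obtain y where y: "y \<in> carrier M" "D = N +>\<^bsub>M\<^esub> y" using car[OF D] by blast
    show "C \<oplus>\<^bsub>?Q\<^esub> D \<in> carrier ?Q"
      unfolding x(2) y(2) add[OF x(1) y(1)] using x y by (intro cl) auto
    show "C \<oplus>\<^bsub>?Q\<^esub> D = D \<oplus>\<^bsub>?Q\<^esub> C"
      unfolding x(2) y(2) add[OF x(1) y(1)] add[OF y(1) x(1)] using x y by (simp add: M.a_comm)
    fix E assume E: "E \<in> carrier ?Q"
    obtain z where z: "z \<in> carrier M" "E = N +>\<^bsub>M\<^esub> z" using car[OF E] by blast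
    note xyz = x(1) y(1) z(1)
    show "C \<oplus>\<^bsub>?Q\<^esub> D \<oplus>\<^bsub>?Q\<^esub> E = C \<oplus>\<^bsub>?Q\<^esub> (D \<oplus>\<^bsub>?Q\<^esub> E)"
      unfolding x(2) y(2) z(2) using xyz by (simp add: add M.a_assoc del: quotient_module_simps)
  qed
  then show ?thesis
  proof (rule moduleI[OF R.is_cring])
    fix a C assume a: "a \<in> carrier R" and C: "C \<in> carrier ?Q"
    obtain x where x: "x \<in> carrier M" "C = N +>\<^bsub>M\<^esub> x" using car[OF C] by blast
    show "a \<odot>\<^bsub>?Q\<^esub> C \<in> carrier ?Q"
      unfolding x(2) quotient_smult[OF N a x(1)] using a x by (intro cl) auto
    fix b assume b: "b \<in> carrier R"
    show "(a \<oplus> b) \<odot>\<^bsub>?Q\<^esub> C = a \<odot>\<^bsub>?Q\<^esub> C \<oplus>\<^bsub>?Q\<^esub> b \<odot>\<^bsub>?Q\<^esub> C"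
      unfolding x(2) using a b x(1)
      by (simp add: add quotient_smult[OF N] smult_l_distr del: quotient_module_simps)
    show "a \<otimes> b \<odot>\<^bsub>?Q\<^esub> C = a \<odot>\<^bsub>?Q\<^esub> (b \<odot>\<^bsub>?Q\<^esub> C)"
      unfolding x(2) using a b x(1)
      by (simp add: quotient_smult[OF N] smult_assoc1 del: quotient_module_simps)
  next
    fix a C D assume a: "a \<in> carrier R" and C: "C \<in> carrier ?Q" and D: "D \<in> carrier ?Q"
    obtain x where x: "x \<in> carrier M" "C = N +>\<^bsub>M\<^esub> x" using car[OF C] by blast
    obtain y where y: "y \<in> carrier M" "D = N +>\<^bsub>M\<^esub> y" using car[OF D] by blast
    show "a \<odot>\<^bsub>?Q\<^esub> (C \<oplus>\<^bsub>?Q\<^esub> D) = a \<odot>\<^bsub>?Q\<^esub> C \<oplus>\<^bsub>?Q\<^esub> a \<odot>\<^bsub>?Q\<^esub> D"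
      unfolding x(2) y(2) using a x(1) y(1)
      by (simp add: add quotient_smult[OF N] smult_r_distr del: quotient_module_simps)
  next
    fix C assume C: "C \<in> carrier ?Q"
    obtain x where x: "x \<in> carrier M" "C = N +>\<^bsub>M\<^esub> x" using car[OF C] by blast
    show "\<one> \<odot>\<^bsub>?Q\<^esub> C = C"
      unfolding x(2) using x(1)
      by (simp add: quotient_smult[OF N] del: quotient_module_simps)
  qed
qed

lemma quotient_hom:
  assumes N: "submodule N R M"
  shows "(\<lambda>x. N +>\<^bsub>M\<^esub> x) \<in> module_hom R M (quotient_module M N)"
proof -
  interpret N: abelian_subgroup N M by (rule submodule_abelian_subgroup[OF N])
  show ?thesis
  proof (rule module_homI)
    show "N +>\<^bsub>M\<^esub> x \<in> carrier (quotient_module M N)" if "x \<in> carrier M" for x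
      using that by (simp add: rcosets_eq)
    show "N +>\<^bsub>M\<^esub> (x \<oplus>\<^bsub>M\<^esub> y) = (N +>\<^bsub>M\<^esub> x) \<oplus>\<^bsub>quotient_module M N\<^esub> (N +>\<^bsub>M\<^esub> y)"
      if "x \<in> carrier M" "y \<in> carrier M" for x y
      unfolding quotient_module_simps by (rule N.a_rcos_sum[OF that, symmetric])
    show "N +>\<^bsub>M\<^esub> (r \<odot>\<^bsub>M\<^esub> x) = r \<odot>\<^bsub>quotient_module M N\<^esub> (N +>\<^bsub>M\<^esub> x)"
      if "r \<in> carrier R" "x \<in> carrier M" for r x
      by (rule quotient_smult[OF N that, symmetric])
  qed
qed

lemma coset_eq_zero_iff:
  assumes "submodule N R M" "x \<in> carrier M"
  shows "N +>\<^bsub>M\<^esub> x = N \<longleftrightarrow> x \<in> N"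
proof -
  interpret N: abelian_subgroup N M by (rule submodule_abelian_subgroup[OF assms(1)])
  have "N +>\<^bsub>M\<^esub> \<zero>\<^bsub>M\<^esub> = N"
    using N.a_rcos_const[of "\<zero>\<^bsub>M\<^esub>"] submodule_zero[OF assms(1)] by simp
  then show ?thesis
    using coset_eq_iff[OF assms M.zero_closed] assms(2) by (simp add: a_minus_def M.uminus_zero)
qed

lemma coset_subset_carrier:
  "\<lbrakk>submodule N R M; x \<in> carrier M; y \<in> N +>\<^bsub>M\<^esub> x\<rbrakk> \<Longrightarrow> y \<in> carrier M \<and> y \<ominus>\<^bsub>M\<^esub> x \<in> N"
  unfolding a_minus_def
  by (rule conjI, rule abelian_subgroup.a_elemrcos_carrier[OF submodule_abelian_subgroup], assumption+,
    rule abelian_subgroup.a_rcos_module_imp[OF submodule_abelian_subgroup], assumption+)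

end


section \<open>Tensor products\<close>

text \<open>The generating set inside \<open>tensor_relations\<close> gets a name so that the
  minimality of the generated submodule can be applied to it.\<close>

definition tensor_generators ::
  "('r, 'x) ring_scheme \<Rightarrow> ('r, 'm, 'y) module_scheme \<Rightarrow> ('r, 'n, 'z) module_scheme
    \<Rightarrow> ('m \<times> 'n \<Rightarrow> 'r) set"
  where "tensor_generators R M N =
    (let F = tensor_free R M N; e = (\<lambda>m n. free_basis R (m, n)) in
       {e (m \<oplus>\<^bsub>M\<^esub> m') n \<ominus>\<^bsub>F\<^esub> (e m n \<oplus>\<^bsub>F\<^esub> e m' n) | m m' n.
           m \<in> carrier M \<and> m' \<in> carrier M \<and> n \<in> carrier N} \<union>
        {e m (n \<oplus>\<^bsub>N\<^esub> n') \<ominus>\<^bsub>F\<^esub> (e m n \<oplus>\<^bsub>F\<^esub> e m n') | m n n'.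
           m \<in> carrier M \<and> n \<in> carrier N \<and> n' \<in> carrier N} \<union>
        {e (r \<odot>\<^bsub>M\<^esub> m) n \<ominus>\<^bsub>F\<^esub> (r \<odot>\<^bsub>F\<^esub> e m n) | r m n.
           r \<in> carrier R \<and> m \<in> carrier M \<and> n \<in> carrier N} \<union>
        {e m (r \<odot>\<^bsub>N\<^esub> n) \<ominus>\<^bsub>F\<^esub> (r \<odot>\<^bsub>F\<^esub> e m n) | r m n.
           r \<in> carrier R \<and> m \<in> carrier M \<and> n \<in> carrier N})"

lemma tensor_relations_eq:
  "tensor_relations R M N = generated_submodule R (tensor_free R M N) (tensor_generators R M N)"
  by (simp add: tensor_relations_def tensor_generators_def Let_def)

locale module_pair = M: module R M + N: module R N
  for R (structure) and M and N
begin

abbreviation F where "F \<equiv> tensor_free R M N"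
abbreviation T where "T \<equiv> tensor_product R M N"
abbreviation K where "K \<equiv> tensor_relations R M N"
abbreviation pure (infix \<open>\<bowtie>\<close> 75) where "m \<bowtie> n \<equiv> pure_tensor R M N m n"

lemma F_module: "module R F"
  unfolding tensor_free_def by (rule M.R.free_module_module)

sublocale F: module R F by (rule F_module)

lemma F_basis: "\<lbrakk>m \<in> carrier M; n \<in> carrier N\<rbrakk> \<Longrightarrow> free_basis R (m, n) \<in> carrier F"
  unfolding tensor_free_def by (intro M.R.free_basis_carrier) simp

lemma tensor_generators_subset: "tensor_generators R M N \<subseteq> carrier F"
proof -
  note c = F.M.minus_closed F.M.add.m_closed F.smult_closed F_basis
    M.M.add.m_closed N.M.add.m_closed M.smult_closed N.smult_closed
  show ?thesis
    unfolding tensor_generators_def Let_def by (rule Un_least)+ (safe intro!: c)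
qed

lemma K_submodule: "submodule K R F"
  unfolding tensor_relations_eq
  by (rule F.generated_submodule_submodule[OF tensor_generators_subset])

sublocale T: module R T
  unfolding tensor_product_def by (rule F.quotient_module_module[OF K_submodule])

lemma coset_hom: "(\<lambda>p. K +>\<^bsub>F\<^esub> p) \<in> module_hom R F T"
  unfolding tensor_product_def by (rule F.quotient_hom[OF K_submodule])

lemma T_carrier: "carrier T = (\<lambda>p. K +>\<^bsub>F\<^esub> p) ` carrier F"
  unfolding tensor_product_def by (simp add: F.rcosets_eq)

lemma coset_eq_zero_iff: "p \<in> carrier F \<Longrightarrow> K +>\<^bsub>F\<^esub> p = \<zero>\<^bsub>T\<^esub> \<longleftrightarrow> p \<in> K"
  using F.coset_eq_zero_iff[OF K_submodule] by (simp add: tensor_product_def)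

lemma pure_closed [simp, intro]: "\<lbrakk>m \<in> carrier M; n \<in> carrier N\<rbrakk> \<Longrightarrow> m \<bowtie> n \<in> carrier T"
  unfolding pure_tensor_def by (rule module_hom_closed[OF coset_hom F_basis])

lemma pure_eqI:
  assumes "p \<in> carrier F" "q \<in> carrier F" "p \<ominus>\<^bsub>F\<^esub> q \<in> tensor_generators R M N"
  shows "K +>\<^bsub>F\<^esub> p = K +>\<^bsub>F\<^esub> q"
proof -
  have "p \<ominus>\<^bsub>F\<^esub> q \<in> K"
    unfolding tensor_relations_eq by (rule subsetD[OF generated_submodule_incl assms(3)])
  then show ?thesis
    using F.coset_eq_iff[OF K_submodule assms(1,2)] by blast
qed

lemma pure_add_left:
  assumes "m \<in> carrier M" "m' \<in> carrier M" "n \<in> carrier N"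
  shows "(m \<oplus>\<^bsub>M\<^esub> m') \<bowtie> n = m \<bowtie> n \<oplus>\<^bsub>T\<^esub> m' \<bowtie> n"
proof -
  note e = F_basis[OF assms(1,3)] F_basis[OF assms(2,3)] F_basis[OF M.M.add.m_closed[OF assms(1,2)] assms(3)]
  show ?thesis
    unfolding pure_tensor_def module_hom_add[OF coset_hom e(1,2), symmetric]
    using e(3) F.M.add.m_closed[OF e(1,2)]
    by (rule pure_eqI) (unfold tensor_generators_def Let_def, use assms in blast)
qed

lemma pure_add_right:
  assumes "m \<in> carrier M" "n \<in> carrier N" "n' \<in> carrier N"
  shows "m \<bowtie> (n \<oplus>\<^bsub>N\<^esub> n') = m \<bowtie> n \<oplus>\<^bsub>T\<^esub> m \<bowtie> n'"
proof -
  note e = F_basis[OF assms(1,2)] F_basis[OF assms(1,3)] F_basis[OF assms(1) N.M.add.m_closed[OF assms(2,3)]]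
  show ?thesis
    unfolding pure_tensor_def module_hom_add[OF coset_hom e(1,2), symmetric]
    using e(3) F.M.add.m_closed[OF e(1,2)]
    by (rule pure_eqI) (unfold tensor_generators_def Let_def, use assms in blast)
qed

lemma pure_smult_left:
  assumes "r \<in> carrier R" "m \<in> carrier M" "n \<in> carrier N"
  shows "(r \<odot>\<^bsub>M\<^esub> m) \<bowtie> n = r \<odot>\<^bsub>T\<^esub> (m \<bowtie> n)"
proof -
  note e = F_basis[OF assms(2,3)] F_basis[OF M.smult_closed[OF assms(1,2)] assms(3)]
  show ?thesis
    unfolding pure_tensor_def module_hom_smult[OF coset_hom assms(1) e(1), symmetric]
    using e(2) F.smult_closed[OF assms(1) e(1)]
    by (rule pure_eqI) (unfold tensor_generators_def Let_def, use assms in blast)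
qed

lemma pure_smult_right:
  assumes "r \<in> carrier R" "m \<in> carrier M" "n \<in> carrier N"
  shows "m \<bowtie> (r \<odot>\<^bsub>N\<^esub> n) = r \<odot>\<^bsub>T\<^esub> (m \<bowtie> n)"
proof -
  note e = F_basis[OF assms(2,3)] F_basis[OF assms(2) N.smult_closed[OF assms(1,3)]]
  show ?thesis
    unfolding pure_tensor_def module_hom_smult[OF coset_hom assms(1) e(1), symmetric]
    using e(2) F.smult_closed[OF assms(1) e(1)]
    by (rule pure_eqI) (unfold tensor_generators_def Let_def, use assms in blast)
qed

lemma pure_hom_left: "n \<in> carrier N \<Longrightarrow> (\<lambda>m. m \<bowtie> n) \<in> module_hom R M T"
  by (rule module_homI) (auto simp: pure_add_left pure_smult_left)

text \<open>The coset map sends the basis of the free module to the pure tensors, so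
  \<open>D\<close> contains the image of the whole free module.\<close>

lemma tensor_submodule_eq:
  assumes D: "submodule D R T" and pure: "\<And>m n. \<lbrakk>m \<in> carrier M; n \<in> carrier N\<rbrakk> \<Longrightarrow> m \<bowtie> n \<in> D"
  shows "D = carrier T"
proof
  show "D \<subseteq> carrier T" by (rule T.submoduleE(1)[OF D])
  show "carrier T \<subseteq> D"
    unfolding T_carrier
  proof (rule image_subsetI)
    fix p assume p: "p \<in> carrier F"
    have e: "K +>\<^bsub>F\<^esub> free_basis R i \<in> D" if "i \<in> carrier M \<times> carrier N" for i
      using that pure[of "fst i" "snd i"] by (auto simp: pure_tensor_def)
    show "K +>\<^bsub>F\<^esub> p \<in> D"
      by (rule T.free_hom_vimage[OF coset_hom[unfolded tensor_free_def] D e[unfolded tensor_free_def]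
            p[unfolded tensor_free_def], folded tensor_free_def])
  qed
qed

text \<open>The elements \<open>p\<close> of the free module whose family of values lies in
  \<open>D\<close> form a submodule that contains the four kinds of generators, hence all of
  \<open>K\<close>. Families indexed by \<open>g\<close>, and a set \<open>D\<close> of such
  families, let one argument serve twice: for \<open>tensor_map\<close> being well defined, where
  \<open>D\<close> holds the zero family alone, and for \<open>tensor_vanish\<close>, where
  \<open>D\<close> is the \<open>coefficient_span\<close>.\<close>

lemma tensor_relations_lift:
  fixes Y (structure)
  assumes Y: "module R Y"
    and \<gamma>: "\<And>g. \<gamma> g \<in> carrier M \<times> carrier N \<rightarrow> carrier Y"
    and D0: "(\<lambda>g. \<zero>\<^bsub>Y\<^esub>) \<in> D"
    and Dadd: "\<And>u v. \<lbrakk>u \<in> D; v \<in> D\<rbrakk> \<Longrightarrow> (\<lambda>g. u g \<oplus>\<^bsub>Y\<^esub> v g) \<in> D"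
    and Dsm: "\<And>r u. \<lbrakk>r \<in> carrier R; u \<in> D\<rbrakk> \<Longrightarrow> (\<lambda>g. r \<odot>\<^bsub>Y\<^esub> u g) \<in> D"
    and al: "\<And>m m' n. \<lbrakk>m \<in> carrier M; m' \<in> carrier M; n \<in> carrier N\<rbrakk> \<Longrightarrow>
      (\<lambda>g. \<gamma> g (m \<oplus>\<^bsub>M\<^esub> m', n) \<ominus>\<^bsub>Y\<^esub> (\<gamma> g (m, n) \<oplus>\<^bsub>Y\<^esub> \<gamma> g (m', n))) \<in> D"
    and ar: "\<And>m n n'. \<lbrakk>m \<in> carrier M; n \<in> carrier N; n' \<in> carrier N\<rbrakk> \<Longrightarrow>
      (\<lambda>g. \<gamma> g (m, n \<oplus>\<^bsub>N\<^esub> n') \<ominus>\<^bsub>Y\<^esub> (\<gamma> g (m, n) \<oplus>\<^bsub>Y\<^esub> \<gamma> g (m, n'))) \<in> D"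
    and sl: "\<And>r m n. \<lbrakk>r \<in> carrier R; m \<in> carrier M; n \<in> carrier N\<rbrakk> \<Longrightarrow>
      (\<lambda>g. \<gamma> g (r \<odot>\<^bsub>M\<^esub> m, n) \<ominus>\<^bsub>Y\<^esub> r \<odot>\<^bsub>Y\<^esub> \<gamma> g (m, n)) \<in> D"
    and sr: "\<And>r m n. \<lbrakk>r \<in> carrier R; m \<in> carrier M; n \<in> carrier N\<rbrakk> \<Longrightarrow>
      (\<lambda>g. \<gamma> g (m, r \<odot>\<^bsub>N\<^esub> n) \<ominus>\<^bsub>Y\<^esub> r \<odot>\<^bsub>Y\<^esub> \<gamma> g (m, n)) \<in> D"
    and p: "p \<in> K"
  shows "(\<lambda>g. free_lift R Y (\<gamma> g) p) \<in> D"
proof -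
  interpret Y: module R Y by fact
  let ?L = "\<lambda>g. free_lift R Y (\<gamma> g)"
  have L: "?L g \<in> module_hom R F Y" for g
    unfolding tensor_free_def by (rule Y.free_lift_hom[OF \<gamma>])
  have e: "?L g (free_basis R (m, n)) = \<gamma> g (m, n)" if "m \<in> carrier M" "n \<in> carrier N" for g m n
    by (rule Y.free_lift_basis[OF \<gamma>]) (use that in simp)
  note hom = module_hom_add[OF L] module_hom_smult[OF L] module_hom_minus[OF F_module Y L]
    module_hom_zero[OF F_module Y L]
  let ?W = "{p \<in> carrier F. (\<lambda>g. ?L g p) \<in> D}"
  have smW: "r \<odot>\<^bsub>F\<^esub> p \<in> ?W" if "r \<in> carrier R" "p \<in> ?W" for r p
    using that Dsm[of r "\<lambda>g. ?L g p"] by (simp add: hom)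
  have W: "submodule ?W R F"
  proof (rule F.submoduleI)
    \<comment> \<open>\<open>D\<close> is given as closed under sums and scalar multiples; negatives
      come from the scalar \<open>\<ominus> \<one>\<close>.\<close>
    fix p assume p: "p \<in> ?W"
    have "\<ominus>\<^bsub>F\<^esub> p = (\<ominus> \<one>) \<odot>\<^bsub>F\<^esub> p"
      using p by (simp add: F.smult_l_minus)
    then show "\<ominus>\<^bsub>F\<^esub> p \<in> ?W"
      using smW[OF _ p, of "\<ominus> \<one>"] by simp
  next
    fix p q assume "p \<in> ?W" "q \<in> ?W"
    then show "p \<oplus>\<^bsub>F\<^esub> q \<in> ?W"
      using Dadd[of "\<lambda>g. ?L g p" "\<lambda>g. ?L g q"] by (simp add: hom)
  qed (use smW D0 in \<open>auto simp: hom\<close>)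
  have "p \<in> ?W" if "p \<in> tensor_generators R M N" for p
  proof -
    have "p \<in> carrier F" using that tensor_generators_subset by blast
    with that show ?thesis
      unfolding tensor_generators_def Let_def
      by (auto simp: hom e F_basis al ar sl sr)
  qed
  then have "K \<subseteq> ?W"
    unfolding tensor_relations_eq by (intro generated_submodule_minimal W) auto
  then show ?thesis using p by auto
qed

end

section \<open>Functoriality of the tensor product\<close>

locale module_pair_hom = S: module_pair R M N + S': module_pair R M' N'
  for R (structure) and M and N and M' and N' +
  fixes f and g
  assumes f: "f \<in> module_hom R M M'" and g: "g \<in> module_hom R N N'"
begin

text \<open>By bilinearity the lift kills the tensor relations, so it is constant on a coset, and
  the union in \<open>tensor_map\<close> runs over copies of one set.\<close>

lemma tensor_map_coset:
  assumes p: "p \<in> carrier S.F"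
  shows "tensor_map R M' N' f g (S.K +>\<^bsub>S.F\<^esub> p)
    = free_lift R S'.T (\<lambda>i. pure_tensor R M' N' (f (fst i)) (g (snd i))) p"
proof -
  let ?w = "\<lambda>i. pure_tensor R M' N' (f (fst i)) (g (snd i))"
  let ?L = "free_lift R S'.T ?w"
  note fg = module_hom_closed[OF f] module_hom_closed[OF g]
  have w: "?w \<in> carrier M \<times> carrier N \<rightarrow> carrier S'.T"
    using fg by auto
  have L: "?L \<in> module_hom R S.F S'.T"
    unfolding tensor_free_def[of R M N] by (rule S'.T.free_lift_hom[OF w])
  have zero: "?L q = \<zero>\<^bsub>S'.T\<^esub>" if "q \<in> S.K" for q
  proof -
    \<comment> \<open>A single map is seen as a family over \<open>unit\<close>; with the zero
      family as the only member of \<open>D\<close>, membership means vanishing.\<close>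
    have "(\<lambda>u::unit. ?L q) \<in> {\<lambda>u. \<zero>\<^bsub>S'.T\<^esub>}"
      by (rule S.tensor_relations_lift[OF S'.T.module_axioms _ _ _ _ _ _ _ _ that])
        (use w fg in \<open>auto simp: module_hom_add[OF f] module_hom_add[OF g] module_hom_smult[OF f]
          module_hom_smult[OF g] S'.pure_add_left S'.pure_add_right S'.pure_smult_left
          S'.pure_smult_right S'.T.r_neg a_minus_def\<close>)
    then show ?thesis by (simp add: fun_eq_iff)
  qed
  have "?L q = ?L p" if "q \<in> S.K +>\<^bsub>S.F\<^esub> p" for q
  proof -
    have q: "q \<in> carrier S.F" "q \<ominus>\<^bsub>S.F\<^esub> p \<in> S.K"
      using S.F.coset_subset_carrier[OF S.K_submodule p that] by auto
    have "?L q \<ominus>\<^bsub>S'.T\<^esub> ?L p = \<zero>\<^bsub>S'.T\<^esub>"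
      using zero[OF q(2)] module_hom_minus[OF S.F_module S'.T.module_axioms L q(1) p] by simp
    then show ?thesis
      by (rule S'.T.M.minus_zeroD[OF _ module_hom_closed[OF L q(1)] module_hom_closed[OF L p]])
  qed
  then have "\<forall>q\<in>S.K +>\<^bsub>S.F\<^esub> p. ?L q = ?L p"
    by blast
  then show ?thesis
    unfolding tensor_map_def Let_def free_lift_def[symmetric]
    by (rule UN_constant_eq[OF abelian_subgroup.a_rcos_self[OF
          S.F.submodule_abelian_subgroup[OF S.K_submodule] p]])
qed

lemma tensor_map_hom: "tensor_map R M' N' f g \<in> module_hom R S.T S'.T"
proof -
  let ?w = "\<lambda>i. pure_tensor R M' N' (f (fst i)) (g (snd i))"
  have w: "?w \<in> carrier M \<times> carrier N \<rightarrow> carrier S'.T"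
    using module_hom_closed[OF f] module_hom_closed[OF g] by auto
  have L: "free_lift R S'.T ?w \<in> module_hom R S.F S'.T"
    unfolding tensor_free_def[of R M N] by (rule S'.T.free_lift_hom[OF w])
  show ?thesis
  proof (rule module_homI)
    fix x assume "x \<in> carrier S.T"
    then obtain p where p: "p \<in> carrier S.F" "x = S.K +>\<^bsub>S.F\<^esub> p" by (auto simp: S.T_carrier)
    show "tensor_map R M' N' f g x \<in> carrier S'.T"
      using p module_hom_closed[OF L] by (simp add: tensor_map_coset)
    fix y assume "y \<in> carrier S.T"
    then obtain q where q: "q \<in> carrier S.F" "y = S.K +>\<^bsub>S.F\<^esub> q" by (auto simp: S.T_carrier)
    show "tensor_map R M' N' f g (x \<oplus>\<^bsub>S.T\<^esub> y) = tensor_map R M' N' f g x \<oplus>\<^bsub>S'.T\<^esub> tensor_map R M' N' f g y"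
      using p q module_hom_add[OF L] S.F.add.m_closed[OF p(1) q(1)]
      by (simp add: tensor_map_coset module_hom_add[OF S.coset_hom, symmetric])
  next
    fix r x assume r: "r \<in> carrier R" and "x \<in> carrier S.T"
    then obtain p where p: "p \<in> carrier S.F" "x = S.K +>\<^bsub>S.F\<^esub> p" by (auto simp: S.T_carrier)
    show "tensor_map R M' N' f g (r \<odot>\<^bsub>S.T\<^esub> x) = r \<odot>\<^bsub>S'.T\<^esub> tensor_map R M' N' f g x"
      using p r module_hom_smult[OF L] S.F.smult_closed[OF r p(1)]
      by (simp add: tensor_map_coset module_hom_smult[OF S.coset_hom, symmetric])
  qed
qed

lemma tensor_map_pure:
  assumes "m \<in> carrier M" "n \<in> carrier N"
  shows "tensor_map R M' N' f g (pure_tensor R M N m n) = pure_tensor R M' N' (f m) (g n)"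
proof -
  have w: "(\<lambda>i. pure_tensor R M' N' (f (fst i)) (g (snd i))) \<in> carrier M \<times> carrier N \<rightarrow> carrier S'.T"
    using module_hom_closed[OF f] module_hom_closed[OF g] by auto
  have "tensor_map R M' N' f g (pure_tensor R M N m n)
      = free_lift R S'.T (\<lambda>i. pure_tensor R M' N' (f (fst i)) (g (snd i))) (free_basis R (m, n))"
    unfolding pure_tensor_def[of R M N] using assms by (simp add: tensor_map_coset S.F_basis)
  also have "\<dots> = pure_tensor R M' N' (f m) (g n)"
    by (subst S'.T.free_lift_basis[OF w]) (use assms in auto)
  finally show ?thesis .
qed

end


section \<open>Relations among generators\<close>

definition linear_relations ::
  "('r, 'x) ring_scheme \<Rightarrow> ('r, 'm, 'y) module_scheme \<Rightarrow> 'm set \<Rightarrow> ('m \<Rightarrow> 'r) set"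
  where "linear_relations R M G =
    {v \<in> carrier (free_module R G). free_lift R M (\<lambda>g. g) v = \<zero>\<^bsub>M\<^esub>}"

text \<open>For a submodule \<open>V\<close> of R^G this is the image of V \<otimes> N in N^G. Zero
  arises by \<open>base\<close> from the zero relation, and a scalar multiple by moving the scalar
  into \<open>n\<close>.\<close>

inductive_set coefficient_span ::
  "('r, 'n, 'y) module_scheme \<Rightarrow> ('i \<Rightarrow> 'r) set \<Rightarrow> ('i \<Rightarrow> 'n) set"
  for N and V
  where
    base: "\<lbrakk>k \<in> V; n \<in> carrier N\<rbrakk> \<Longrightarrow> (\<lambda>i. k i \<odot>\<^bsub>N\<^esub> n) \<in> coefficient_span N V"
  | add: "\<lbrakk>u \<in> coefficient_span N V; v \<in> coefficient_span N V\<rbrakk>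
      \<Longrightarrow> (\<lambda>i. u i \<oplus>\<^bsub>N\<^esub> v i) \<in> coefficient_span N V"

context module
begin

lemma coefficient_span_closed:
  assumes V: "\<forall>k\<in>V. \<forall>i. k i \<in> carrier R" and "u \<in> coefficient_span M V"
  shows "u i \<in> carrier M"
  using assms(2) by induction (use V in auto)

lemma coefficient_span_smult:
  assumes V: "\<forall>k\<in>V. \<forall>i. k i \<in> carrier R" and r: "r \<in> carrier R"
    and "u \<in> coefficient_span M V"
  shows "(\<lambda>i. r \<odot>\<^bsub>M\<^esub> u i) \<in> coefficient_span M V"
  using assms(3)
proof induction
  case (base k n)
  have "(\<lambda>i. r \<odot>\<^bsub>M\<^esub> (k i \<odot>\<^bsub>M\<^esub> n)) = (\<lambda>i. k i \<odot>\<^bsub>M\<^esub> (r \<odot>\<^bsub>M\<^esub> n))"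
    using base V r by (simp add: fun_eq_iff smult_assoc1[symmetric] R.m_comm)
  then show ?case
    using coefficient_span.base[OF base(1) smult_closed[OF r base(2)]] by simp
next
  case (add u v)
  have "(\<lambda>i. r \<odot>\<^bsub>M\<^esub> (u i \<oplus>\<^bsub>M\<^esub> v i)) = (\<lambda>i. r \<odot>\<^bsub>M\<^esub> u i \<oplus>\<^bsub>M\<^esub> r \<odot>\<^bsub>M\<^esub> v i)"
    using smult_r_distr[OF r coefficient_span_closed[OF V add(1)] coefficient_span_closed[OF V add(2)]]
    by blast
  then show ?case
    using coefficient_span.add[OF add.IH] by simp
qed

end

section \<open>The presentation of a finitely generated module\<close>

locale generated_module = module +
  fixes G
  assumes finite_G: "finite G" and G_subset: "G \<subseteq> carrier M"
    and generated: "generated_submodule R M G = carrier M"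
begin

abbreviation FG where "FG \<equiv> free_module R G"
abbreviation \<pi> where "\<pi> \<equiv> free_lift R M (\<lambda>g. g)"
abbreviation V where "V \<equiv> linear_relations R M G"

lemma G_Pi: "(\<lambda>g. g) \<in> G \<rightarrow> carrier M"
  using G_subset by auto

sublocale FG: module R FG
  by (rule R.free_module_module)

lemma \<pi>_hom: "\<pi> \<in> module_hom R FG M"
  by (rule free_lift_hom[OF G_Pi])

lemma \<pi>_basis: "g \<in> G \<Longrightarrow> \<pi> (free_basis R g) = g"
  by (rule free_lift_basis[OF G_Pi])

lemma \<pi>_surj: "\<pi> ` carrier FG = carrier M"
proof
  show "\<pi> ` carrier FG \<subseteq> carrier M"
    using module_hom_closed[OF \<pi>_hom] by blast
  have "G \<subseteq> \<pi> ` carrier FG"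
    using \<pi>_basis[symmetric] R.free_basis_carrier by (intro subsetI image_eqI) auto
  then show "carrier M \<subseteq> \<pi> ` carrier FG"
    using generated_submodule_minimal[OF submodule_image[OF FG.module_axioms module_axioms \<pi>_hom]]
    by (simp add: generated[symmetric])
qed

lemma V_submodule: "submodule V R FG"
  using submodule_vimage[OF FG.module_axioms module_axioms \<pi>_hom zero_submodule]
  by (simp add: linear_relations_def)

lemma V_iff: "v \<in> V \<longleftrightarrow> v \<in> carrier FG \<and> \<pi> v = \<zero>\<^bsub>M\<^esub>"
  by (simp add: linear_relations_def)

lemma FG_coeff: "v \<in> carrier FG \<Longrightarrow> v i \<in> carrier R"
  by (rule R.free_module_coeff)

lemma V_coeff: "\<forall>v\<in>V. \<forall>i. v i \<in> carrier R"
  by (auto simp: V_iff intro: FG_coeff)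

lemma \<pi>_expand: "v \<in> carrier FG \<Longrightarrow> \<pi> v = (\<Oplus>\<^bsub>M\<^esub>g\<in>G. v g \<odot>\<^bsub>M\<^esub> g)"
  by (rule free_lift_superset[OF _ G_Pi finite_G]) (auto dest: free_module_outside)

lemma minus_mem_V:
  "\<lbrakk>v \<in> carrier FG; w \<in> carrier FG; \<pi> v = \<pi> w\<rbrakk> \<Longrightarrow> v \<ominus>\<^bsub>FG\<^esub> w \<in> V"
  using FG.M.minus_closed[of v w] module_hom_closed[OF \<pi>_hom, of w]
    module_hom_minus[OF FG.module_axioms module_axioms \<pi>_hom, of v w]
  unfolding V_iff by (simp add: M.r_neg M.minus_eq del: free_module_simps)

end

section \<open>Right exactness of the tensor product in coordinates\<close>

locale generated_tensor = generated_module R M G + module_pair R M N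
  for R (structure) and M and G and N
begin

text \<open>Choose a preimage \<open>c m\<close> in \<open>FG\<close> of every \<open>m\<close>. The
  map \<open>c\<close> is linear up to errors in \<open>V\<close>, so sending (m, n) to the family c
  m h \<cdot> n is bilinear modulo \<open>coefficient_span\<close>, and its extension maps all
  tensor relations into that span. On the representative of \<Sum> g \<otimes> u g, which is a
  relation by assumption, it returns \<open>u\<close>.\<close>

lemma tensor_vanish:
  assumes u: "u \<in> G \<rightarrow> carrier N" and zero: "(\<Oplus>\<^bsub>T\<^esub>g\<in>G. pure_tensor R M N g (u g)) = \<zero>\<^bsub>T\<^esub>"
  shows "(\<lambda>h. if h \<in> G then u h else \<zero>\<^bsub>N\<^esub>) \<in> coefficient_span N V"
proof -
  \<comment> \<open>On \<open>G\<close> the preimage is fixed to be the basis vector, so that the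
    final evaluation returns \<open>u\<close> exactly; elsewhere any preimage will do.\<close>
  define c where "c m = (if m \<in> G then free_basis R m else SOME v. v \<in> carrier FG \<and> \<pi> v = m)" for m
  have c: "c m \<in> carrier FG" "\<pi> (c m) = m" if "m \<in> carrier M" for m
  proof -
    have "\<exists>v. v \<in> carrier FG \<and> \<pi> v = m"
      using that \<pi>_surj by (metis imageE)
    from someI_ex[OF this] show "c m \<in> carrier FG" "\<pi> (c m) = m"
      by (auto simp: c_def \<pi>_basis R.free_basis_carrier)
  qed
  note cc = FG_coeff[OF c(1)]
  define \<gamma> where "\<gamma> h i = c (fst i) h \<odot>\<^bsub>N\<^esub> snd i" for h i
  have \<gamma>: "\<gamma> h \<in> carrier M \<times> carrier N \<rightarrow> carrier N" for h
    by (auto simp: \<gamma>_def cc)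
  have zN: "(\<lambda>g. \<zero>\<^bsub>N\<^esub>) \<in> coefficient_span N V"
    using coefficient_span.base[OF submodule_zero[OF V_submodule], of "\<zero>\<^bsub>N\<^esub>" N] by simp
  define p where "p = (\<Oplus>\<^bsub>F\<^esub>g\<in>G. free_basis R (g, u g))"
  have e: "(\<lambda>g. free_basis R (g, u g)) \<in> G \<rightarrow> carrier F"
    using u G_subset by (auto intro!: F_basis)
  have p: "p \<in> carrier F"
    unfolding p_def by (rule F.M.finsum_closed[OF e])
  have "K +>\<^bsub>F\<^esub> p = \<zero>\<^bsub>T\<^esub>"
    unfolding p_def module_hom_finsum[OF F_module T.module_axioms coset_hom e]
    using zero by (simp add: pure_tensor_def)
  then have pK: "p \<in> K"
    using coset_eq_zero_iff[OF p] by simp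
  have span: "(\<lambda>h. free_lift R N (\<gamma> h) p) \<in> coefficient_span N V"
  proof (rule tensor_relations_lift[OF N.module_axioms \<gamma> zN coefficient_span.add _ _ _ _ _ pK])
    show "(\<lambda>g. r \<odot>\<^bsub>N\<^esub> u g) \<in> coefficient_span N V"
      if "r \<in> carrier R" "u \<in> coefficient_span N V" for r u
      by (rule N.coefficient_span_smult[OF V_coeff that])
  next
    fix m m' n assume m: "m \<in> carrier M" "m' \<in> carrier M" and n: "n \<in> carrier N"
    \<comment> \<open>The failure of \<open>c\<close> to be additive is itself a relation, so its
      product with \<open>n\<close> is a \<open>base\<close> element of the span.\<close>
    let ?k = "c (m \<oplus>\<^bsub>M\<^esub> m') \<ominus>\<^bsub>FG\<^esub> (c m \<oplus>\<^bsub>FG\<^esub> c m')"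
    have mm: "m \<oplus>\<^bsub>M\<^esub> m' \<in> carrier M" using m by simp
    have "\<pi> (c m \<oplus>\<^bsub>FG\<^esub> c m') = m \<oplus>\<^bsub>M\<^esub> m'"
      unfolding module_hom_add[OF \<pi>_hom c(1)[OF m(1)] c(1)[OF m(2)]] c(2)[OF m(1)] c(2)[OF m(2)] ..
    then have "?k \<in> V"
      using c(2)[OF mm] by (intro minus_mem_V FG.M.add.m_closed c(1) mm m) (rule trans, assumption, rule sym)
    moreover have "?k h = c (m \<oplus>\<^bsub>M\<^esub> m') h \<ominus> (c m h \<oplus> c m' h)" for h
      using fun_cong[OF R.free_module_minus[OF c(1)[OF mm] FG.M.add.m_closed[OF c(1)[OF m(1)] c(1)[OF m(2)]]]]
      by simp
    then have "?k h \<odot>\<^bsub>N\<^esub> n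
        = \<gamma> h (m \<oplus>\<^bsub>M\<^esub> m', n) \<ominus>\<^bsub>N\<^esub> (\<gamma> h (m, n) \<oplus>\<^bsub>N\<^esub> \<gamma> h (m', n))" for h
      using m mm n cc
      by (simp add: \<gamma>_def R.minus_eq N.M.minus_eq N.smult_l_distr N.smult_l_minus del: free_module_simps)
    ultimately show "(\<lambda>h. \<gamma> h (m \<oplus>\<^bsub>M\<^esub> m', n) \<ominus>\<^bsub>N\<^esub> (\<gamma> h (m, n) \<oplus>\<^bsub>N\<^esub> \<gamma> h (m', n)))
        \<in> coefficient_span N V"
      using coefficient_span.base[of ?k V n N] n by simp
  next
    fix m n n' assume m: "m \<in> carrier M" and n: "n \<in> carrier N" "n' \<in> carrier N"
    \<comment> \<open>In the second argument \<open>\<gamma>\<close> is additive on the nose, and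
      the defect is zero.\<close>
    have "\<gamma> h (m, n \<oplus>\<^bsub>N\<^esub> n') \<ominus>\<^bsub>N\<^esub> (\<gamma> h (m, n) \<oplus>\<^bsub>N\<^esub> \<gamma> h (m, n')) = \<zero>\<^bsub>N\<^esub>" for h
      using m n cc by (simp add: \<gamma>_def N.smult_r_distr N.M.minus_eq N.M.r_neg)
    then show "(\<lambda>h. \<gamma> h (m, n \<oplus>\<^bsub>N\<^esub> n') \<ominus>\<^bsub>N\<^esub> (\<gamma> h (m, n) \<oplus>\<^bsub>N\<^esub> \<gamma> h (m, n')))
        \<in> coefficient_span N V"
      using zN by simp
  next
    fix r m n assume r: "r \<in> carrier R" and m: "m \<in> carrier M" and n: "n \<in> carrier N"
    let ?k = "c (r \<odot>\<^bsub>M\<^esub> m) \<ominus>\<^bsub>FG\<^esub> (r \<odot>\<^bsub>FG\<^esub> c m)"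
    have rm: "r \<odot>\<^bsub>M\<^esub> m \<in> carrier M" using r m by simp
    have "\<pi> (r \<odot>\<^bsub>FG\<^esub> c m) = r \<odot>\<^bsub>M\<^esub> m"
      unfolding module_hom_smult[OF \<pi>_hom r c(1)[OF m]] c(2)[OF m] ..
    then have "?k \<in> V"
      using c(2)[OF rm] by (intro minus_mem_V FG.smult_closed c(1) rm m r) (rule trans, assumption, rule sym)
    moreover have "?k h = c (r \<odot>\<^bsub>M\<^esub> m) h \<ominus> r \<otimes> c m h" for h
      using fun_cong[OF R.free_module_minus[OF c(1)[OF rm] FG.smult_closed[OF r c(1)[OF m]]]] by simp
    then have "?k h \<odot>\<^bsub>N\<^esub> n = \<gamma> h (r \<odot>\<^bsub>M\<^esub> m, n) \<ominus>\<^bsub>N\<^esub> r \<odot>\<^bsub>N\<^esub> \<gamma> h (m, n)" for h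
      using m rm n r cc
      by (simp add: \<gamma>_def R.minus_eq N.M.minus_eq N.smult_l_distr N.smult_l_minus N.smult_assoc1
          del: free_module_simps)
    ultimately show "(\<lambda>h. \<gamma> h (r \<odot>\<^bsub>M\<^esub> m, n) \<ominus>\<^bsub>N\<^esub> r \<odot>\<^bsub>N\<^esub> \<gamma> h (m, n)) \<in> coefficient_span N V"
      using coefficient_span.base[of ?k V n N] n by simp
    have "\<gamma> h (m, r \<odot>\<^bsub>N\<^esub> n) \<ominus>\<^bsub>N\<^esub> r \<odot>\<^bsub>N\<^esub> \<gamma> h (m, n) = \<zero>\<^bsub>N\<^esub>" for h
      using m n r cc[OF m, of h]
      by (simp add: \<gamma>_def N.smult_assoc1[symmetric] R.m_comm N.M.minus_eq N.M.r_neg)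
    then show "(\<lambda>h. \<gamma> h (m, r \<odot>\<^bsub>N\<^esub> n) \<ominus>\<^bsub>N\<^esub> r \<odot>\<^bsub>N\<^esub> \<gamma> h (m, n)) \<in> coefficient_span N V"
      using zN by simp
  qed
  have "free_lift R N (\<gamma> h) p = (if h \<in> G then u h else \<zero>\<^bsub>N\<^esub>)" for h
  proof -
    have L: "free_lift R N (\<gamma> h) \<in> module_hom R F N"
      unfolding tensor_free_def by (rule N.free_lift_hom[OF \<gamma>])
    have "free_lift R N (\<gamma> h) p = (\<Oplus>\<^bsub>N\<^esub>g\<in>G. free_lift R N (\<gamma> h) (free_basis R (g, u g)))"
      unfolding p_def by (rule module_hom_finsum[OF F_module N.module_axioms L e])
    also have "\<dots> = (\<Oplus>\<^bsub>N\<^esub>g\<in>G. if h = g then u g else \<zero>\<^bsub>N\<^esub>)"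
    proof (rule N.M.add.finprod_cong'[OF refl])
      show "(\<lambda>g. if h = g then u g else \<zero>\<^bsub>N\<^esub>) \<in> G \<rightarrow> carrier N"
        using u by auto
      fix g assume g: "g \<in> G"
      then have "u g \<in> carrier N" "g \<in> carrier M" using u G_subset by auto
      then show "free_lift R N (\<gamma> h) (free_basis R (g, u g)) = (if h = g then u g else \<zero>\<^bsub>N\<^esub>)"
        using g by (subst N.free_lift_basis[OF \<gamma>]) (auto simp: \<gamma>_def c_def free_basis_def)
    qed
    also have "\<dots> = (if h \<in> G then u h else \<zero>\<^bsub>N\<^esub>)"
    proof (cases "h \<in> G")
      case True
      then show ?thesis
        using N.M.add.finprod_singleton[OF True finite_G u] by simp
    next
      case False
      then have "(\<Oplus>\<^bsub>N\<^esub>g\<in>G. if h = g then u g else \<zero>\<^bsub>N\<^esub>) = \<zero>\<^bsub>N\<^esub>"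
        by (intro N.M.add.finprod_one_eqI) auto
      then show ?thesis using False by simp
    qed
    finally show ?thesis .
  qed
  then show ?thesis
    using span by (simp only:)
qed

end


section \<open>Tests for projectivity and flatness\<close>

text \<open>Projectivity and flatness are assumed for one carrier type; a copy along an injection
  \<open>h\<close> brings a module into that type.\<close>

definition transport_module ::
  "('a \<Rightarrow> 'b) \<Rightarrow> ('r, 'a, 'y) module_scheme \<Rightarrow> ('r, 'b) module"
  where "transport_module h M = (let k = the_inv_into (carrier M) h in
    \<lparr>carrier = h ` carrier M, monoid.mult = undefined, one = undefined, ring.zero = h \<zero>\<^bsub>M\<^esub>,
     add = (\<lambda>x y. h (k x \<oplus>\<^bsub>M\<^esub> k y)), smult = (\<lambda>r x. h (r \<odot>\<^bsub>M\<^esub> k x))\<rparr>)"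

lemma transport_module_carrier: "carrier (transport_module h M) = h ` carrier M"
  by (simp add: transport_module_def Let_def)

locale module_transport = module +
  fixes h
  assumes inj: "inj_on h (carrier M)"
begin

abbreviation M' where "M' \<equiv> transport_module h M"
abbreviation k where "k \<equiv> the_inv_into (carrier M) h"

lemma k_h: "x \<in> carrier M \<Longrightarrow> k (h x) = x"
  by (rule the_inv_into_f_f[OF inj])

lemma transport_zero: "\<zero>\<^bsub>M'\<^esub> = h \<zero>\<^bsub>M\<^esub>"
  by (simp add: transport_module_def Let_def)

lemma transport_add: "\<lbrakk>x \<in> carrier M; y \<in> carrier M\<rbrakk> \<Longrightarrow> h x \<oplus>\<^bsub>M'\<^esub> h y = h (x \<oplus>\<^bsub>M\<^esub> y)"
  by (simp add: transport_module_def Let_def k_h)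

lemma transport_smult: "x \<in> carrier M \<Longrightarrow> r \<odot>\<^bsub>M'\<^esub> h x = h (r \<odot>\<^bsub>M\<^esub> x)"
  by (simp add: transport_module_def Let_def k_h)

lemma transport_module_module: "module R M'"
proof (rule moduleI[OF R.is_cring])
  note c = transport_module_carrier
  show "abelian_group M'"
  proof (rule abelian_groupI)
    fix x assume "x \<in> carrier M'"
    then obtain a where a: "a \<in> carrier M" "x = h a" by (auto simp: c)
    have "h (\<ominus>\<^bsub>M\<^esub> a) \<oplus>\<^bsub>M'\<^esub> x = \<zero>\<^bsub>M'\<^esub>"
      using a by (simp add: transport_add transport_zero M.l_neg)
    then show "\<exists>y\<in>carrier M'. y \<oplus>\<^bsub>M'\<^esub> x = \<zero>\<^bsub>M'\<^esub>"
      using a(1) by (intro bexI[of _ "h (\<ominus>\<^bsub>M\<^esub> a)"]) (simp_all add: c)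
  qed (auto simp: c transport_add transport_zero M.a_ac)
qed (auto simp: transport_module_carrier transport_add transport_smult smult_l_distr smult_r_distr smult_assoc1)

lemma transport_hom: "h \<in> module_hom R M M'"
  by (rule module_homI) (simp_all add: transport_module_carrier transport_add transport_smult)

lemma transport_inv_hom: "k \<in> module_hom R M' M"
  by (rule module_homI) (auto simp: transport_module_carrier transport_add transport_smult k_h)

end

text \<open>The lifting problem is moved to the copies of \<open>L\<close> and \<open>N\<close> in
  the test type, solved there and brought back; injectivity of \<open>e2\<close> recovers the
  equation in \<open>N\<close>.\<close>

lemma projective_module_lift:
  assumes P: "projective_module TYPE('u) R P"
    and L: "module R L" and N: "module R N"
    and e1: "inj_on (e1 :: 'l \<Rightarrow> 'u) (carrier L)" and e2: "inj_on (e2 :: 'n \<Rightarrow> 'u) (carrier N)"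
    and g: "g \<in> module_hom R L N" and surj: "g ` carrier L = carrier N" and f: "f \<in> module_hom R P N"
  shows "\<exists>h\<in>module_hom R P L. \<forall>x\<in>carrier P. g (h x) = f x"
proof -
  interpret L: module R L by fact
  interpret N: module R N by fact
  interpret TL: module_transport R L e1 by unfold_locales (rule e1)
  interpret TN: module_transport R N e2 by unfold_locales (rule e2)
  let ?g = "\<lambda>x. e2 (g (TL.k x))"
  have "?g \<in> module_hom R TL.M' TN.M'"
    by (rule module_hom_comp[OF module_hom_comp[OF TL.transport_inv_hom g] TN.transport_hom])
  moreover have "?g ` carrier TL.M' = carrier TN.M'"
    unfolding transport_module_carrier image_image surj[symmetric] by (simp add: TL.k_h)
  moreover have "(\<lambda>x. e2 (f x)) \<in> module_hom R P TN.M'"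
    by (rule module_hom_comp[OF f TN.transport_hom])
  ultimately obtain h where h: "h \<in> module_hom R P TL.M'" "\<forall>x\<in>carrier P. ?g (h x) = e2 (f x)"
    using P TL.transport_module_module TN.transport_module_module unfolding projective_module_def
    by blast
  have hk: "(\<lambda>x. TL.k (h x)) \<in> module_hom R P L"
    by (rule module_hom_comp[OF h(1) TL.transport_inv_hom])
  have "g (TL.k (h x)) = f x" if x: "x \<in> carrier P" for x
  proof (rule inj_onD[OF e2])
    show "e2 (g (TL.k (h x))) = e2 (f x)" using h(2) x by blast
  qed (use x module_hom_closed[OF hk] module_hom_closed[OF g] module_hom_closed[OF f] in auto)
  with hk show ?thesis by (intro bexI[of _ "\<lambda>x. TL.k (h x)"] ballI)
qed

section \<open>Retracts of free modules\<close>

context generated_module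
begin

text \<open>The composite of \<open>f\<close> with \<open>\<pi>\<close> lifts to \<open>L\<close> by
  a choice of preimages on the basis, and the lift is precomposed with \<open>sec\<close>. The
  choice can be made in any \<open>L\<close>, hence the arbitrary type \<open>'u\<close>.\<close>

lemma projective_if_section:
  assumes sec: "sec \<in> module_hom R M FG" "\<And>x. x \<in> carrier M \<Longrightarrow> \<pi> (sec x) = x"
  shows "projective_module TYPE('u) R M"
  unfolding projective_module_def
proof (intro conjI allI impI; (elim conjE)?)
  show "module R M" by (rule module_axioms)
  fix L N :: "('a, 'u) module" and g f
  assume L: "module R L" and N: "module R N" and g: "g \<in> module_hom R L N"
    and surj: "g ` carrier L = carrier N" and f: "f \<in> module_hom R M N"
  interpret L: module R L by fact
  interpret N: module R N by fact
  have "\<exists>y\<in>carrier L. g y = f x" if "x \<in> G" for x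
  proof -
    have "f x \<in> g ` carrier L"
      using that G_subset module_hom_closed[OF f] surj by auto
    then show ?thesis by auto
  qed
  then obtain l where l: "\<And>x. x \<in> G \<Longrightarrow> l x \<in> carrier L \<and> g (l x) = f x"
    by metis
  then have lPi: "l \<in> G \<rightarrow> carrier L" by auto
  let ?l = "free_lift R L l"
  note lh = L.free_lift_hom[OF lPi]
  have eq: "g (?l v) = f (\<pi> v)" if v: "v \<in> carrier FG" for v
  proof (rule N.free_hom_ext[OF module_hom_comp[OF lh g] module_hom_comp[OF \<pi>_hom f] _ v])
    show "g (?l (free_basis R x)) = f (\<pi> (free_basis R x))" if "x \<in> G" for x
      using that l by (simp add: L.free_lift_basis[OF lPi] \<pi>_basis)
  qed
  show "\<exists>h\<in>module_hom R M L. \<forall>x\<in>carrier M. g (h x) = f x"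
  proof (intro bexI ballI)
    show "(\<lambda>x. ?l (sec x)) \<in> module_hom R M L"
      by (rule module_hom_comp[OF sec(1) lh])
    show "g (?l (sec x)) = f x" if "x \<in> carrier M" for x
      using eq[OF module_hom_closed[OF sec(1) that]] sec(2)[OF that] by simp
  qed
qed

end

text \<open>The equational criterion for flatness, for one relation \<open>v\<close>: flatness is only tested on
  the inclusion into \<open>R\<close> of the ideal generated by the coefficients of \<open>v\<close>.\<close>

lemma (in generated_module) flat_relation_trivial:
  assumes flat: "flat_module TYPE(('a, nat) coset_type) R M" and v: "v \<in> V"
  shows "\<exists>\<phi>\<in>module_hom R FG FG. (\<forall>w\<in>carrier FG. \<phi> w \<in> V) \<and> \<phi> v = v"
proof -
  \<comment> \<open>A copy of R as a module over itself inside the test type: functions on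
    \<open>nat\<close> supported at 0, wrapped into singletons to become elements of
    \<open>coset_type\<close>.\<close>
  let ?F0 = "free_module R {0::nat}"
  let ?e = "free_basis R (0::nat)"
  interpret F0: module R ?F0 by (rule R.free_module_module)
  have e: "?e \<in> carrier ?F0" by (rule R.free_basis_carrier) simp
  interpret E: module_transport R ?F0 "\<lambda>p. {p}"
    by unfold_locales simp
  have E: "module R E.M'" by (rule E.transport_module_module)
  interpret E: module R E.M' by (rule E)
  define \<iota> where "\<iota> r = {r \<odot>\<^bsub>?F0\<^esub> ?e}" for r
  have \<iota>_closed: "\<iota> r \<in> carrier E.M'" if "r \<in> carrier R" for r
    unfolding \<iota>_def transport_module_carrier using F0.smult_closed[OF that e] by (rule imageI)
  have \<iota>_smult: "r \<odot>\<^bsub>E.M'\<^esub> \<iota> s = \<iota> (r \<otimes> s)" if "r \<in> carrier R" "s \<in> carrier R" for r s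
    unfolding \<iota>_def using that e
    by (subst E.transport_smult[OF F0.smult_closed]) (simp_all add: F0.smult_assoc1 del: free_module_simps)
  have \<iota>_add: "\<iota> r \<oplus>\<^bsub>E.M'\<^esub> \<iota> s = \<iota> (r \<oplus> s)" if "r \<in> carrier R" "s \<in> carrier R" for r s
    unfolding \<iota>_def using that e
    by (subst E.transport_add[OF F0.smult_closed F0.smult_closed])
      (simp_all add: F0.smult_l_distr del: free_module_simps)
  have \<iota>_inj: "r = s" if "\<iota> r = \<iota> s" "r \<in> carrier R" "s \<in> carrier R" for r s
  proof -
    have "(r \<odot>\<^bsub>?F0\<^esub> ?e) 0 = (s \<odot>\<^bsub>?F0\<^esub> ?e) 0" using that(1) by (simp add: \<iota>_def)
    then show ?thesis using that by (simp add: free_basis_def)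
  qed
  have vF: "v \<in> carrier FG" and v0: "\<pi> v = \<zero>\<^bsub>M\<^esub>" using v by (auto simp: V_iff)
  note vc = FG_coeff[OF vF]
  \<comment> \<open>This is the pairing with \<open>v\<close>, so its image is the copy of the ideal
    generated by the coefficients of \<open>v\<close>.\<close>
  define \<beta> where "\<beta> = free_lift R E.M' (\<lambda>g. \<iota> (v g))"
  have \<iota>Pi: "(\<lambda>g. \<iota> (v g)) \<in> G \<rightarrow> carrier E.M'" using \<iota>_closed vc by auto
  have \<beta>: "\<beta> \<in> module_hom R FG E.M'"
    unfolding \<beta>_def by (rule E.free_lift_hom[OF \<iota>Pi])
  have \<iota>_hom_sum: "(\<Oplus>\<^bsub>E.M'\<^esub>g\<in>A. \<iota> (c g)) = \<iota> (\<Oplus>g\<in>A. c g)" if "c \<in> A \<rightarrow> carrier R" for A :: "'c set" and c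
    using that
  proof (induction A rule: infinite_finite_induct)
    case (insert x A)
    then have x: "c x \<in> carrier R" "c \<in> A \<rightarrow> carrier R" by auto
    then have "(\<lambda>g. \<iota> (c g)) \<in> A \<rightarrow> carrier E.M'" using \<iota>_closed by auto
    with x insert show ?case
      by (simp add: \<iota>_closed \<iota>_add)
  qed (simp_all add: \<iota>_def E.transport_zero F0.smult_l_null[OF e] del: free_module_simps)
  have \<beta>_eq: "\<beta> w = \<iota> (\<Oplus>g\<in>G. w g \<otimes> v g)" if w: "w \<in> carrier FG" for w
  proof -
    have "\<beta> w = (\<Oplus>\<^bsub>E.M'\<^esub>g\<in>G. w g \<odot>\<^bsub>E.M'\<^esub> \<iota> (v g))"
      unfolding \<beta>_def using free_module_support(2)[OF w]
      by (rule E.free_lift_superset[OF w \<iota>Pi finite_G]) simp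
    also have "\<dots> = (\<Oplus>\<^bsub>E.M'\<^esub>g\<in>G. \<iota> (w g \<otimes> v g))"
      by (intro E.M.add.finprod_cong' refl Pi_I \<iota>_closed R.m_closed \<iota>_smult FG_coeff[OF w] vc)
    also have "\<dots> = \<iota> (\<Oplus>g\<in>G. w g \<otimes> v g)"
      by (intro \<iota>_hom_sum Pi_I R.m_closed FG_coeff[OF w] vc)
    finally show ?thesis .
  qed
  define N' where "N' = E.M'\<lparr>carrier := \<beta> ` carrier FG\<rparr>"
  have sub: "submodule (\<beta> ` carrier FG) R E.M'"
    by (rule submodule_image[OF FG.module_axioms E \<beta>])
  have N': "module R N'"
    unfolding N'_def by (rule submodule.submodule_is_module[OF sub E])
  have N'_simps: "carrier N' = \<beta> ` carrier FG" "\<zero>\<^bsub>N'\<^esub> = \<zero>\<^bsub>E.M'\<^esub>"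
    "x \<oplus>\<^bsub>N'\<^esub> y = x \<oplus>\<^bsub>E.M'\<^esub> y" "r \<odot>\<^bsub>N'\<^esub> x = r \<odot>\<^bsub>E.M'\<^esub> x" for r x y
    by (simp_all add: N'_def)
  have incl: "(\<lambda>x. x) \<in> module_hom R N' E.M'"
    using E.submoduleE(1)[OF sub] by (intro module_homI) (auto simp only: N'_simps)
  interpret N': module R N' by (rule N')
  interpret H: module_pair_hom R M N' M E.M' "\<lambda>m. m" "\<lambda>x. x"
    by unfold_locales (rule module_hom_id incl)+
  interpret GT: generated_tensor R M G N'
    by unfold_locales
  have u: "(\<lambda>g. \<iota> (v g)) \<in> G \<rightarrow> carrier N'"
  proof
    fix g assume g: "g \<in> G"
    have "\<beta> (free_basis R g) = \<iota> (v g)"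
      unfolding \<beta>_def by (rule E.free_lift_basis[OF \<iota>Pi g])
    then show "\<iota> (v g) \<in> carrier N'"
      using R.free_basis_carrier[OF g] by (auto simp: N'_simps)
  qed
  \<comment> \<open>The element \<Sum> g \<otimes> v g over the ideal. Over R the coefficients move
    across the tensor sign and give \<pi> v \<otimes> 1 = 0; by flatness it vanishes over the ideal
    already.\<close>
  let ?t = "\<Oplus>\<^bsub>H.S.T\<^esub>g\<in>G. pure_tensor R M N' g (\<iota> (v g))"
  have pPi: "(\<lambda>g. pure_tensor R M N' g (\<iota> (v g))) \<in> G \<rightarrow> carrier H.S.T"
    using u G_subset by auto
  have "tensor_map R M E.M' (\<lambda>m. m) (\<lambda>x. x) ?t
      = (\<Oplus>\<^bsub>H.S'.T\<^esub>g\<in>G. tensor_map R M E.M' (\<lambda>m. m) (\<lambda>x. x) (pure_tensor R M N' g (\<iota> (v g))))"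
    by (rule module_hom_finsum[OF H.S.T.module_axioms H.S'.T.module_axioms H.tensor_map_hom pPi])
  also have "\<dots> = (\<Oplus>\<^bsub>H.S'.T\<^esub>g\<in>G. pure_tensor R M E.M' (v g \<odot>\<^bsub>M\<^esub> g) (\<iota> \<one>))"
  proof (rule H.S'.T.M.add.finprod_cong'[OF refl])
    show "(\<lambda>g. pure_tensor R M E.M' (v g \<odot>\<^bsub>M\<^esub> g) (\<iota> \<one>)) \<in> G \<rightarrow> carrier H.S'.T"
      using G_subset vc \<iota>_closed by auto
    fix g assume g: "g \<in> G"
    then have gM: "g \<in> carrier M" using G_subset by auto
    have "\<iota> (v g) = v g \<odot>\<^bsub>E.M'\<^esub> \<iota> \<one>" using vc by (simp add: \<iota>_smult)
    then show "tensor_map R M E.M' (\<lambda>m. m) (\<lambda>x. x) (pure_tensor R M N' g (\<iota> (v g)))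
        = pure_tensor R M E.M' (v g \<odot>\<^bsub>M\<^esub> g) (\<iota> \<one>)"
      using H.tensor_map_pure[OF gM Pi_mem[OF u g]] vc gM \<iota>_closed
      by (simp add: H.S'.pure_smult_left H.S'.pure_smult_right)
  qed
  also have "\<dots> = pure_tensor R M E.M' (\<Oplus>\<^bsub>M\<^esub>g\<in>G. v g \<odot>\<^bsub>M\<^esub> g) (\<iota> \<one>)"
    using G_subset vc
    by (intro module_hom_finsum[OF module_axioms H.S'.T.module_axioms H.S'.pure_hom_left[OF \<iota>_closed], symmetric])
      auto
  also have "\<dots> = \<zero>\<^bsub>H.S'.T\<^esub>"
    unfolding \<pi>_expand[OF vF, symmetric] v0
    by (rule module_hom_zero[OF module_axioms H.S'.T.module_axioms H.S'.pure_hom_left[OF \<iota>_closed]]) simp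
  also have "\<dots> = tensor_map R M E.M' (\<lambda>m. m) (\<lambda>x. x) \<zero>\<^bsub>H.S.T\<^esub>"
    by (rule module_hom_zero[OF H.S.T.module_axioms H.S'.T.module_axioms H.tensor_map_hom, symmetric])
  finally have "tensor_map R M E.M' (\<lambda>m. m) (\<lambda>x. x) ?t = tensor_map R M E.M' (\<lambda>m. m) (\<lambda>x. x) \<zero>\<^bsub>H.S.T\<^esub>" .
  moreover have inj: "inj_on (tensor_map R M E.M' (\<lambda>m. m) (\<lambda>x. x)) (carrier H.S.T)"
    using flat N' E incl inj_on_id2[of "carrier N'"] unfolding flat_module_def by blast
  ultimately have "?t = \<zero>\<^bsub>H.S.T\<^esub>"
    using inj_onD[OF inj _ H.S.T.M.finsum_closed[OF pPi] H.S.T.M.zero_closed] by blast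
  from GT.tensor_vanish[OF u this]
  have span: "(\<lambda>h. if h \<in> G then \<iota> (v h) else \<zero>\<^bsub>N'\<^esub>) \<in> coefficient_span N' V" .
  \<comment> \<open>Every member of the span is the value at \<open>v\<close> of an endomorphism
    with image in \<open>V\<close>. For the member given by \<open>v\<close> itself, this
    endomorphism fixes \<open>v\<close>.\<close>
  have "\<exists>\<phi>\<in>module_hom R FG FG. (\<forall>w\<in>carrier FG. \<phi> w \<in> V) \<and> (\<forall>h. \<iota> (\<phi> v h) = d h)"
    if "d \<in> coefficient_span N' V" for d
    using that
  proof induction
    case (base k n)
    then obtain w where w: "w \<in> carrier FG" "n = \<beta> w" unfolding N'_simps by blast
    have kF: "k \<in> carrier FG" using base by (simp add: V_iff)
    note kc = FG_coeff[OF kF] and wc = FG_coeff[OF w(1)]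
    \<comment> \<open>The rank-one map that sends x to its pairing with \<open>w\<close>, times
      \<open>k\<close>. Since \<open>n\<close> is the pairing of \<open>w\<close> with
      \<open>v\<close>, the value at \<open>v\<close> is \<open>k\<close> times
      \<open>n\<close>.\<close>
    let ?\<phi> = "free_lift R FG (\<lambda>g. w g \<odot>\<^bsub>FG\<^esub> k)"
    have Pi: "(\<lambda>g. w g \<odot>\<^bsub>FG\<^esub> k) \<in> G \<rightarrow> carrier FG"
      using FG.smult_closed[OF wc kF] by (rule Pi_I)
    note \<phi> = FG.free_lift_hom[OF Pi]
    have "?\<phi> x \<in> V" if "x \<in> carrier FG" for x
      using FG.submoduleE(4)[OF V_submodule wc base(1)]
      by (intro FG.free_hom_vimage[OF \<phi> V_submodule _ that])
        (simp add: FG.free_lift_basis[OF Pi] del: free_module_simps)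
    moreover have "\<iota> (?\<phi> v h) = k h \<odot>\<^bsub>N'\<^esub> n" for h
    proof -
      have "?\<phi> v = (\<Oplus>\<^bsub>FG\<^esub>g\<in>G. v g \<odot>\<^bsub>FG\<^esub> (w g \<odot>\<^bsub>FG\<^esub> k))"
        using free_module_support(2)[OF vF] by (intro FG.free_lift_superset[OF vF Pi finite_G]) simp_all
      then have "?\<phi> v h = (\<Oplus>\<^bsub>FG\<^esub>g\<in>G. v g \<odot>\<^bsub>FG\<^esub> (w g \<odot>\<^bsub>FG\<^esub> k)) h"
        by (rule fun_cong)
      also have "\<dots> = (\<Oplus>g\<in>G. (v g \<odot>\<^bsub>FG\<^esub> (w g \<odot>\<^bsub>FG\<^esub> k)) h)"
        by (rule R.free_module_finsum) (intro Pi_I FG.smult_closed vc wc kF)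
      also have "\<dots> = (\<Oplus>g\<in>G. k h \<otimes> (w g \<otimes> v g))"
        using vc wc kc
        by (intro R.finsum_cong' refl Pi_I R.m_closed vc wc kc) (simp add: R.m_ac vc wc kc)
      also have "\<dots> = k h \<otimes> (\<Oplus>g\<in>G. w g \<otimes> v g)"
        by (intro R.finsum_rdistr[symmetric] finite_G Pi_I R.m_closed vc wc kc)
      finally have "?\<phi> v h = k h \<otimes> (\<Oplus>g\<in>G. w g \<otimes> v g)" .
      then show ?thesis
        unfolding N'_simps w(2) \<beta>_eq[OF w(1)]
        by (subst \<iota>_smult) (simp_all add: kc vc wc Pi_I)
    qed
    ultimately show ?case using \<phi> by blast
  next
    case (add d d')
    then obtain \<phi> \<phi>' where \<phi>: "\<phi> \<in> module_hom R FG FG" "\<forall>w\<in>carrier FG. \<phi> w \<in> V" "\<forall>h. \<iota> (\<phi> v h) = d h"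
      and \<phi>': "\<phi>' \<in> module_hom R FG FG" "\<forall>w\<in>carrier FG. \<phi>' w \<in> V" "\<forall>h. \<iota> (\<phi>' v h) = d' h"
      by blast
    note c = module_hom_closed[OF \<phi>(1)] module_hom_closed[OF \<phi>'(1)]
    show ?case
    proof (intro bexI conjI ballI allI)
      show "(\<lambda>w. \<phi> w \<oplus>\<^bsub>FG\<^esub> \<phi>' w) \<in> module_hom R FG FG"
        by (rule module_homI)
          (simp_all add: c FG.smult_r_distr FG.M.a_ac module_hom_add[OF \<phi>(1)] module_hom_add[OF \<phi>'(1)]
            module_hom_smult[OF \<phi>(1)] module_hom_smult[OF \<phi>'(1)] del: free_module_simps)
      show "\<phi> w \<oplus>\<^bsub>FG\<^esub> \<phi>' w \<in> V" if "w \<in> carrier FG" for w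
        using \<phi>(2) \<phi>'(2) that by (intro FG.submoduleE(5)[OF V_submodule]) auto
      show "\<iota> ((\<phi> v \<oplus>\<^bsub>FG\<^esub> \<phi>' v) h) = d h \<oplus>\<^bsub>N'\<^esub> d' h" for h
        using \<phi>(3) \<phi>'(3) FG_coeff[OF c(1)[OF vF]] FG_coeff[OF c(2)[OF vF]]
        by (simp add: N'_simps \<iota>_add[symmetric])
    qed
  qed
  from this[OF span] obtain \<phi> where \<phi>: "\<phi> \<in> module_hom R FG FG" "\<forall>w\<in>carrier FG. \<phi> w \<in> V"
    "\<forall>h. \<iota> (\<phi> v h) = (if h \<in> G then \<iota> (v h) else \<zero>\<^bsub>N'\<^esub>)"
    by blast
  have \<phi>v: "\<phi> v \<in> carrier FG" by (rule module_hom_closed[OF \<phi>(1) vF])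
  have "\<phi> v h = v h" for h
  proof (cases "h \<in> G")
    case True
    then show ?thesis using \<phi>(3) by (intro \<iota>_inj[OF _ FG_coeff[OF \<phi>v] vc]) simp
  next
    case False
    then show ?thesis using free_module_outside[OF \<phi>v] free_module_outside[OF vF] by simp
  qed
  then have "\<phi> v = v" by (rule ext)
  then show ?thesis using \<phi>(1,2) by blast
qed


section \<open>Base change\<close>

lemma base_change_simps:
  "carrier (base_change R M A) = carrier (tensor_product R M A)"
  "\<zero>\<^bsub>base_change R M A\<^esub> = \<zero>\<^bsub>tensor_product R M A\<^esub>"
  "x \<oplus>\<^bsub>base_change R M A\<^esub> y = x \<oplus>\<^bsub>tensor_product R M A\<^esub> y"
  "a \<odot>\<^bsub>base_change R M A\<^esub> x = tensor_map R M A (\<lambda>m. m) (\<lambda>b. a \<otimes>\<^bsub>A\<^esub> b) x"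
  by (simp_all add: base_change_def Let_def)

text \<open>A finite sum reads only the additive structure, which the base change shares with the
  tensor product over \<open>R\<close>.\<close>

lemma base_change_finsum: "finsum (base_change R M A) f S = finsum (tensor_product R M A) f S"
  by (simp add: finsum_def finprod_def base_change_def Let_def)

locale generated_base_change = generated_tensor R M G A + A: cring A
  for R (structure) and M and G and A +
  assumes smult_assoc2: "\<lbrakk>r \<in> carrier R; a \<in> carrier A; b \<in> carrier A\<rbrakk>
    \<Longrightarrow> (r \<odot>\<^bsub>A\<^esub> a) \<otimes>\<^bsub>A\<^esub> b = r \<odot>\<^bsub>A\<^esub> (a \<otimes>\<^bsub>A\<^esub> b)"
begin

abbreviation AG where "AG \<equiv> free_module A G"
abbreviation BC where "BC \<equiv> base_change R M A"

text \<open>The structure map R \<rightarrow> A, whose kernel is the ideal J of the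
  overview.\<close>

definition \<iota> where "\<iota> r = r \<odot>\<^bsub>A\<^esub> \<one>\<^bsub>A\<^esub>"

lemma \<iota>_closed [simp, intro]: "r \<in> carrier R \<Longrightarrow> \<iota> r \<in> carrier A"
  by (simp add: \<iota>_def)

lemma \<iota>_zero [simp]: "\<iota> \<zero> = \<zero>\<^bsub>A\<^esub>"
  by (simp add: \<iota>_def)

lemma \<iota>_one [simp]: "\<iota> \<one> = \<one>\<^bsub>A\<^esub>"
  by (simp add: \<iota>_def)

lemma \<iota>_add: "\<lbrakk>r \<in> carrier R; s \<in> carrier R\<rbrakk> \<Longrightarrow> \<iota> (r \<oplus> s) = \<iota> r \<oplus>\<^bsub>A\<^esub> \<iota> s"
  by (simp add: \<iota>_def N.smult_l_distr)

lemma smult_eq_\<iota>: "\<lbrakk>r \<in> carrier R; a \<in> carrier A\<rbrakk> \<Longrightarrow> r \<odot>\<^bsub>A\<^esub> a = \<iota> r \<otimes>\<^bsub>A\<^esub> a"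
  by (simp add: \<iota>_def smult_assoc2)

lemma \<iota>_mult: "\<lbrakk>r \<in> carrier R; s \<in> carrier R\<rbrakk> \<Longrightarrow> \<iota> (r \<otimes> s) = \<iota> r \<otimes>\<^bsub>A\<^esub> \<iota> s"
  by (simp add: smult_eq_\<iota>[symmetric]) (simp add: \<iota>_def N.smult_assoc1)

lemma \<iota>_finsum:
  "f \<in> S \<rightarrow> carrier R \<Longrightarrow> \<iota> (\<Oplus>x\<in>S. f x) = (\<Oplus>\<^bsub>A\<^esub>x\<in>S. \<iota> (f x))"
proof (induction S rule: infinite_finite_induct)
  case (insert x S)
  then have x: "f x \<in> carrier R" "f \<in> S \<rightarrow> carrier R" by auto
  then have "(\<lambda>x. \<iota> (f x)) \<in> S \<rightarrow> carrier A" by auto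
  with x insert show ?case by (simp add: \<iota>_add)
qed simp_all

sublocale AG: module A AG
  by (rule A.free_module_module)

lemma AG_coeff: "w \<in> carrier AG \<Longrightarrow> w i \<in> carrier A"
  by (rule A.free_module_coeff)

lemma \<iota>_AG: "v \<in> carrier FG \<Longrightarrow> (\<lambda>i. \<iota> (v i)) \<in> carrier AG"
  using finite_G FG_coeff free_module_outside
  by (intro A.free_module_finite_carrierI) fastforce+

lemma mult_hom: "a \<in> carrier A \<Longrightarrow> (\<lambda>b. a \<otimes>\<^bsub>A\<^esub> b) \<in> module_hom R A A"
  by (rule module_homI) (auto simp: A.r_distr smult_eq_\<iota> A.m_ac)

lemma smult_pure:
  assumes "a \<in> carrier A" "m \<in> carrier M" "b \<in> carrier A"
  shows "a \<odot>\<^bsub>BC\<^esub> pure_tensor R M A m b = pure_tensor R M A m (a \<otimes>\<^bsub>A\<^esub> b)"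
proof -
  interpret H: module_pair_hom R M A M A "\<lambda>m. m" "\<lambda>b. a \<otimes>\<^bsub>A\<^esub> b"
    by unfold_locales (rule module_hom_id mult_hom[OF assms(1)])+
  show ?thesis
    unfolding base_change_simps by (rule H.tensor_map_pure[OF assms(2,3)])
qed

text \<open>The canonical map A^G \<rightarrow> M \<otimes> A in coordinates.\<close>

definition tensor_sum where "tensor_sum w = (\<Oplus>\<^bsub>T\<^esub>g\<in>G. pure_tensor R M A g (w g))"

lemma tensor_sum_Pi:
  "(\<And>g. g \<in> G \<Longrightarrow> w g \<in> carrier A) \<Longrightarrow> (\<lambda>g. pure_tensor R M A g (w g)) \<in> G \<rightarrow> carrier T"
  using G_subset by auto

lemma pure_eq_tensor_sum:
  assumes v: "v \<in> carrier FG" and a: "a \<in> carrier A"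
  shows "pure_tensor R M A (\<pi> v) a = tensor_sum (\<lambda>g. v g \<odot>\<^bsub>A\<^esub> a)"
proof -
  have "pure_tensor R M A (\<pi> v) a = (\<Oplus>\<^bsub>T\<^esub>g\<in>G. pure_tensor R M A (v g \<odot>\<^bsub>M\<^esub> g) a)"
    unfolding \<pi>_expand[OF v] using FG_coeff[OF v] G_subset
    by (intro module_hom_finsum[OF module_axioms T.module_axioms pure_hom_left[OF a]]) auto
  also have "\<dots> = tensor_sum (\<lambda>g. v g \<odot>\<^bsub>A\<^esub> a)"
    unfolding tensor_sum_def
  proof (rule T.M.add.finprod_cong'[OF refl])
    show "(\<lambda>g. pure_tensor R M A g (v g \<odot>\<^bsub>A\<^esub> a)) \<in> G \<rightarrow> carrier T"
      using FG_coeff[OF v] a by (intro tensor_sum_Pi) simp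
    show "pure_tensor R M A (v g \<odot>\<^bsub>M\<^esub> g) a = pure_tensor R M A g (v g \<odot>\<^bsub>A\<^esub> a)" if "g \<in> G" for g
      using that G_subset a FG_coeff[OF v] by (simp add: subset_iff pure_smult_left pure_smult_right)
  qed
  finally show ?thesis .
qed

lemma smult_tensor_sum:
  assumes w: "\<And>g. g \<in> G \<Longrightarrow> w g \<in> carrier A" and r: "r \<in> carrier R"
  shows "r \<odot>\<^bsub>T\<^esub> tensor_sum w = tensor_sum (\<lambda>g. r \<odot>\<^bsub>A\<^esub> w g)"
proof -
  have "r \<odot>\<^bsub>T\<^esub> tensor_sum w = (\<Oplus>\<^bsub>T\<^esub>g\<in>G. r \<odot>\<^bsub>T\<^esub> pure_tensor R M A g (w g))"
    unfolding tensor_sum_def by (rule T.finsum_smult_ldistr[OF finite_G r]) (intro tensor_sum_Pi w)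
  also have "\<dots> = tensor_sum (\<lambda>g. r \<odot>\<^bsub>A\<^esub> w g)"
    unfolding tensor_sum_def
  proof (rule T.M.add.finprod_cong'[OF refl])
  show "(\<lambda>g. pure_tensor R M A g (r \<odot>\<^bsub>A\<^esub> w g)) \<in> G \<rightarrow> carrier T"
    using r w by (intro tensor_sum_Pi) simp
  show "r \<odot>\<^bsub>T\<^esub> pure_tensor R M A g (w g) = pure_tensor R M A g (r \<odot>\<^bsub>A\<^esub> w g)" if "g \<in> G" for g
    using that G_subset w r by (auto simp: subset_iff pure_smult_right)
  qed
  finally show ?thesis .
qed

text \<open>A splitting \<open>h\<close> of p : A^G \<rightarrow> M \<otimes> A makes 1 - h p a
  projection onto the kernel of p, which is thus generated by the images of the basis. By
  \<open>tensor_vanish\<close> each of them is a finite A-combination of elements of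
  \<open>V\<close>, and \<open>V0\<close> collects these elements. If \<theta> kills
  \<open>V0\<close>, its extension to A^G kills the kernel, in particular the image of
  \<open>V\<close>. The injections \<open>e1\<close> and \<open>e2\<close> put A^G and M \<otimes> A
  into the test type.\<close>

lemma projective_base_change_relations:
  assumes P: "projective_module TYPE('u) A BC"
    and e1: "inj_on (e1 :: _ \<Rightarrow> 'u) (carrier AG)" and e2: "inj_on (e2 :: _ \<Rightarrow> 'u) (carrier BC)"
  shows "\<exists>V0. finite V0 \<and> V0 \<subseteq> V \<and> (\<forall>\<theta>\<in>module_hom R FG FG.
    (\<forall>v\<in>V0. \<theta> v = \<zero>\<^bsub>FG\<^esub>) \<longrightarrow> (\<forall>v\<in>V. \<forall>i. \<iota> (\<theta> v i) = \<zero>\<^bsub>A\<^esub>))"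
proof -
  have BC: "module A BC" using P by (simp add: projective_module_def)
  interpret BC: module A BC by (rule BC)
  let ?b = "\<lambda>g. pure_tensor R M A g \<one>\<^bsub>A\<^esub>"
  have b: "?b \<in> G \<rightarrow> carrier BC"
    using G_subset by (auto simp: base_change_simps)
  define p where "p = free_lift A BC ?b"
  have p: "p \<in> module_hom A AG BC"
    unfolding p_def by (rule BC.free_lift_hom[OF b])
  have p_eq: "p w = tensor_sum w" if w: "w \<in> carrier AG" for w
  proof -
    have "p w = (\<Oplus>\<^bsub>BC\<^esub>g\<in>G. w g \<odot>\<^bsub>BC\<^esub> ?b g)"
      unfolding p_def using free_module_support(2)[OF w]
      by (rule BC.free_lift_superset[OF w b finite_G]) simp
    also have "\<dots> = tensor_sum w"
      unfolding tensor_sum_def base_change_finsum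
    proof (rule T.M.add.finprod_cong'[OF refl tensor_sum_Pi])
      show "w g \<in> carrier A" for g by (rule AG_coeff[OF w])
      then show "w g \<odot>\<^bsub>BC\<^esub> ?b g = pure_tensor R M A g (w g)" if "g \<in> G" for g
        using that G_subset by (subst smult_pure) auto
    qed
    finally show ?thesis .
  qed
  have surj: "p ` carrier AG = carrier BC"
  proof -
    note D = BC.submoduleE[OF submodule_image[OF AG.module_axioms BC p]]
      submodule_zero[OF submodule_image[OF AG.module_axioms BC p]]
    have uminus: "\<ominus>\<^bsub>BC\<^esub> x = \<ominus>\<^bsub>T\<^esub> x" for x
      by (simp add: a_inv_def m_inv_def base_change_def Let_def)
    \<comment> \<open>That pure tensors span is known for submodules over \<open>R\<close>, so the
      image of \<open>p\<close> is viewed over \<open>R\<close>, with \<open>r\<close> acting as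
      \<open>\<iota> r\<close>.\<close>
    have "submodule (p ` carrier AG) R T"
    proof (rule T.submoduleI)
      fix r x assume r: "r \<in> carrier R" and "x \<in> p ` carrier AG"
      then obtain w where w: "w \<in> carrier AG" "x = p w" by blast
      have rw: "(\<lambda>g. r \<odot>\<^bsub>A\<^esub> w g) = \<iota> r \<odot>\<^bsub>AG\<^esub> w"
        using AG_coeff[OF w(1)] r by (simp add: smult_eq_\<iota>)
      have "r \<odot>\<^bsub>T\<^esub> x = p (\<iota> r \<odot>\<^bsub>AG\<^esub> w)"
        unfolding w(2) p_eq[OF w(1)] p_eq[OF AG.smult_closed[OF \<iota>_closed[OF r] w(1)]]
        using smult_tensor_sum[OF AG_coeff[OF w(1)] r] rw by simp
      then show "r \<odot>\<^bsub>T\<^esub> x \<in> p ` carrier AG"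
        using AG.smult_closed[OF \<iota>_closed[OF r] w(1)] by blast
    qed (use D in \<open>simp_all add: base_change_simps uminus\<close>)
    moreover have "pure_tensor R M A m a \<in> p ` carrier AG" if m: "m \<in> carrier M" and a: "a \<in> carrier A" for m a
    proof -
      obtain v where v: "v \<in> carrier FG" "m = \<pi> v" using m \<pi>_surj by blast
      have "(\<lambda>g. v g \<odot>\<^bsub>A\<^esub> a) \<in> carrier AG"
        using finite_G FG_coeff[OF v(1)] a free_module_outside[OF v(1)]
        by (intro A.free_module_finite_carrierI) simp_all
      then show ?thesis
        using p_eq pure_eq_tensor_sum[OF v(1) a] v(2) by (metis imageI)
    qed
    ultimately show ?thesis
      using tensor_submodule_eq by (simp add: base_change_simps)
  qed
  obtain h where h: "h \<in> module_hom A BC AG" "\<forall>x\<in>carrier BC. p (h x) = x"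
    using projective_module_lift[OF P AG.module_axioms BC e1 e2 p surj module_hom_id] by blast
  \<comment> \<open>The projection of A^G onto the kernel of \<open>p\<close> that belongs to the
    splitting \<open>h\<close>.\<close>
  define \<psi> where "\<psi> w = w \<ominus>\<^bsub>AG\<^esub> h (p w)" for w
  have hp: "(\<lambda>w. h (p w)) \<in> module_hom A AG AG"
    by (rule module_hom_comp[OF p h(1)])
  note hpc = module_hom_closed[OF hp]
  have \<psi>: "\<psi> \<in> module_hom A AG AG"
    unfolding \<psi>_def
    by (rule module_homI)
      (simp_all add: hpc AG.M.minus_eq AG.smult_r_distr AG.smult_r_minus AG.M.minus_add AG.M.a_ac
        module_hom_add[OF hp] module_hom_smult[OF hp] del: free_module_simps)
  have p\<psi>: "p (\<psi> w) = \<zero>\<^bsub>BC\<^esub>" if w: "w \<in> carrier AG" for w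
    using module_hom_minus[OF AG.module_axioms BC p w hpc[OF w]] h(2) module_hom_closed[OF p w]
    by (simp add: \<psi>_def BC.M.minus_eq BC.M.r_neg)
  have vc: "v i \<in> carrier R" if "v \<in> V" for v i
    using that V_coeff by blast
  have span: "\<psi> (free_basis A g) \<in> coefficient_span A V" if g: "g \<in> G" for g
  proof -
    let ?u = "\<psi> (free_basis A g)"
    have u: "?u \<in> carrier AG"
      by (rule module_hom_closed[OF \<psi> A.free_basis_carrier[OF g]])
    have "tensor_sum ?u = \<zero>\<^bsub>T\<^esub>"
      using p\<psi>[OF A.free_basis_carrier[OF g]] p_eq[OF u] by (simp add: base_change_simps)
    moreover have "(\<lambda>h. if h \<in> G then ?u h else \<zero>\<^bsub>A\<^esub>) = ?u"
      using free_module_outside[OF u] by auto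
    ultimately show ?thesis
      using tensor_vanish[of ?u] AG_coeff[OF u] by (simp add: tensor_sum_def Pi_I)
  qed
  \<comment> \<open>The A-linear extension of \<theta>, whose matrix is that of \<theta> with its
    entries mapped into A.\<close>
  define lift where "lift \<theta> = free_lift A AG (\<lambda>g i. \<iota> (\<theta> (free_basis R g) i))" for \<theta> :: "('c \<Rightarrow> 'a) \<Rightarrow> ('c \<Rightarrow> 'a)"
  have lift_Pi: "(\<lambda>g i. \<iota> (\<theta> (free_basis R g) i)) \<in> G \<rightarrow> carrier AG"
    if "\<theta> \<in> module_hom R FG FG" for \<theta>
    by (intro Pi_I \<iota>_AG module_hom_closed[OF that] R.free_basis_carrier)
  have lift: "lift \<theta> \<in> module_hom A AG AG" if "\<theta> \<in> module_hom R FG FG" for \<theta>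
    unfolding lift_def by (rule AG.free_lift_hom[OF lift_Pi[OF that]])
  have lift_\<iota>: "lift \<theta> (\<lambda>i. \<iota> (v i)) = (\<lambda>i. \<iota> (\<theta> v i))"
    if \<theta>: "\<theta> \<in> module_hom R FG FG" and v: "v \<in> carrier FG" for \<theta> v
  proof
    fix i
    note vc = FG_coeff[OF v]
    have tc: "\<theta> (free_basis R g) i \<in> carrier R" if "g \<in> G" for g
      by (rule FG_coeff[OF module_hom_closed[OF \<theta> R.free_basis_carrier[OF that]]])
    have 1: "(\<lambda>g. \<iota> (v g) \<odot>\<^bsub>AG\<^esub> (\<lambda>i. \<iota> (\<theta> (free_basis R g) i))) \<in> G \<rightarrow> carrier AG"
      using lift_Pi[OF \<theta>] by (intro Pi_I AG.smult_closed \<iota>_closed vc) blast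
    have "lift \<theta> (\<lambda>i. \<iota> (v i))
        = (\<Oplus>\<^bsub>AG\<^esub>g\<in>G. \<iota> (v g) \<odot>\<^bsub>AG\<^esub> (\<lambda>i. \<iota> (\<theta> (free_basis R g) i)))"
      unfolding lift_def using free_module_support(2)[OF \<iota>_AG[OF v]]
      by (rule AG.free_lift_superset[OF \<iota>_AG[OF v] lift_Pi[OF \<theta>] finite_G]) simp
    then have "lift \<theta> (\<lambda>i. \<iota> (v i)) i = (\<Oplus>\<^bsub>A\<^esub>g\<in>G. \<iota> (v g) \<otimes>\<^bsub>A\<^esub> \<iota> (\<theta> (free_basis R g) i))"
      using A.free_module_finsum[OF 1] by simp
    also have "\<dots> = (\<Oplus>\<^bsub>A\<^esub>g\<in>G. \<iota> (v g \<otimes> \<theta> (free_basis R g) i))"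
      by (intro N.M.add.finprod_cong' refl Pi_I \<iota>_closed R.m_closed vc tc)
        (simp_all add: \<iota>_mult vc tc)
    also have "\<dots> = \<iota> (\<Oplus>g\<in>G. v g \<otimes> \<theta> (free_basis R g) i)"
      by (intro \<iota>_finsum[symmetric] Pi_I R.m_closed vc tc)
    also have "(\<Oplus>g\<in>G. v g \<otimes> \<theta> (free_basis R g) i) = \<theta> v i"
    proof -
      have "(\<lambda>g. v g \<odot>\<^bsub>FG\<^esub> \<theta> (free_basis R g)) \<in> G \<rightarrow> carrier FG"
        by (intro Pi_I FG.smult_closed vc module_hom_closed[OF \<theta>] R.free_basis_carrier)
      from R.free_module_finsum[OF this, of i] show ?thesis
        using FG.free_hom_expand[OF \<theta> v finite_G] by simp
    qed
    finally show "lift \<theta> (\<lambda>i. \<iota> (v i)) i = \<iota> (\<theta> v i)" .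
  qed
  define kills where "kills V0 u \<longleftrightarrow> (\<forall>\<theta>\<in>module_hom R FG FG.
      (\<forall>v\<in>V0. \<theta> v = \<zero>\<^bsub>FG\<^esub>) \<longrightarrow> lift \<theta> u = \<zero>\<^bsub>AG\<^esub>)" for V0 u
  \<comment> \<open>Only finitely many elements of \<open>V\<close> enter into a member of the span;
    if \<theta> kills these, its extension kills the member.\<close>
  have kill: "\<exists>V0. finite V0 \<and> V0 \<subseteq> V \<and> kills V0 u \<and> u \<in> carrier AG"
    if "u \<in> coefficient_span A V" for u
    using that
  proof induction
    case (base k n)
    have k: "k \<in> carrier FG" using base(1) by (simp add: V_iff)
    have u: "(\<lambda>i. k i \<odot>\<^bsub>A\<^esub> n) = n \<odot>\<^bsub>AG\<^esub> (\<lambda>i. \<iota> (k i))"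
      using FG_coeff[OF k] base(2) by (simp add: smult_eq_\<iota> A.m_comm)
    have "kills {k} (\<lambda>i. k i \<odot>\<^bsub>A\<^esub> n)"
      unfolding kills_def
    proof (intro ballI impI)
      fix \<theta> assume \<theta>: "\<theta> \<in> module_hom R FG FG" and "\<forall>v\<in>{k}. \<theta> v = \<zero>\<^bsub>FG\<^esub>"
      then have "lift \<theta> (\<lambda>i. \<iota> (k i)) = \<zero>\<^bsub>AG\<^esub>"
        by (simp add: lift_\<iota>[OF \<theta> k])
      then show "lift \<theta> (\<lambda>i. k i \<odot>\<^bsub>A\<^esub> n) = \<zero>\<^bsub>AG\<^esub>"
        unfolding u module_hom_smult[OF lift[OF \<theta>] base(2) \<iota>_AG[OF k]] using base(2) by simp
    qed
    moreover have "(\<lambda>i. k i \<odot>\<^bsub>A\<^esub> n) \<in> carrier AG"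
      unfolding u by (rule AG.smult_closed[OF base(2) \<iota>_AG[OF k]])
    ultimately show ?case
      using base(1) by (intro exI[of _ "{k}"]) simp
  next
    case (add u v)
    then obtain V1 V2 where V1: "finite V1" "V1 \<subseteq> V" "kills V1 u" "u \<in> carrier AG"
      and V2: "finite V2" "V2 \<subseteq> V" "kills V2 v" "v \<in> carrier AG"
      by blast
    have eq: "(\<lambda>i. u i \<oplus>\<^bsub>A\<^esub> v i) = u \<oplus>\<^bsub>AG\<^esub> v" by simp
    have "kills (V1 \<union> V2) (u \<oplus>\<^bsub>AG\<^esub> v)"
      unfolding kills_def
    proof (intro ballI impI)
      fix \<theta> assume \<theta>: "\<theta> \<in> module_hom R FG FG" and z: "\<forall>v\<in>V1 \<union> V2. \<theta> v = \<zero>\<^bsub>FG\<^esub>"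
      have "lift \<theta> u = \<zero>\<^bsub>AG\<^esub>" "lift \<theta> v = \<zero>\<^bsub>AG\<^esub>"
        using V1(3)[unfolded kills_def, rule_format, OF \<theta>]
          V2(3)[unfolded kills_def, rule_format, OF \<theta>] z by simp_all
      then show "lift \<theta> (u \<oplus>\<^bsub>AG\<^esub> v) = \<zero>\<^bsub>AG\<^esub>"
        unfolding module_hom_add[OF lift[OF \<theta>] V1(4) V2(4)] by simp
    qed
    moreover have "u \<oplus>\<^bsub>AG\<^esub> v \<in> carrier AG" by (rule AG.M.add.m_closed[OF V1(4) V2(4)])
    ultimately show ?case
      unfolding eq using V1(1,2) V2(1,2)
      by (intro exI[of _ "V1 \<union> V2"] conjI finite_UnI Un_least)
  qed
  have "\<forall>g\<in>G. \<exists>V0. finite V0 \<and> V0 \<subseteq> V \<and> kills V0 (\<psi> (free_basis A g))"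
    using kill[OF span] by blast
  then obtain W where W: "\<And>g. g \<in> G \<Longrightarrow> finite (W g) \<and> W g \<subseteq> V \<and> kills (W g) (\<psi> (free_basis A g))"
    unfolding bchoice_iff by blast
  show ?thesis
  proof (intro exI[of _ "\<Union>g\<in>G. W g"] conjI ballI impI allI)
    show "finite (\<Union>g\<in>G. W g)" using finite_G W by blast
    show "(\<Union>g\<in>G. W g) \<subseteq> V" using W by blast
    fix \<theta> v i
    assume \<theta>: "\<theta> \<in> module_hom R FG FG" and z: "\<forall>v\<in>\<Union>g\<in>G. W g. \<theta> v = \<zero>\<^bsub>FG\<^esub>" and v: "v \<in> V"
    have vF: "v \<in> carrier FG" "\<pi> v = \<zero>\<^bsub>M\<^esub>" using v by (simp_all add: V_iff)
    let ?w = "\<lambda>i. \<iota> (v i)"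
    have w: "?w \<in> carrier AG" by (rule \<iota>_AG[OF vF(1)])
    \<comment> \<open>The image of a relation lies in the kernel of \<open>p\<close>, where
      \<open>\<psi>\<close> is the identity; so it suffices that the extension of \<theta> kills
      \<open>\<psi>\<close> of every basis vector.\<close>
    have "p ?w = pure_tensor R M A (\<pi> v) \<one>\<^bsub>A\<^esub>"
      unfolding p_eq[OF w] pure_eq_tensor_sum[OF vF(1) A.one_closed] by (simp add: \<iota>_def)
    also have "\<dots> = \<zero>\<^bsub>BC\<^esub>"
      unfolding vF(2) base_change_simps
      by (rule module_hom_zero[OF module_axioms T.module_axioms pure_hom_left]) simp
    finally have "\<psi> ?w = ?w"
      unfolding \<psi>_def using w by (simp add: module_hom_zero[OF BC AG.module_axioms h(1)]
          AG.M.minus_eq AG.M.uminus_zero del: free_module_simps)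
    moreover have "lift \<theta> (\<psi> ?w) \<in> {\<zero>\<^bsub>AG\<^esub>}"
    proof (rule AG.free_hom_vimage[OF module_hom_comp[OF \<psi> lift[OF \<theta>]] AG.zero_submodule _ w])
      show "lift \<theta> (\<psi> (free_basis A g)) \<in> {\<zero>\<^bsub>AG\<^esub>}" if "g \<in> G" for g
        using W[OF that] \<theta> z that unfolding kills_def by blast
    qed
    ultimately have "lift \<theta> ?w = \<zero>\<^bsub>AG\<^esub>" by simp
    then show "\<iota> (\<theta> v i) = \<zero>\<^bsub>A\<^esub>"
      unfolding lift_\<iota>[OF \<theta> vF(1)] by (simp add: fun_eq_iff)
  qed
qed

end


section \<open>The ring of indexed polynomials\<close>

lemma finite_subseteq_mset: "finite {k. k \<subseteq># m}"
proof (induction m)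
  case (add x m)
  have "{k. k \<subseteq># add_mset x m} \<subseteq> {k. k \<subseteq># m} \<union> add_mset x ` {k. k \<subseteq># m}"
  proof
    fix k assume k: "k \<in> {k. k \<subseteq># add_mset x m}"
    show "k \<in> {k. k \<subseteq># m} \<union> add_mset x ` {k. k \<subseteq># m}"
    proof (cases "x \<in># k")
      case True
      then obtain k' where "k = add_mset x k'" by (metis insert_DiffM)
      then show ?thesis using k by auto
    next
      case False
      then have "count k y \<le> count m y" for y
        using mset_subset_eq_count[of k "add_mset x m" y] k
        by (cases "y = x") (simp_all add: not_in_iff)
      then have "k \<subseteq># m" by (rule mset_subset_eqI)
      then show ?thesis by simp
    qed
  qed
  then show ?case by (rule finite_subset) (use add in simp)
qed simp

context cring
begin

text \<open>The product of \<open>indexed_poly_ring\<close>, but on all coefficient functions, that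
  is, on formal power series: \<open>mset_prod\<close>, to which it is applied below, is not a
  polynomial in general.\<close>

definition convolution :: "('c multiset \<Rightarrow> 'a) \<Rightarrow> ('c multiset \<Rightarrow> 'a) \<Rightarrow> 'c multiset \<Rightarrow> 'a"
  where "convolution P Q = (\<lambda>m. \<Oplus>k\<in>{k. k \<subseteq># m}. P k \<otimes> Q (m - k))"

lemma convolution_carrier:
  assumes "carrier_coeff P" "carrier_coeff Q"
  shows "carrier_coeff (convolution P Q)"
  using assms unfolding carrier_coeff_def convolution_def by (intro allI finsum_closed) auto

lemma convolution_const:
  assumes a: "a \<in> carrier R" and Q: "carrier_coeff Q"
  shows "convolution (indexed_const a) Q = (\<lambda>m. a \<otimes> Q m)"
proof
  fix m
  note [simp] = carrier_coeffE[OF Q]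
  have "convolution (indexed_const a) Q m = (\<Oplus>k\<in>{k. k \<subseteq># m}. if {#} = k then a \<otimes> Q (m - k) else \<zero>)"
    unfolding convolution_def using a
    by (intro add.finprod_cong') (auto simp: indexed_const_def)
  also have "\<dots> = a \<otimes> Q (m - {#})"
    using a by (intro add.finprod_singleton finite_subseteq_mset) auto
  finally show "convolution (indexed_const a) Q m = a \<otimes> Q m" by simp
qed

lemma convolution_add:
  assumes "carrier_coeff P" "carrier_coeff P'" "carrier_coeff Q"
  shows "convolution (indexed_padd P P') Q = indexed_padd (convolution P Q) (convolution P' Q)"
proof
  fix m
  note [simp] = carrier_coeffE[OF assms(1)] carrier_coeffE[OF assms(2)] carrier_coeffE[OF assms(3)]
  have "convolution (indexed_padd P P') Q m
      = (\<Oplus>k\<in>{k. k \<subseteq># m}. P k \<otimes> Q (m - k) \<oplus> P' k \<otimes> Q (m - k))"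
    unfolding convolution_def by (simp add: indexed_padd_def l_distr)
  also have "\<dots> = indexed_padd (convolution P Q) (convolution P' Q) m"
    unfolding convolution_def indexed_padd_def by (intro finsum_addf) auto
  finally show "convolution (indexed_padd P P') Q m = indexed_padd (convolution P Q) (convolution P' Q) m" .
qed

lemma convolution_pmult:
  assumes "carrier_coeff P" "carrier_coeff Q"
  shows "convolution (indexed_pmult P i) Q = indexed_pmult (convolution P Q) i"
proof
  fix m
  note [simp] = carrier_coeffE[OF assms(1)] carrier_coeffE[OF assms(2)]
  show "convolution (indexed_pmult P i) Q m = indexed_pmult (convolution P Q) i m"
  proof (cases "i \<in># m")
    case False
    then have "i \<notin># k" if "k \<subseteq># m" for k
      using that mset_subset_eqD by metis
    then have "convolution (indexed_pmult P i) Q m = \<zero>"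
      unfolding convolution_def by (intro add.finprod_one_eqI) (auto simp: indexed_pmult_def)
    then show ?thesis using False by (simp add: indexed_pmult_def)
  next
    case True
    then obtain m' where m: "m = add_mset i m'" by (metis insert_DiffM)
    let ?f = "\<lambda>k. indexed_pmult P i k \<otimes> Q (m - k)"
    have f: "?f k \<in> carrier R" for k
      by (simp add: indexed_pmult_def)
    have inj: "inj_on (add_mset i) {k. k \<subseteq># m'}"
      by (simp add: inj_on_def)
    have "convolution (indexed_pmult P i) Q m = (\<Oplus>k\<in>add_mset i ` {k. k \<subseteq># m'}. ?f k)"
      unfolding convolution_def
    \<comment> \<open>Only the parts \<open>k\<close> of \<open>m\<close> that contain
      \<open>i\<close> contribute, and they are the parts of \<open>m'\<close> with one
      \<open>i\<close> added.\<close>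
    proof (rule add.finprod_mono_neutral_cong_right[OF finite_subseteq_mset])
      show "add_mset i ` {k. k \<subseteq># m'} \<subseteq> {k. k \<subseteq># m}"
        by (auto simp: m)
      fix k assume k: "k \<in> {k. k \<subseteq># m} - add_mset i ` {k. k \<subseteq># m'}"
      have "i \<notin># k"
      proof
        assume "i \<in># k"
        then obtain k' where "k = add_mset i k'" by (metis insert_DiffM)
        then show False using k by (auto simp: m)
      qed
      then show "?f k = \<zero>" by (simp add: indexed_pmult_def)
    qed (use f in auto)
    also have "\<dots> = (\<Oplus>k\<in>{k. k \<subseteq># m'}. ?f (add_mset i k))"
      by (rule finsum_reindex[OF _ inj]) (use f in auto)
    also have "\<dots> = convolution P Q m'"
      unfolding convolution_def by (simp add: m indexed_pmult_def)
    finally show ?thesis by (simp add: m indexed_pmult_def)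
  qed
qed

lemma convolution_comm:
  fixes P Q :: "'c multiset \<Rightarrow> 'a"
  assumes "carrier_coeff P" "carrier_coeff Q"
  shows "convolution P Q = convolution Q P"
proof
  fix m :: "'c multiset"
  note [simp] = carrier_coeffE[OF assms(1)] carrier_coeffE[OF assms(2)]
  let ?K = "{k. k \<subseteq># m}"
  have inv: "m - (m - k) = k" if "k \<subseteq># m" for k :: "'c multiset"
    using that by (intro multiset_eqI) (simp add: subseteq_mset_def)
  have bij: "(\<lambda>k. m - k) ` ?K = ?K" "inj_on (\<lambda>k. m - k) ?K"
  proof -
    show "inj_on (\<lambda>k. m - k) ?K"
      by (rule inj_onI) (metis inv mem_Collect_eq)
    show "(\<lambda>k. m - k) ` ?K = ?K"
      using inv by (auto simp: image_iff) (metis diff_subset_eq_self)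
  qed
  have "convolution P Q m = (\<Oplus>k\<in>(\<lambda>k. m - k) ` ?K. P k \<otimes> Q (m - k))"
    unfolding convolution_def bij(1) ..
  also have "\<dots> = (\<Oplus>k\<in>?K. P (m - k) \<otimes> Q (m - (m - k)))"
    by (rule finsum_reindex[OF _ bij(2)]) auto
  also have "\<dots> = convolution Q P m"
    unfolding convolution_def by (intro add.finprod_cong') (auto simp: inv m_comm)
  finally show "convolution P Q m = convolution Q P m" .
qed

abbreviation polys :: "'c set \<Rightarrow> ('c multiset \<Rightarrow> 'a) set"
  where "polys I \<equiv> indexed_pset I (carrier R)"

lemma polys_coeff: "P \<in> polys I \<Longrightarrow> carrier_coeff P"
  by (rule indexed_pset_in_carrier[OF subset_refl])

text \<open>Induction on the construction of \<open>P\<close> takes the place of a double sum over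
  factorizations: constants, sums and multiplication by an indeterminate all pass through a
  convolution. The last factor may thus be a power series such as \<open>mset_prod\<close>.\<close>

lemma convolution_assoc:
  assumes "P \<in> polys I" "carrier_coeff Q" "carrier_coeff Z"
  shows "convolution (convolution P Q) Z = convolution P (convolution Q Z)"
  using assms(1)
proof induction
  case (indexed_const a)
  note [simp] = carrier_coeffE[OF assms(2)] carrier_coeffE[OF assms(3)]
  have "convolution (\<lambda>m. a \<otimes> Q m) Z m = a \<otimes> convolution Q Z m" for m
    unfolding convolution_def
    by (subst finsum_rdistr[OF finite_subseteq_mset]) (auto simp: indexed_const m_assoc)
  then show ?case
    unfolding convolution_const[OF indexed_const assms(2)]
      convolution_const[OF indexed_const convolution_carrier[OF assms(2,3)]] by (rule ext)
next
  case (indexed_padd P P')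
  then show ?case
    using assms by (simp add: convolution_add convolution_carrier polys_coeff)
next
  case (indexed_pmult P i)
  then show ?case
    using assms by (simp add: convolution_pmult convolution_carrier polys_coeff)
qed

lemma polys_smult:
  fixes P :: "'c multiset \<Rightarrow> 'a"
  shows "\<lbrakk>P \<in> polys I; a \<in> carrier R\<rbrakk> \<Longrightarrow> (\<lambda>m. a \<otimes> P m) \<in> polys I"
proof (induction P rule: indexed_pset.induct)
  case (indexed_const k)
  then have "(\<lambda>m :: 'c multiset. a \<otimes> indexed_const k m) = indexed_const (a \<otimes> k)"
    by (auto simp: indexed_const_def)
  then show ?case
    using indexed_pset.indexed_const[OF m_closed[OF indexed_const(2,1)], of I] by (simp only:)
next
  case (indexed_padd P Q)
  then have "(\<lambda>m. a \<otimes> (indexed_padd P Q) m) = indexed_padd (\<lambda>m. a \<otimes> P m) (\<lambda>m. a \<otimes> Q m)"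
    using carrier_coeffE[OF polys_coeff[OF indexed_padd(1)]] carrier_coeffE[OF polys_coeff[OF indexed_padd(2)]]
    by (auto simp: indexed_padd_def r_distr)
  then show ?case
    using indexed_pset.indexed_padd[OF indexed_padd.IH(1)[OF indexed_padd.prems] indexed_padd.IH(2)[OF indexed_padd.prems]]
    by (simp only:)
next
  case (indexed_pmult P i)
  then have "(\<lambda>m. a \<otimes> (indexed_pmult P i) m) = indexed_pmult (\<lambda>m. a \<otimes> P m) i"
    by (auto simp: indexed_pmult_def)
  then show ?case
    using indexed_pset.indexed_pmult[OF indexed_pmult.IH[OF indexed_pmult.prems] indexed_pmult.hyps(2)] by (simp only:)
qed

lemma polys_convolution:
  assumes "P \<in> polys I" "Q \<in> polys I"
  shows "convolution P Q \<in> polys I"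
  using assms(1)
proof induction
  case (indexed_const a)
  then show ?case using assms(2) by (simp add: convolution_const polys_coeff polys_smult)
next
  case (indexed_padd P P')
  then show ?case
    using assms(2) by (simp add: convolution_add polys_coeff indexed_pset.indexed_padd)
next
  case (indexed_pmult P i)
  then show ?case
    using assms(2) by (simp add: convolution_pmult polys_coeff indexed_pset.indexed_pmult)
qed

lemma indexed_poly_ring_simps [simp]:
  "carrier (indexed_poly_ring R I) = polys I"
  "P \<otimes>\<^bsub>indexed_poly_ring R I\<^esub> Q = convolution P Q"
  "P \<oplus>\<^bsub>indexed_poly_ring R I\<^esub> Q = indexed_padd P Q"
  "\<one>\<^bsub>indexed_poly_ring R I\<^esub> = indexed_const \<one>"
  "\<zero>\<^bsub>indexed_poly_ring R I\<^esub> = indexed_const \<zero>"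
  by (simp_all add: indexed_poly_ring_def convolution_def)

lemma indexed_poly_ring_cring: "cring (indexed_poly_ring R I)"
proof (rule cringI)
  let ?P = "indexed_poly_ring R I"
  note c = carrier_coeffE[OF polys_coeff]
  show "abelian_group ?P"
  proof (rule abelian_groupI)
    fix P assume P: "P \<in> carrier ?P"
    let ?Q = "\<lambda>m. \<ominus> \<one> \<otimes> P m"
    have "?Q \<in> carrier ?P" using P by (simp add: polys_smult)
    moreover have "?Q \<oplus>\<^bsub>?P\<^esub> P = \<zero>\<^bsub>?P\<^esub>"
      using c[of P I] P by (auto simp: indexed_padd_def indexed_const_def l_minus l_neg)
    ultimately show "\<exists>Q\<in>carrier ?P. Q \<oplus>\<^bsub>?P\<^esub> P = \<zero>\<^bsub>?P\<^esub>" by blast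
    show "\<zero>\<^bsub>?P\<^esub> \<oplus>\<^bsub>?P\<^esub> P = P"
      using P by (simp add: indexed_padd_zero polys_coeff)
  next
    fix P Q assume P: "P \<in> carrier ?P" and Q: "Q \<in> carrier ?P"
    show "P \<oplus>\<^bsub>?P\<^esub> Q = Q \<oplus>\<^bsub>?P\<^esub> P"
      using P Q by (auto simp: indexed_padd_def c a_comm)
    fix Z assume Z: "Z \<in> carrier ?P"
    show "P \<oplus>\<^bsub>?P\<^esub> Q \<oplus>\<^bsub>?P\<^esub> Z = P \<oplus>\<^bsub>?P\<^esub> (Q \<oplus>\<^bsub>?P\<^esub> Z)"
      using P Q Z by (auto simp: indexed_padd_def c a_assoc)
  qed (simp_all add: indexed_pset.intros)
  show "comm_monoid ?P"
  proof (rule comm_monoidI)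
    fix P Q Z assume P: "P \<in> carrier ?P" and Q: "Q \<in> carrier ?P" and Z: "Z \<in> carrier ?P"
    show "P \<otimes>\<^bsub>?P\<^esub> Q \<otimes>\<^bsub>?P\<^esub> Z = P \<otimes>\<^bsub>?P\<^esub> (Q \<otimes>\<^bsub>?P\<^esub> Z)"
      using P Q Z by (simp add: convolution_assoc[of P I] polys_coeff)
  next
    fix P Q assume P: "P \<in> carrier ?P" and Q: "Q \<in> carrier ?P"
    show "P \<otimes>\<^bsub>?P\<^esub> Q = Q \<otimes>\<^bsub>?P\<^esub> P"
      unfolding indexed_poly_ring_simps using P Q by (intro convolution_comm polys_coeff[of _ I]) simp_all
    show "\<one>\<^bsub>?P\<^esub> \<otimes>\<^bsub>?P\<^esub> P = P"
      using P c[of P I] by (simp add: convolution_const polys_coeff)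
  qed (simp_all add: polys_convolution indexed_pset.intros)
  show "(P \<oplus>\<^bsub>?P\<^esub> Q) \<otimes>\<^bsub>?P\<^esub> Z = P \<otimes>\<^bsub>?P\<^esub> Z \<oplus>\<^bsub>?P\<^esub> Q \<otimes>\<^bsub>?P\<^esub> Z"
    if "P \<in> carrier ?P" "Q \<in> carrier ?P" "Z \<in> carrier ?P" for P Q Z
    using that by (simp add: convolution_add polys_coeff)
qed

lemma indexed_const_hom: "indexed_const \<in> ring_hom R (indexed_poly_ring R I)"
proof (rule ring_hom_memI)
  fix a b assume ab: "a \<in> carrier R" "b \<in> carrier R"
  show "indexed_const (a \<otimes> b) = indexed_const a \<otimes>\<^bsub>indexed_poly_ring R I\<^esub> indexed_const b"
    unfolding indexed_poly_ring_simps
      convolution_const[OF ab(1) polys_coeff[OF indexed_pset.indexed_const[OF ab(2)]]]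
    using ab by (auto simp: indexed_const_def)
qed (simp_all add: indexed_pset.intros indexed_padd_const)

lemma indexed_var_poly: "i \<in> I \<Longrightarrow> indexed_var i \<in> polys I"
  unfolding indexed_var_def by (intro indexed_pset.intros one_closed)

end


section \<open>The kernel of the pointwise localization\<close>

context cring
begin

text \<open>An ideal maximal among those that contain no power of \<open>r\<close> is prime, and it
  exists by Zorn's lemma unless \<open>r\<close> is nilpotent.\<close>

lemma nilpotent_if_in_all_primes:
  assumes r: "r \<in> carrier R" and primes: "\<And>p. primeideal p R \<Longrightarrow> r \<in> p"
  shows "\<exists>n::nat. r [^] n = \<zero>"
proof (rule ccontr)
  assume not_nil: "\<nexists>n::nat. r [^] n = \<zero>"
  define \<A> where "\<A> = {p. ideal p R \<and> (\<forall>n::nat. r [^] n \<notin> p)}"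
  have zero: "{\<zero>} \<in> \<A>"
    using zeroideal not_nil by (auto simp: \<A>_def)
  have "\<exists>p\<in>\<A>. \<forall>q\<in>\<A>. p \<subseteq> q \<longrightarrow> q = p"
  proof (rule subset_Zorn_nonempty)
    show "\<A> \<noteq> {}" using zero by blast
    fix C assume C: "C \<noteq> {}" "subset.chain \<A> C"
    then have "subset.chain {I. ideal I R} C" and sub: "C \<subseteq> \<A>"
      by (auto simp: subset.chain_def \<A>_def)
    from chain_Union_is_ideal[OF this(1)] show "\<Union>C \<in> \<A>"
      using C(1) sub by (auto simp: \<A>_def)
  qed
  then obtain p where pA: "p \<in> \<A>" and maxA: "\<forall>q\<in>\<A>. p \<subseteq> q \<longrightarrow> q = p" ..
  have p: "ideal p R" "r [^] n \<notin> p" for n :: nat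
    using pA by (simp_all add: \<A>_def)
  have max: "q = p" if "ideal q R" "\<nexists>n::nat. r [^] n \<in> q" "p \<subseteq> q" for q
    using maxA that by (simp add: \<A>_def)
  interpret p: ideal p R by (rule p(1))
  \<comment> \<open>By maximality the larger ideal p + (a) contains a power of
    \<open>r\<close>.\<close>
  have power: "\<exists>n::nat. \<exists>u\<in>p. \<exists>x\<in>carrier R. r [^] n = u \<oplus> x \<otimes> a"
    if a: "a \<in> carrier R" "a \<notin> p" for a
  proof -
    let ?q = "p <+>\<^bsub>R\<^esub> PIdl a"
    have mem: "u \<oplus> x \<otimes> a \<in> ?q" if "u \<in> p" "x \<in> carrier R" for u x
      using that by (auto simp: set_add_def' cgenideal_def)
    have "p \<subseteq> ?q"
    proof
      fix u assume "u \<in> p"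
      then show "u \<in> ?q" using mem[of u \<zero>] a(1) by simp
    qed
    moreover have "a \<in> ?q" using mem[of \<zero> \<one>] a(1) by simp
    ultimately have "\<exists>n::nat. r [^] n \<in> ?q"
      using max[OF add_ideals[OF p(1) cgenideal_ideal[OF a(1)]]] a(2) by blast
    then show ?thesis
      by (auto simp: set_add_def' cgenideal_def)
  qed
  have "primeideal p R"
  proof (rule primeidealI[OF p(1) is_cring])
    show "carrier R \<noteq> p" using p(2)[of 0] by auto
    fix a b assume a: "a \<in> carrier R" and b: "b \<in> carrier R" and ab: "a \<otimes> b \<in> p"
    show "a \<in> p \<or> b \<in> p"
    proof (rule ccontr)
      assume "\<not> (a \<in> p \<or> b \<in> p)"
      then obtain n m :: nat and u v x y where u: "u \<in> p" "x \<in> carrier R" "r [^] n = u \<oplus> x \<otimes> a"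
        and v: "v \<in> p" "y \<in> carrier R" "r [^] m = v \<oplus> y \<otimes> b"
        using power[OF a] power[OF b] by metis
      have c: "u \<in> carrier R" "v \<in> carrier R" using u v p.a_subset by auto
      \<comment> \<open>In the product of the two expansions every term has a factor
        \<open>u\<close>, \<open>v\<close> or \<open>a \<otimes> b\<close> from \<open>p\<close>, so
        a power of \<open>r\<close> would lie in \<open>p\<close>.\<close>
      have "r [^] (n + m) = u \<otimes> (v \<oplus> y \<otimes> b) \<oplus> (x \<otimes> a) \<otimes> v \<oplus> (x \<otimes> y) \<otimes> (a \<otimes> b)"
        using r a b c u(2) v(2) by (simp add: nat_pow_mult[symmetric] u(3) v(3) l_distr r_distr m_ac a_ac)
      also have "\<dots> \<in> p"
      proof (intro p.a_closed)
        show "u \<otimes> (v \<oplus> y \<otimes> b) \<in> p" using b c v by (intro p.I_r_closed u(1)) simp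
        show "x \<otimes> a \<otimes> v \<in> p" using a u by (intro p.I_l_closed v(1)) simp
        show "x \<otimes> y \<otimes> (a \<otimes> b) \<in> p" using u v by (intro p.I_l_closed ab) simp
      qed
      finally show False using p(2) by blast
    qed
  qed
  from primes[OF this] have "r [^] (1::nat) \<in> p" using r by simp
  then show False using p(2) by blast
qed

text \<open>Folding over a multiset wants an operation that commutes on the whole type, whereas
  multiplication is only known to commute on the carrier; the guard bridges this.\<close>

definition mset_prod :: "'a multiset \<Rightarrow> 'a"
  where "mset_prod = fold_mset (\<lambda>s x. if s \<in> carrier R \<and> x \<in> carrier R then s \<otimes> x else x) \<one>"

lemma mset_prod_commute:
  "comp_fun_commute (\<lambda>s x. if s \<in> carrier R \<and> x \<in> carrier R then s \<otimes> x else x)"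
  by standard (auto simp: fun_eq_iff m_lcomm)

lemma mset_prod_empty: "mset_prod {#} = \<one>"
  by (simp add: mset_prod_def)

lemma mset_prod_closed: "mset_prod m \<in> carrier R"
  by (induction m) (auto simp: mset_prod_def comp_fun_commute.fold_mset_add_mset[OF mset_prod_commute])

lemma mset_prod_add_mset: "s \<in> carrier R \<Longrightarrow> mset_prod (add_mset s m) = s \<otimes> mset_prod m"
  using mset_prod_closed[of m]
  by (simp add: mset_prod_def comp_fun_commute.fold_mset_add_mset[OF mset_prod_commute])

lemma mset_prod_coeff: "carrier_coeff mset_prod"
  by (simp add: carrier_coeff_def mset_prod_closed)

lemma mset_prod_notin_prime:
  assumes "primeideal p R" "set_mset m \<subseteq> carrier R - p"
  shows "mset_prod m \<notin> p"
proof -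
  interpret p: primeideal p R by fact
  show ?thesis
    using assms(2)
  proof (induction m)
    case empty
    then show ?case using p.one_imp_carrier p.I_notcarr by (auto simp: mset_prod_empty)
  next
    case (add s m)
    then show ?case using p.I_prime[OF _ mset_prod_closed[of m], of s] by (auto simp: mset_prod_add_mset)
  qed
qed

text \<open>Modulo a prime \<open>p\<close>, evaluate at \<open>x\<^sub>s = 1/s\<close> for \<open>s \<notin> p\<close> and \<open>x\<^sub>s = 0\<close> for \<open>s \<in> p\<close>. To stay
  inside \<open>R\<close>, the value is multiplied by the common denominator \<open>\<Prod>D\<close>: a monomial \<open>m\<close> contributes
  \<open>\<Prod>(D - m)\<close>, so that the value is a coefficient of the convolution with \<open>mset_prod\<close>.\<close>

definition vanishes_mod :: "'a set \<Rightarrow> 'a set \<Rightarrow> ('a multiset \<Rightarrow> 'a) \<Rightarrow> bool"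
  where "vanishes_mod S p E \<longleftrightarrow> carrier_coeff E \<and>
    (\<exists>D0. set_mset D0 \<subseteq> S - p \<and> (\<forall>D. set_mset D \<subseteq> S - p \<and> D0 \<subseteq># D \<longrightarrow> E D \<in> p))"

text \<open>A multiset that contains \<open>D1 + D2\<close> is beyond both bounds.\<close>

lemma vanishes_mod_add:
  assumes p: "ideal p R" and E: "vanishes_mod S p E" and E': "vanishes_mod S p E'"
  shows "vanishes_mod S p (indexed_padd E E')"
proof -
  interpret p: ideal p R by (rule p)
  obtain D1 where D1: "set_mset D1 \<subseteq> S - p" "\<And>D. \<lbrakk>set_mset D \<subseteq> S - p; D1 \<subseteq># D\<rbrakk> \<Longrightarrow> E D \<in> p"
    using E unfolding vanishes_mod_def by blast
  obtain D2 where D2: "set_mset D2 \<subseteq> S - p" "\<And>D. \<lbrakk>set_mset D \<subseteq> S - p; D2 \<subseteq># D\<rbrakk> \<Longrightarrow> E' D \<in> p"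
    using E' unfolding vanishes_mod_def by blast
  have "indexed_padd E E' D \<in> p" if "set_mset D \<subseteq> S - p" "D1 + D2 \<subseteq># D" for D
    using D1(2)[OF that(1) subset_mset.order_trans[OF _ that(2)]]
      D2(2)[OF that(1) subset_mset.order_trans[OF _ that(2)]]
    by (simp add: indexed_padd_def p.a_closed)
  then show ?thesis
    using D1(1) D2(1) E E' indexed_padd_in_carrier unfolding vanishes_mod_def
    by (intro conjI exI[of _ "D1 + D2"]) auto
qed

text \<open>Multiplication by x_t replaces the value at D by the value at D with one
  \<open>t\<close> removed. For \<open>t\<close> in \<open>p\<close> there is none to remove and the
  coefficient is zero, in accordance with x_t = 0; for \<open>t\<close> outside \<open>p\<close> the
  bound grows by one \<open>t\<close>.\<close>

lemma vanishes_mod_convolution: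
  assumes p: "ideal p R" and P: "P \<in> polys S" and E: "vanishes_mod S p E"
  shows "vanishes_mod S p (convolution P E)"
proof -
  interpret p: ideal p R by (rule p)
  have Ec: "carrier_coeff E" using E by (simp add: vanishes_mod_def)
  show ?thesis
    using P
  proof induction
    case (indexed_const a)
    have "carrier_coeff (\<lambda>m. a \<otimes> E m)"
      using indexed_const Ec by (simp add: carrier_coeff_def)
    moreover obtain D0 where "set_mset D0 \<subseteq> S - p" "\<And>D. \<lbrakk>set_mset D \<subseteq> S - p; D0 \<subseteq># D\<rbrakk> \<Longrightarrow> E D \<in> p"
      using E unfolding vanishes_mod_def by blast
    ultimately show ?case
      unfolding vanishes_mod_def convolution_const[OF indexed_const Ec]
      using p.I_l_closed[OF _ indexed_const] by blast
  next
    case (indexed_padd P Q)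
    then show ?case
      using vanishes_mod_add[OF p]
        convolution_add[OF polys_coeff[OF indexed_padd.hyps(1)] polys_coeff[OF indexed_padd.hyps(2)] Ec]
      by simp
  next
    case (indexed_pmult P t)
    let ?E = "convolution P E"
    from indexed_pmult.IH obtain D1 where D1: "set_mset D1 \<subseteq> S - p"
      "\<And>D. \<lbrakk>set_mset D \<subseteq> S - p; D1 \<subseteq># D\<rbrakk> \<Longrightarrow> ?E D \<in> p"
      unfolding vanishes_mod_def by blast
    have 1: "carrier_coeff (indexed_pmult ?E t)"
      using indexed_pmult.IH unfolding vanishes_mod_def by (intro indexed_pmult_in_carrier) auto
    have eq: "convolution (indexed_pmult P t) E
        = indexed_pmult ?E t"
      by (rule convolution_pmult[OF polys_coeff[OF indexed_pmult.hyps(1)] Ec])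
    show ?case
    proof (cases "t \<in> p")
      case True
      then have "indexed_pmult ?E t D \<in> p" if "set_mset D \<subseteq> S - p" for D
        using that by (auto simp: indexed_pmult_def)
      then show ?thesis
        unfolding vanishes_mod_def eq using 1 D1(1) by blast
    next
      case False
      have "indexed_pmult ?E t D \<in> p"
        if D: "set_mset D \<subseteq> S - p" "add_mset t D1 \<subseteq># D" for D
      proof -
        obtain D' where D': "D = add_mset t D'"
          using D(2) by (metis insert_DiffM mset_subset_eqD union_single_eq_member)
        then have "?E D' \<in> p" using D by (intro D1(2)) auto
        then show ?thesis by (simp add: indexed_pmult_def D')
      qed
      moreover have "set_mset (add_mset t D1) \<subseteq> S - p"
        using D1(1) False indexed_pmult.hyps(2) by simp
      ultimately show ?thesis
        unfolding vanishes_mod_def eq using 1 by blast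
    qed
  qed
qed

end


text \<open>The localization is a record with a scalar multiplication added to the operations of a
  quotient ring, so the ring axioms have to be carried over from one record to another.\<close>

lemma cring_cong:
  assumes "cring A" and eq: "carrier B = carrier A" "\<zero>\<^bsub>B\<^esub> = \<zero>\<^bsub>A\<^esub>" "\<one>\<^bsub>B\<^esub> = \<one>\<^bsub>A\<^esub>"
    and "add B = add A" "monoid.mult B = monoid.mult A"
  shows "cring B"
proof -
  interpret A: cring A by fact
  have ops: "x \<oplus>\<^bsub>B\<^esub> y = x \<oplus>\<^bsub>A\<^esub> y" "x \<otimes>\<^bsub>B\<^esub> y = x \<otimes>\<^bsub>A\<^esub> y" for x y
    using assms(5,6) by simp_all
  show ?thesis
  proof (rule cringI)
    show "abelian_group B"
    proof (rule abelian_groupI; unfold eq ops)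
      show "\<exists>y\<in>carrier A. y \<oplus>\<^bsub>A\<^esub> x = \<zero>\<^bsub>A\<^esub>" if "x \<in> carrier A" for x
        using A.l_neg[OF that] A.a_inv_closed[OF that] by blast
    qed (simp_all add: A.a_ac)
    show "comm_monoid B"
      by (rule comm_monoidI; unfold eq ops) (simp_all add: A.m_ac)
    show "(x \<oplus>\<^bsub>B\<^esub> y) \<otimes>\<^bsub>B\<^esub> z = x \<otimes>\<^bsub>B\<^esub> z \<oplus>\<^bsub>B\<^esub> y \<otimes>\<^bsub>B\<^esub> z"
      if "x \<in> carrier B" "y \<in> carrier B" "z \<in> carrier B" for x y z
      using that unfolding eq ops by (rule A.l_distr)
  qed
qed

section \<open>The defining ideal and the kernel of the structure map\<close>

context cring
begin

abbreviation pointwise_generators :: "'a set \<Rightarrow> ('a multiset \<Rightarrow> 'a) set"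
  where "pointwise_generators S \<equiv>
    (let P = indexed_poly_ring R S; c = indexed_const; x = indexed_var in
      {c s \<otimes>\<^bsub>P\<^esub> x s [^]\<^bsub>P\<^esub> (2::nat) \<ominus>\<^bsub>P\<^esub> x s | s. s \<in> S} \<union>
      {c s [^]\<^bsub>P\<^esub> (2::nat) \<otimes>\<^bsub>P\<^esub> x s \<ominus>\<^bsub>P\<^esub> c s | s. s \<in> S})"

lemma pointwise_ideal_eq:
  "pointwise_ideal R S = Idl\<^bsub>indexed_poly_ring R S\<^esub> (pointwise_generators S)"
  by (simp add: pointwise_ideal_def Let_def)

lemma pointwise_ideal_ideal:
  assumes S: "S \<subseteq> carrier R"
  shows "ideal (pointwise_ideal R S) (indexed_poly_ring R S)"
proof -
  interpret P: cring "indexed_poly_ring R S" by (rule indexed_poly_ring_cring)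
  have x: "indexed_var s \<in> carrier (indexed_poly_ring R S)" if "s \<in> S" for s
    using that by (simp add: indexed_var_poly)
  have c: "indexed_const s \<in> carrier (indexed_poly_ring R S)" if "s \<in> S" for s
    using that S by (auto intro: indexed_pset.indexed_const)
  show ?thesis
    unfolding pointwise_ideal_eq Let_def
  proof (rule P.genideal_ideal, rule Un_least; safe)
    fix s assume s: "s \<in> S"
    show "indexed_const s \<otimes>\<^bsub>indexed_poly_ring R S\<^esub> indexed_var s [^]\<^bsub>indexed_poly_ring R S\<^esub> (2::nat)
        \<ominus>\<^bsub>indexed_poly_ring R S\<^esub> indexed_var s \<in> carrier (indexed_poly_ring R S)"
      by (intro P.minus_closed P.m_closed P.nat_pow_closed x c s)
    show "indexed_const s [^]\<^bsub>indexed_poly_ring R S\<^esub> (2::nat) \<otimes>\<^bsub>indexed_poly_ring R S\<^esub> indexed_var s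
        \<ominus>\<^bsub>indexed_poly_ring R S\<^esub> indexed_const s \<in> carrier (indexed_poly_ring R S)"
      by (intro P.minus_closed P.m_closed P.nat_pow_closed x c s)
  qed
qed

lemma convolution_minus:
  assumes P: "P \<in> polys I" and Q: "Q \<in> polys I" and E: "carrier_coeff E"
  shows "convolution (P \<ominus>\<^bsub>indexed_poly_ring R I\<^esub> Q) E D = convolution P E D \<ominus> convolution Q E D"
proof -
  interpret P: cring "indexed_poly_ring R I" by (rule indexed_poly_ring_cring)
  let ?d = "P \<ominus>\<^bsub>indexed_poly_ring R I\<^esub> Q"
  have d: "?d \<in> polys I" using P.minus_closed[of P Q] P Q by simp
  \<comment> \<open>Subtraction in the polynomial ring is not given by coefficients; P = (P - Q) + Q
    reduces it to additivity of the convolution.\<close>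
  have "indexed_padd ?d Q = P"
    using P.a_assoc[of P "\<ominus>\<^bsub>indexed_poly_ring R I\<^esub> Q" Q] P.l_neg[of Q] P.r_zero[of P] P.a_inv_closed[of Q] P Q
    unfolding P.minus_eq by simp
  then have eq: "convolution P E = indexed_padd (convolution ?d E) (convolution Q E)"
    using convolution_add[OF polys_coeff[OF d] polys_coeff[OF Q] E] by simp
  have "convolution ?d E D \<in> carrier R" "convolution Q E D \<in> carrier R"
    by (rule carrier_coeffE[OF convolution_carrier[OF polys_coeff[OF d] E]],
        rule carrier_coeffE[OF convolution_carrier[OF polys_coeff[OF Q] E]])
  then show ?thesis
    unfolding eq indexed_padd_def by (simp add: minus_eq a_assoc r_neg)
qed

lemma convolution_var:
  "carrier_coeff E \<Longrightarrow> convolution (indexed_var s) E = indexed_pmult E s"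
  unfolding indexed_var_def
  by (subst convolution_pmult[OF polys_coeff[OF indexed_pset.indexed_const]])
    (simp_all add: convolution_const fun_eq_iff indexed_pmult_def carrier_coeff_def)

text \<open>The polynomials whose evaluation vanishes modulo \<open>p\<close> form an ideal, by
  associativity of the convolution, so it is enough to check the generators.\<close>

lemma pointwise_ideal_vanishes:
  assumes S: "S \<subseteq> carrier R" and p: "primeideal p R" and Q: "Q \<in> pointwise_ideal R S"
  shows "vanishes_mod S p (convolution Q mset_prod)"
proof -
  let ?P = "indexed_poly_ring R S"
  interpret P: cring ?P by (rule indexed_poly_ring_cring)
  interpret p: primeideal p R by (rule p)
  note E = mset_prod_coeff
  define N where "N = {Q \<in> polys S. vanishes_mod S p (convolution Q mset_prod)}"
  have mult: "convolution Z Q \<in> N" if "Q \<in> N" "Z \<in> polys S" for Q Z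
    using that vanishes_mod_convolution[OF p.is_ideal that(2)]
    by (simp add: N_def polys_convolution convolution_assoc[of Z S] polys_coeff[of _ S] E)
  have add: "indexed_padd Q Q' \<in> N" if Q: "Q \<in> N" and Q': "Q' \<in> N" for Q Q'
  proof -
    have q: "Q \<in> polys S" "Q' \<in> polys S" using Q Q' by (simp_all add: N_def)
    have "vanishes_mod S p (indexed_padd (convolution Q mset_prod) (convolution Q' mset_prod))"
      using Q Q' by (intro vanishes_mod_add p.is_ideal) (simp_all add: N_def)
    then show ?thesis
      using indexed_pset.indexed_padd[OF q] convolution_add[OF polys_coeff[OF q(1)] polys_coeff[OF q(2)] E]
      by (simp add: N_def)
  qed
  have zero: "indexed_const \<zero> \<in> N"
    using additive_subgroup.zero_closed[OF p.is_additive_subgroup]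
    by (auto simp: N_def vanishes_mod_def convolution_const E mset_prod_closed carrier_coeff_def
        indexed_pset.indexed_const intro!: exI[of _ "{#}"])
  have N: "ideal N ?P"
  proof (rule idealI[OF P.ring_axioms])
    show "subgroup N (add_monoid ?P)"
    proof (rule P.add.subgroupI)
      show "N \<subseteq> carrier ?P" by (auto simp: N_def)
      show "N \<noteq> {}" using zero by blast
      fix Q assume Q: "Q \<in> N"
      have "\<ominus>\<^bsub>?P\<^esub> Q = convolution (\<ominus>\<^bsub>?P\<^esub> \<one>\<^bsub>?P\<^esub>) Q"
        using P.l_minus[of "\<one>\<^bsub>?P\<^esub>" Q] P.l_one[of Q] Q P.one_closed
        unfolding indexed_poly_ring_simps by (simp add: N_def)
      moreover have "\<ominus>\<^bsub>?P\<^esub> \<one>\<^bsub>?P\<^esub> \<in> polys S"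
        using P.a_inv_closed[OF P.one_closed] by simp
      ultimately show "\<ominus>\<^bsub>?P\<^esub> Q \<in> N" using mult[OF Q] by simp
      fix Q' assume "Q' \<in> N"
      then show "Q \<oplus>\<^bsub>?P\<^esub> Q' \<in> N" using add[OF Q] by simp
    qed
    fix Q Z assume Q: "Q \<in> N" and Z: "Z \<in> carrier ?P"
    show "Z \<otimes>\<^bsub>?P\<^esub> Q \<in> N" using mult[OF Q] Z by simp
    then show "Q \<otimes>\<^bsub>?P\<^esub> Z \<in> N" using P.m_comm[OF Z, of Q] Q by (simp add: N_def)
  qed
  have gen: "G \<in> N" if G: "G \<in> pointwise_generators S" for G
  proof -
    obtain s where s: "s \<in> S" and G_cases:
      "G = indexed_const s \<otimes>\<^bsub>?P\<^esub> indexed_var s [^]\<^bsub>?P\<^esub> (2::nat) \<ominus>\<^bsub>?P\<^esub> indexed_var s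
      \<or> G = indexed_const s [^]\<^bsub>?P\<^esub> (2::nat) \<otimes>\<^bsub>?P\<^esub> indexed_var s \<ominus>\<^bsub>?P\<^esub> indexed_const s"
      using G unfolding Let_def by blast
    have sR: "s \<in> carrier R" using s S by auto
    have x: "indexed_var s \<in> polys S" by (rule indexed_var_poly[OF s])
    have c: "indexed_const s \<in> polys S" by (rule indexed_pset.indexed_const[OF sR])
    have pow: "Q [^]\<^bsub>?P\<^esub> (2::nat) = convolution Q Q" if "Q \<in> polys S" for Q
      using P.l_one[of Q] that by (simp add: numeral_2_eq_2)
    have Gp: "G \<in> polys S"
      using G_cases P.minus_closed P.m_closed P.nat_pow_closed x c by (metis indexed_poly_ring_simps(1))
    have vE: "convolution (indexed_var s) E' = indexed_pmult E' s" if "carrier_coeff E'" for E' :: "'a multiset \<Rightarrow> 'a"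
      by (rule convolution_var[OF that])
    have cE: "convolution (indexed_const s) E' = (\<lambda>m. s \<otimes> E' m)" if "carrier_coeff E'" for E' :: "'a multiset \<Rightarrow> 'a"
      by (rule convolution_const[OF sR that])
    have G1: "convolution (indexed_const s \<otimes>\<^bsub>?P\<^esub> indexed_var s [^]\<^bsub>?P\<^esub> (2::nat) \<ominus>\<^bsub>?P\<^esub> indexed_var s) mset_prod D
        = s \<otimes> indexed_pmult (indexed_pmult mset_prod s) s D \<ominus> indexed_pmult mset_prod s D" for D
    proof -
      have "convolution (convolution (indexed_const s) (convolution (indexed_var s) (indexed_var s))) mset_prod
          = (\<lambda>m. s \<otimes> indexed_pmult (indexed_pmult mset_prod s) s m)"
        unfolding convolution_assoc[OF c polys_coeff[OF polys_convolution[OF x x]] E]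
          convolution_assoc[OF x polys_coeff[OF x] E] vE[OF E] vE[OF indexed_pmult_in_carrier[OF E]]
          cE[OF indexed_pmult_in_carrier[OF indexed_pmult_in_carrier[OF E]]] ..
      then show ?thesis
        using convolution_minus[OF polys_convolution[OF c polys_convolution[OF x x]] x E, of D]
        by (simp add: pow[OF x] vE[OF E])
    qed
    have G2: "convolution (indexed_const s [^]\<^bsub>?P\<^esub> (2::nat) \<otimes>\<^bsub>?P\<^esub> indexed_var s \<ominus>\<^bsub>?P\<^esub> indexed_const s) mset_prod D
        = s \<otimes> (s \<otimes> indexed_pmult mset_prod s D) \<ominus> s \<otimes> mset_prod D" for D
    proof -
      have "carrier_coeff (\<lambda>m. s \<otimes> indexed_pmult mset_prod s m)"
        using sR mset_prod_closed by (simp add: carrier_coeff_def indexed_pmult_def)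
      from cE[OF this] have "convolution (convolution (convolution (indexed_const s) (indexed_const s)) (indexed_var s)) mset_prod
          = (\<lambda>m. s \<otimes> (s \<otimes> indexed_pmult mset_prod s m))"
        unfolding convolution_assoc[OF polys_convolution[OF c c] polys_coeff[OF x] E] vE[OF E]
          convolution_assoc[OF c polys_coeff[OF c] indexed_pmult_in_carrier[OF E]]
          cE[OF indexed_pmult_in_carrier[OF E]] .
      then show ?thesis
        using convolution_minus[OF polys_convolution[OF polys_convolution[OF c c] x] c E, of D]
        by (simp add: pow[OF c] cE[OF E])
    qed
    have "\<exists>D0. set_mset D0 \<subseteq> S - p \<and>
        (\<forall>D. set_mset D \<subseteq> S - p \<and> D0 \<subseteq># D \<longrightarrow> convolution G mset_prod D \<in> p)"
    proof (cases "s \<in> p")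
      \<comment> \<open>Here x_s = 0: no admissible \<open>D\<close> contains \<open>s\<close>, so
        the terms with x_s contribute zero, and what is left of the second generator is a multiple
        of \<open>s\<close>.\<close>
      case True
      have "convolution G mset_prod D \<in> p" if "set_mset D \<subseteq> S - p" for D
      proof -
        have sD: "s \<notin># D" using True that by auto
        have "s \<otimes> mset_prod D \<in> p" using True by (rule p.I_r_closed[OF _ mset_prod_closed])
        then have "\<ominus> (s \<otimes> mset_prod D) \<in> p" by (rule p.a_inv_closed)
        then show ?thesis
          using G_cases
        proof (elim disjE)
          assume "G = indexed_const s \<otimes>\<^bsub>?P\<^esub> indexed_var s [^]\<^bsub>?P\<^esub> (2::nat) \<ominus>\<^bsub>?P\<^esub> indexed_var s"
          then show ?thesis using sR sD G1 by (simp add: indexed_pmult_def minus_eq)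
        next
          assume "\<ominus> (s \<otimes> mset_prod D) \<in> p"
            and "G = indexed_const s [^]\<^bsub>?P\<^esub> (2::nat) \<otimes>\<^bsub>?P\<^esub> indexed_var s \<ominus>\<^bsub>?P\<^esub> indexed_const s"
          then show ?thesis using sR sD G2 mset_prod_closed[of D] by (simp add: indexed_pmult_def minus_eq)
        qed
      qed
      then show ?thesis by (intro exI[of _ "{#}"]) simp
    next
      \<comment> \<open>Here x_s = 1/s, and both generators evaluate to zero exactly. Two copies of
        \<open>s\<close> are demanded in \<open>D\<close> because x_s occurs squared.\<close>
      case False
      have "convolution G mset_prod D \<in> p" if D: "{#s, s#} \<subseteq># D" for D
      proof -
        obtain D' where D': "D = {#s, s#} + D'"
          using D by (metis subset_mset.add_diff_inverse)
        note m = mset_prod_closed[of D'] mset_prod_add_mset[OF sR]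
        show ?thesis
          using G_cases
        proof
          assume "G = indexed_const s \<otimes>\<^bsub>?P\<^esub> indexed_var s [^]\<^bsub>?P\<^esub> (2::nat) \<ominus>\<^bsub>?P\<^esub> indexed_var s"
          then show ?thesis using sR G1 m by (simp add: indexed_pmult_def minus_eq D' r_neg)
        next
          assume "G = indexed_const s [^]\<^bsub>?P\<^esub> (2::nat) \<otimes>\<^bsub>?P\<^esub> indexed_var s \<ominus>\<^bsub>?P\<^esub> indexed_const s"
          then show ?thesis using sR G2 m by (simp add: indexed_pmult_def minus_eq D' r_neg)
        qed
      qed
      then show ?thesis using False s by (intro exI[of _ "{#s, s#}"]) simp
    qed
    then show ?thesis
      using Gp unfolding N_def vanishes_mod_def by (simp add: convolution_carrier polys_coeff[of _ S] E)
  qed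
  have "pointwise_ideal R S \<subseteq> N"
    unfolding pointwise_ideal_eq using gen by (intro P.genideal_minimal N) blast
  then show ?thesis using Q by (auto simp: N_def)
qed

text \<open>A constant \<open>r\<close> evaluates to \<open>r\<close> times the common denominator,
  which is outside the prime; so \<open>r\<close> lies in every prime.\<close>

lemma pointwise_ideal_const_nilpotent:
  assumes S: "S \<subseteq> carrier R" and r: "r \<in> carrier R" and "indexed_const r \<in> pointwise_ideal R S"
  shows "\<exists>n::nat. r [^] n = \<zero>"
proof (rule nilpotent_if_in_all_primes[OF r])
  fix p assume p: "primeideal p R"
  interpret p: primeideal p R by (rule p)
  obtain D where D: "set_mset D \<subseteq> S - p" "convolution (indexed_const r) mset_prod D \<in> p"
    using pointwise_ideal_vanishes[OF S p assms(3)] unfolding vanishes_mod_def by blast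
  then have "r \<otimes> mset_prod D \<in> p"
    by (simp add: convolution_const[OF r mset_prod_coeff])
  moreover have "mset_prod D \<notin> p"
    using D(1) S by (intro mset_prod_notin_prime[OF p]) auto
  ultimately show "r \<in> p"
    using p.I_prime[OF r mset_prod_closed] by blast
qed

lemma pointwise_localization_simps:
  "carrier (pointwise_localization R S) = carrier (indexed_poly_ring R S Quot pointwise_ideal R S)"
  "\<zero>\<^bsub>pointwise_localization R S\<^esub> = \<zero>\<^bsub>indexed_poly_ring R S Quot pointwise_ideal R S\<^esub>"
  "\<one>\<^bsub>pointwise_localization R S\<^esub> = \<one>\<^bsub>indexed_poly_ring R S Quot pointwise_ideal R S\<^esub>"
  "add (pointwise_localization R S) = add (indexed_poly_ring R S Quot pointwise_ideal R S)"
  "monoid.mult (pointwise_localization R S) = monoid.mult (indexed_poly_ring R S Quot pointwise_ideal R S)"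
  "r \<odot>\<^bsub>pointwise_localization R S\<^esub> C =
    (pointwise_ideal R S +>\<^bsub>indexed_poly_ring R S\<^esub> indexed_const r)
      \<otimes>\<^bsub>indexed_poly_ring R S Quot pointwise_ideal R S\<^esub> C"
  by (simp_all add: pointwise_localization_def Let_def)

lemma pointwise_localization_cring:
  assumes S: "S \<subseteq> carrier R"
  shows "cring (pointwise_localization R S)"
  by (rule cring_cong[OF ideal.quotient_is_cring[OF pointwise_ideal_ideal[OF S] indexed_poly_ring_cring]])
    (simp_all add: pointwise_localization_simps)

lemma pointwise_localization_algebra:
  assumes S: "S \<subseteq> carrier R"
  shows "algebra R (pointwise_localization R S)"
proof -
  let ?P = "indexed_poly_ring R S" and ?I = "pointwise_ideal R S"
  let ?Q = "?P Quot ?I" and ?A = "pointwise_localization R S"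
  interpret I: ideal ?I ?P by (rule pointwise_ideal_ideal[OF S])
  interpret Q: cring ?Q by (rule I.quotient_is_cring[OF indexed_poly_ring_cring])
  define j where "j r = ?I +>\<^bsub>?P\<^esub> indexed_const r" for r
  have "(\<lambda>r. ?I +>\<^bsub>?P\<^esub> indexed_const r) \<in> ring_hom R ?Q"
    using ring_hom_trans[OF indexed_const_hom I.rcos_ring_hom] by (simp add: comp_def)
  then have j: "j \<in> ring_hom R ?Q" unfolding j_def .
  note jh = ring_hom_closed[OF j] ring_hom_add[OF j] ring_hom_mult[OF j] ring_hom_one[OF j]
  have sm: "r \<odot>\<^bsub>?A\<^esub> C = j r \<otimes>\<^bsub>?Q\<^esub> C" for r C
    by (simp add: pointwise_localization_simps j_def)
  have simps: "carrier ?A = carrier ?Q" "x \<oplus>\<^bsub>?A\<^esub> y = x \<oplus>\<^bsub>?Q\<^esub> y" "x \<otimes>\<^bsub>?A\<^esub> y = x \<otimes>\<^bsub>?Q\<^esub> y" for x y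
    by (simp_all add: pointwise_localization_simps)
  show ?thesis
    by (rule algebraI[OF is_cring pointwise_localization_cring[OF S]]; unfold sm simps)
      (simp_all add: jh Q.l_distr Q.r_distr Q.m_assoc)
qed

lemma pointwise_localization_kernel_nilpotent:
  assumes S: "S \<subseteq> carrier R" and r: "r \<in> carrier R"
    and zero: "r \<odot>\<^bsub>pointwise_localization R S\<^esub> \<one>\<^bsub>pointwise_localization R S\<^esub> = \<zero>\<^bsub>pointwise_localization R S\<^esub>"
  shows "\<exists>n::nat. r [^] n = \<zero>"
proof (rule pointwise_ideal_const_nilpotent[OF S r])
  let ?P = "indexed_poly_ring R S" and ?I = "pointwise_ideal R S"
  let ?Q = "?P Quot ?I"
  interpret I: ideal ?I ?P by (rule pointwise_ideal_ideal[OF S])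
  interpret Q: cring ?Q by (rule I.quotient_is_cring[OF indexed_poly_ring_cring])
  have c: "indexed_const r \<in> carrier ?P" using r by (simp add: indexed_pset.indexed_const)
  have "?I +>\<^bsub>?P\<^esub> indexed_const r = \<zero>\<^bsub>?Q\<^esub>"
    using zero ring_hom_closed[OF I.rcos_ring_hom c] by (simp add: pointwise_localization_simps)
  then have "?I +>\<^bsub>?P\<^esub> indexed_const r = ?I" by (simp add: FactRing_def)
  then show "indexed_const r \<in> ?I" using I.a_rcos_self[OF c] by simp
qed

end


section \<open>Nilpotent endomorphisms\<close>

lemma module_hom_funpow: "f \<in> module_hom R M M \<Longrightarrow> (f ^^ n) \<in> module_hom R M M"
proof (induction n)
  case 0
  then show ?case by (simp add: module_hom_def)
next
  case (Suc n)
  show ?case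
    using module_hom_comp[OF Suc.IH[OF Suc.prems] Suc.prems] by (simp add: comp_def)
qed

context generated_module
begin

text \<open>The hypothesis is on the products in the matrix formula, so that it covers both vectors
  with coefficients in \<open>H\<close> and matrices with entries in \<open>H\<close>.\<close>

lemma endo_coeff_mem_ideal:
  assumes H: "ideal H R" and f: "f \<in> module_hom R FG FG" and v: "v \<in> carrier FG"
    and t: "\<And>g. g \<in> G \<Longrightarrow> v g \<otimes> f (free_basis R g) i \<in> H"
  shows "f v i \<in> H"
proof -
  interpret H: ideal H R by (rule H)
  have "(\<lambda>g. v g \<odot>\<^bsub>FG\<^esub> f (free_basis R g)) \<in> G \<rightarrow> carrier FG"
    by (intro Pi_I FG.smult_closed FG_coeff[OF v] module_hom_closed[OF f] R.free_basis_carrier)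
  from R.free_module_finsum[OF this, of i]
  have eq: "f v i = (\<Oplus>g\<in>G. v g \<otimes> f (free_basis R g) i)"
    using FG.free_hom_expand[OF f v finite_G] by simp
  have "(\<Oplus>g\<in>B. v g \<otimes> f (free_basis R g) i) \<in> H" if "finite B" "B \<subseteq> G" for B
    using that
  proof (induction B)
    case empty
    then show ?case using additive_subgroup.zero_closed[OF H.is_additive_subgroup] by simp
  next
    case (insert g B)
    then have "(\<lambda>g. v g \<otimes> f (free_basis R g) i) \<in> B \<rightarrow> carrier R"
      using t H.a_subset by blast
    then show ?case
      using insert t[of g] H.a_subset by (simp add: subset_iff H.a_closed)
  qed
  then show ?thesis using eq finite_G by simp
qed

lemma endo_ideal_coeff:
  assumes H: "ideal H R" and f: "f \<in> module_hom R FG FG" and v: "v \<in> carrier FG" "\<And>i. v i \<in> H"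
  shows "f v i \<in> H"
  by (rule endo_coeff_mem_ideal[OF H f v(1)])
    (rule ideal.I_r_closed[OF H v(2) FG_coeff[OF module_hom_closed[OF f R.free_basis_carrier]]])

text \<open>By induction on t, the values of f^t have coefficients in H + (a^t): a further
  application of \<open>f\<close> preserves the part in H and turns a^t y into a^t f(y) with f(y) in
  H + (a). At t = n the second part is gone.\<close>

lemma funpow_ideal_step:
  assumes H: "ideal H R" and a: "a \<in> carrier R" "a [^] n = \<zero>" and f: "f \<in> module_hom R FG FG"
    and fH: "\<And>v i. v \<in> carrier FG \<Longrightarrow> f v i \<in> H <+>\<^bsub>R\<^esub> PIdl a" and v: "v \<in> carrier FG"
  shows "(f ^^ n) v i \<in> H"
proof -
  interpret H: ideal H R by (rule H)
  have mem: "x \<in> H <+>\<^bsub>R\<^esub> PIdl b \<longleftrightarrow> (\<exists>h\<in>H. \<exists>y\<in>carrier R. x = h \<oplus> y \<otimes> b)" for x b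
    by (auto simp: set_add_def' cgenideal_def)
  have "\<forall>i. \<exists>h\<in>H. \<exists>y\<in>carrier R. (f ^^ t) v i = h \<oplus> y \<otimes> a [^] t" for t
  proof (induction t)
    case 0
    have "v i = \<zero> \<oplus> v i \<otimes> a [^] (0::nat)" for i
      using FG_coeff[OF v] by simp
    then show ?case
      using FG_coeff[OF v] additive_subgroup.zero_closed[OF H.is_additive_subgroup]
      by (simp only: funpow_0) blast
  next
    case (Suc t)
    let ?w = "(f ^^ t) v"
    have wF: "?w \<in> carrier FG" by (rule module_hom_closed[OF module_hom_funpow[OF f] v])
    obtain h y where hy: "\<And>i. h i \<in> H" "\<And>i. y i \<in> carrier R" "\<And>i. ?w i = h i \<oplus> y i \<otimes> a [^] t"
      using Suc by metis
    have hc: "h i \<in> carrier R" for i using hy(1) H.a_subset by blast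
    \<comment> \<open>The chosen \<open>h\<close> and \<open>y\<close> are arbitrary outside
      \<open>G\<close>; cut off there, they become elements of the free module.\<close>
    define h' where "h' i = (if i \<in> G then h i else \<zero>)" for i
    define y' where "y' i = (if i \<in> G then y i else \<zero>)" for i
    have h': "h' \<in> carrier FG" "\<And>i. h' i \<in> H"
      using hc hy(1) additive_subgroup.zero_closed[OF H.is_additive_subgroup]
      by (auto intro!: R.free_module_finite_carrierI[OF finite_G] simp: h'_def)
    have y': "y' \<in> carrier FG"
      using hy(2) by (auto intro!: R.free_module_finite_carrierI[OF finite_G] simp: y'_def)
    have aF: "a [^] t \<in> carrier R" using a(1) by simp
    have w: "?w = h' \<oplus>\<^bsub>FG\<^esub> a [^] t \<odot>\<^bsub>FG\<^esub> y'"
    proof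
      fix i
      show "?w i = (h' \<oplus>\<^bsub>FG\<^esub> a [^] t \<odot>\<^bsub>FG\<^esub> y') i"
        using hy(2,3)[of i] free_module_outside[OF wF, of i] aF
        by (simp add: h'_def y'_def R.m_comm)
    qed
    have fw: "f ?w i = f h' i \<oplus> a [^] t \<otimes> f y' i" for i
      unfolding w module_hom_add[OF f h'(1) FG.smult_closed[OF aF y']] module_hom_smult[OF f aF y'] by simp
    show ?case
    proof
      fix i
      obtain k z where kz: "k \<in> H" "z \<in> carrier R" "f y' i = k \<oplus> z \<otimes> a"
        using fH[OF y', of i] unfolding mem by blast
      have c: "k \<in> carrier R" "f h' i \<in> carrier R"
        using kz(1) H.a_subset FG_coeff[OF module_hom_closed[OF f h'(1)]] by auto
      have "(f ^^ Suc t) v i = (f h' i \<oplus> a [^] t \<otimes> k) \<oplus> z \<otimes> a [^] Suc t"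
        using fw[of i] kz c a(1) by (simp add: R.r_distr R.m_ac R.a_ac)
      moreover have "f h' i \<oplus> a [^] t \<otimes> k \<in> H"
        using endo_ideal_coeff[OF H f h'] H.I_l_closed[OF kz(1) aF] by (simp add: H.a_closed)
      ultimately show "\<exists>h\<in>H. \<exists>y\<in>carrier R. (f ^^ Suc t) v i = h \<oplus> y \<otimes> a [^] Suc t"
        using kz(2) by blast
    qed
  qed
  from this[of n] obtain h y where "h \<in> H" "y \<in> carrier R" "(f ^^ n) v i = h \<oplus> y \<otimes> a [^] n"
    by blast
  then show ?thesis using a H.a_subset by (auto simp: subset_iff)
qed

text \<open>The nilpotent generators are removed one at a time. With \<open>a\<close> absorbed into
  the ideal, the induction hypothesis brings a power of \<open>f\<close> into H + (a), and
  \<open>funpow_ideal_step\<close> removes \<open>a\<close> by a further power.\<close>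

lemma funpow_ideal:
  assumes "finite B" "B \<subseteq> carrier R" "\<forall>b\<in>B. \<exists>n::nat. b [^] n = \<zero>" and f: "f \<in> module_hom R FG FG"
    and H: "ideal H R" and "\<forall>v\<in>carrier FG. \<forall>i. f v i \<in> Idl (B \<union> H)"
  shows "\<exists>r. \<forall>v\<in>carrier FG. \<forall>i. (f ^^ r) v i \<in> H"
  using assms(1-3) H assms(6)
proof (induction B arbitrary: H)
  case empty
  have "Idl ({} \<union> H) \<subseteq> H"
    using R.genideal_minimal[OF empty(3)] by simp
  then have "\<forall>v\<in>carrier FG. \<forall>i. (f ^^ 1) v i \<in> H" using empty by (simp add: subset_iff)
  then show ?case by blast
next
  case (insert a B)
  interpret H: ideal H R by (rule insert.prems)
  let ?H = "H <+>\<^bsub>R\<^esub> PIdl a"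
  have a: "a \<in> carrier R" using insert.prems by simp
  obtain n :: nat where n: "a [^] n = \<zero>" using insert.prems by blast
  have H': "ideal ?H R"
    by (rule R.add_ideals[OF insert.prems(3) R.cgenideal_ideal[OF a]])
  have sub: "?H \<subseteq> carrier R" using additive_subgroup.a_subset[OF ideal.axioms(1)[OF H']] .
  have mem: "h \<oplus> y \<otimes> a \<in> ?H" if "h \<in> H" "y \<in> carrier R" for h y
    using that by (auto simp: set_add_def' cgenideal_def)
  have "insert a B \<union> H \<subseteq> B \<union> ?H"
  proof -
    have "a \<in> ?H"
      using mem[of \<zero> \<one>] additive_subgroup.zero_closed[OF H.is_additive_subgroup] a by simp
    moreover have "H \<subseteq> ?H"
    proof
      fix h assume h: "h \<in> H"
      then have "h \<in> carrier R" using H.a_subset by blast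
      then show "h \<in> ?H" using mem[OF h, of \<zero>] a by simp
    qed
    ultimately show ?thesis by blast
  qed
  moreover have "B \<union> ?H \<subseteq> carrier R" using insert.prems(1) sub by blast
  ultimately have "Idl (insert a B \<union> H) \<subseteq> Idl (B \<union> ?H)"
    by (rule R.subset_Idl_subset[rotated])
  then have "\<forall>v\<in>carrier FG. \<forall>i. f v i \<in> Idl (B \<union> ?H)"
    using insert.prems(4) by blast
  then obtain r where r: "\<forall>v\<in>carrier FG. \<forall>i. (f ^^ r) v i \<in> ?H"
    using insert.IH[OF _ _ H'] insert.prems by auto
  have "((f ^^ r) ^^ n) v i \<in> H" if "v \<in> carrier FG" for v i
    by (rule funpow_ideal_step[OF insert.prems(3) a n module_hom_funpow[OF f] _ that]) (use r in blast)
  then have "\<forall>v\<in>carrier FG. \<forall>i. (f ^^ (r * n)) v i \<in> H"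
    by (simp add: funpow_mult)
  then show ?case by blast
qed

text \<open>The ideal that contains all coefficients of values of \<open>f\<close> is generated by
  finitely many nilpotent matrix entries. This is where a nil ideal does the work of a nilpotent
  one.\<close>

lemma nilpotent_endo:
  assumes f: "f \<in> module_hom R FG FG"
    and nil: "\<And>v i. v \<in> carrier FG \<Longrightarrow> \<exists>n::nat. f v i [^] n = \<zero>"
  shows "\<exists>r. \<forall>v\<in>carrier FG. (f ^^ r) v = \<zero>\<^bsub>FG\<^esub>"
proof -
  let ?B = "(\<lambda>(g, i). f (free_basis R g) i) ` (G \<times> G)"
  have fc: "f (free_basis R g) \<in> carrier FG" if "g \<in> G" for g
    by (rule module_hom_closed[OF f R.free_basis_carrier[OF that]])
  have B: "finite ?B" "?B \<subseteq> carrier R" "\<forall>b\<in>?B. \<exists>n::nat. b [^] n = \<zero>"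
    using finite_G FG_coeff[OF fc] nil[OF R.free_basis_carrier] by auto
  have BZ: "?B \<union> {\<zero>} \<subseteq> carrier R" using B(2) by blast
  have I: "ideal (Idl (?B \<union> {\<zero>})) R" by (rule R.genideal_ideal[OF BZ])
  interpret I: ideal "Idl (?B \<union> {\<zero>})" R by (rule I)
  have e: "f (free_basis R g) i \<in> Idl (?B \<union> {\<zero>})" if "g \<in> G" for g i
  proof (cases "i \<in> G")
    case True
    then show ?thesis using that R.genideal_self[OF BZ] by blast
  next
    case False
    then show ?thesis
      using free_module_outside[OF fc[OF that]] additive_subgroup.zero_closed[OF I.is_additive_subgroup] by simp
  qed
  have "f v i \<in> Idl (?B \<union> {\<zero>})" if v: "v \<in> carrier FG" for v i
    by (rule endo_coeff_mem_ideal[OF I f v]) (rule I.I_l_closed[OF e FG_coeff[OF v]])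
  then obtain r where r: "\<forall>v\<in>carrier FG. \<forall>i. (f ^^ r) v i \<in> {\<zero>}"
    using funpow_ideal[OF B f R.zeroideal] by blast
  then show ?thesis by (intro exI[of _ r] ballI) (auto simp: fun_eq_iff)
qed


section \<open>Descent of projectivity\<close>

text \<open>If \<phi> has values in \<open>V\<close> and fixes a relation, then 1 - \<phi> kills it.
  Relations are killed one after another: for a new \<open>k\<close> the criterion is applied to
  \<theta> k, and the map obtained is composed after \<theta>, so that what \<theta> has killed
  stays killed.\<close>

lemma flat_relations_trivial:
  assumes flat: "flat_module TYPE(('a, nat) coset_type) R M" and "finite V0" "V0 \<subseteq> V"
  shows "\<exists>\<theta>\<in>module_hom R FG FG. (\<forall>v\<in>carrier FG. v \<ominus>\<^bsub>FG\<^esub> \<theta> v \<in> V) \<and> (\<forall>v\<in>V0. \<theta> v = \<zero>\<^bsub>FG\<^esub>)"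
  using assms(2,3)
proof (induction V0)
  case empty
  show ?case
    using submodule_zero[OF V_submodule]
    by (intro bexI[OF _ module_hom_id]) (simp add: FG.M.minus_eq FG.M.r_neg del: free_module_simps)
next
  case (insert k V0)
  then obtain \<theta> where \<theta>: "\<theta> \<in> module_hom R FG FG" "\<And>v. v \<in> carrier FG \<Longrightarrow> v \<ominus>\<^bsub>FG\<^esub> \<theta> v \<in> V"
    "\<And>v. v \<in> V0 \<Longrightarrow> \<theta> v = \<zero>\<^bsub>FG\<^esub>"
    by auto
  have k: "k \<in> V" "k \<in> carrier FG" using insert.prems by (auto simp: V_iff)
  have t: "\<theta> v \<in> carrier FG" if "v \<in> carrier FG" for v by (rule module_hom_closed[OF \<theta>(1) that])
  \<comment> \<open>As \<theta> moves elements only within their class modulo \<open>V\<close>,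
    \<theta> k is again a relation.\<close>
  have "\<theta> k = k \<ominus>\<^bsub>FG\<^esub> (k \<ominus>\<^bsub>FG\<^esub> \<theta> k)"
    using k t[OF k(2)] by (simp add: FG.M.minus_eq FG.M.minus_add FG.M.a_assoc[symmetric] FG.M.r_neg del: free_module_simps)
  then have tk: "\<theta> k \<in> V"
    using FG.submodule_minus[OF V_submodule k(1) \<theta>(2)[OF k(2)]] by simp
  obtain \<phi> where \<phi>: "\<phi> \<in> module_hom R FG FG" "\<And>w. w \<in> carrier FG \<Longrightarrow> \<phi> w \<in> V" "\<phi> (\<theta> k) = \<theta> k"
    using flat_relation_trivial[OF flat tk] by blast
  note f = module_hom_closed[OF \<phi>(1)]
  define \<theta>' where "\<theta>' w = w \<ominus>\<^bsub>FG\<^esub> \<phi> w" for w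
  have \<theta>': "\<theta>' \<in> module_hom R FG FG"
    unfolding \<theta>'_def
    by (rule module_homI)
      (simp_all add: f FG.M.minus_eq FG.smult_r_distr FG.smult_r_minus FG.M.minus_add FG.M.a_ac
        module_hom_add[OF \<phi>(1)] module_hom_smult[OF \<phi>(1)] del: free_module_simps)
  show ?case
  proof (intro bexI conjI ballI)
    show "(\<lambda>v. \<theta>' (\<theta> v)) \<in> module_hom R FG FG" by (rule module_hom_comp[OF \<theta>(1) \<theta>'])
    fix v assume v: "v \<in> carrier FG"
    have "v \<ominus>\<^bsub>FG\<^esub> \<theta>' (\<theta> v) = (v \<ominus>\<^bsub>FG\<^esub> \<theta> v) \<oplus>\<^bsub>FG\<^esub> \<phi> (\<theta> v)"
      using v t[OF v] f[OF t[OF v]]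
      by (simp add: \<theta>'_def FG.M.minus_eq FG.M.minus_add FG.M.a_assoc del: free_module_simps)
    then show "v \<ominus>\<^bsub>FG\<^esub> \<theta>' (\<theta> v) \<in> V"
      using FG.submoduleE(5)[OF V_submodule \<theta>(2)[OF v] \<phi>(2)[OF t[OF v]]] by simp
  next
    fix v assume "v \<in> insert k V0"
    then show "\<theta>' (\<theta> v) = \<zero>\<^bsub>FG\<^esub>"
    proof
      assume "v = k"
      then show ?thesis using t[OF k(2)] \<phi>(3) by (simp add: \<theta>'_def FG.M.minus_eq FG.M.r_neg del: free_module_simps)
    next
      assume "v \<in> V0"
      then show ?thesis
        using \<theta>(3) module_hom_zero[OF FG.module_axioms FG.module_axioms \<theta>'] by simp
    qed
  qed
qed

text \<open>A map that kills \<open>V\<close> factors through M, and the factor is a section of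
  \<open>\<pi>\<close> because v and \<eta> v have the same image in M.\<close>

lemma projective_if_relations_killed:
  assumes \<eta>: "\<eta> \<in> module_hom R FG FG" and \<eta>V: "\<And>v. v \<in> carrier FG \<Longrightarrow> v \<ominus>\<^bsub>FG\<^esub> \<eta> v \<in> V"
    and kills: "\<And>v. v \<in> V \<Longrightarrow> \<eta> v = \<zero>\<^bsub>FG\<^esub>"
  shows "projective_module TYPE('u) R M"
proof -
  define c where "c x = (SOME v. v \<in> carrier FG \<and> \<pi> v = x)" for x
  have c: "c x \<in> carrier FG" "\<pi> (c x) = x" if "x \<in> carrier M" for x
  proof -
    have "\<exists>v. v \<in> carrier FG \<and> \<pi> v = x"
      using that \<pi>_surj by (metis imageE)
    from someI_ex[OF this] show "c x \<in> carrier FG" "\<pi> (c x) = x"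
      by (auto simp: c_def)
  qed
  have eq: "\<eta> v = \<eta> w" if vw: "v \<in> carrier FG" "w \<in> carrier FG" "\<pi> v = \<pi> w" for v w
    using kills[OF minus_mem_V[OF vw]] module_hom_minus[OF FG.module_axioms FG.module_axioms \<eta> vw(1,2)]
    by (intro FG.M.minus_zeroD[OF _ module_hom_closed[OF \<eta> vw(1)] module_hom_closed[OF \<eta> vw(2)]]) simp
  have \<pi>\<eta>: "\<pi> (\<eta> v) = \<pi> v" if v: "v \<in> carrier FG" for v
  proof (rule sym, rule M.minus_zeroD)
    show "\<pi> v \<ominus>\<^bsub>M\<^esub> \<pi> (\<eta> v) = \<zero>\<^bsub>M\<^esub>"
      using \<eta>V[OF v] module_hom_minus[OF FG.module_axioms module_axioms \<pi>_hom v module_hom_closed[OF \<eta> v]]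
      by (simp add: V_iff)
  qed (intro module_hom_closed[OF \<pi>_hom] module_hom_closed[OF \<eta>] v)+
  show ?thesis
  proof (rule projective_if_section)
    show "(\<lambda>x. \<eta> (c x)) \<in> module_hom R M FG"
    proof (rule module_homI)
      show "\<eta> (c x) \<in> carrier FG" if "x \<in> carrier M" for x
        by (rule module_hom_closed[OF \<eta> c(1)[OF that]])
    next
      fix x y assume x: "x \<in> carrier M" and y: "y \<in> carrier M"
      have "\<pi> (c x \<oplus>\<^bsub>FG\<^esub> c y) = x \<oplus>\<^bsub>M\<^esub> y"
        unfolding module_hom_add[OF \<pi>_hom c(1)[OF x] c(1)[OF y]] c(2)[OF x] c(2)[OF y] ..
      then have "\<eta> (c (x \<oplus>\<^bsub>M\<^esub> y)) = \<eta> (c x \<oplus>\<^bsub>FG\<^esub> c y)"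
        using c[of "x \<oplus>\<^bsub>M\<^esub> y"] x y by (intro eq FG.M.add.m_closed c(1)) simp_all
      then show "\<eta> (c (x \<oplus>\<^bsub>M\<^esub> y)) = \<eta> (c x) \<oplus>\<^bsub>FG\<^esub> \<eta> (c y)"
        unfolding module_hom_add[OF \<eta> c(1)[OF x] c(1)[OF y]] .
    next
      fix r x assume r: "r \<in> carrier R" and x: "x \<in> carrier M"
      have "\<pi> (r \<odot>\<^bsub>FG\<^esub> c x) = r \<odot>\<^bsub>M\<^esub> x"
        unfolding module_hom_smult[OF \<pi>_hom r c(1)[OF x]] c(2)[OF x] ..
      then have "\<eta> (c (r \<odot>\<^bsub>M\<^esub> x)) = \<eta> (r \<odot>\<^bsub>FG\<^esub> c x)"
        using c[of "r \<odot>\<^bsub>M\<^esub> x"] r x by (intro eq FG.smult_closed c(1)) simp_all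
      then show "\<eta> (c (r \<odot>\<^bsub>M\<^esub> x)) = r \<odot>\<^bsub>FG\<^esub> \<eta> (c x)"
        unfolding module_hom_smult[OF \<eta> r c(1)[OF x]] .
    qed
    show "\<pi> (\<eta> (c x)) = x" if "x \<in> carrier M" for x
      using \<pi>\<eta>[OF c(1)[OF that]] c(2)[OF that] by simp
  qed
qed

text \<open>The assumption \<open>nil\<close> is all that base change contributes to the descent;
  the rest is an argument over R with endomorphisms supplied by flatness.\<close>

lemma projective_descent:
  assumes flat: "flat_module TYPE(('a, nat) coset_type) R M"
    and V0: "finite V0" "V0 \<subseteq> V"
    and nil: "\<And>\<theta> v i. \<lbrakk>\<theta> \<in> module_hom R FG FG; \<forall>v\<in>V0. \<theta> v = \<zero>\<^bsub>FG\<^esub>; v \<in> V\<rbrakk>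
      \<Longrightarrow> \<exists>n::nat. \<theta> v i [^] n = \<zero>"
  shows "projective_module TYPE('u) R M"
proof -
  obtain \<theta> where \<theta>: "\<theta> \<in> module_hom R FG FG" "\<And>v. v \<in> carrier FG \<Longrightarrow> v \<ominus>\<^bsub>FG\<^esub> \<theta> v \<in> V"
    "\<forall>v\<in>V0. \<theta> v = \<zero>\<^bsub>FG\<^esub>"
    using flat_relations_trivial[OF flat V0] by blast
  note t = module_hom_closed[OF \<theta>(1)]
  have diff_hom: "(\<lambda>w. w \<ominus>\<^bsub>FG\<^esub> f w) \<in> module_hom R FG FG" if f: "f \<in> module_hom R FG FG" for f
    by (rule module_homI)
      (simp_all add: module_hom_closed[OF f] FG.M.minus_eq FG.smult_r_distr FG.smult_r_minus FG.M.minus_add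
        FG.M.a_ac module_hom_add[OF f] module_hom_smult[OF f] del: free_module_simps)
  let ?\<phi> = "\<lambda>w. w \<ominus>\<^bsub>FG\<^esub> \<theta> w"
  note \<phi> = diff_hom[OF \<theta>(1)]
  \<comment> \<open>These finitely many relations generate the image of 1 - \<theta>, so flatness
    can kill the whole image at once.\<close>
  let ?B = "(\<lambda>g. ?\<phi> (free_basis R g)) ` G"
  have B: "finite ?B" "?B \<subseteq> V"
    using finite_G by (simp, intro image_subsetI \<theta>(2) R.free_basis_carrier)
  have kills: "\<eta> (?\<phi> w) = \<zero>\<^bsub>FG\<^esub>"
    if \<eta>: "\<eta> \<in> module_hom R FG FG" and z: "\<forall>v\<in>?B. \<eta> v = \<zero>\<^bsub>FG\<^esub>" and w: "w \<in> carrier FG" for \<eta> w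
  proof -
    have "\<eta> (?\<phi> w) \<in> {\<zero>\<^bsub>FG\<^esub>}"
      by (rule FG.free_hom_vimage[OF module_hom_comp[OF \<phi> \<eta>] FG.zero_submodule _ w]) (use z in blast)
    then show ?thesis by simp
  qed
  have D: "submodule (?\<phi> ` carrier FG) R FG"
    by (rule submodule_image[OF FG.module_axioms FG.module_axioms \<phi>])
  have V_sub: "V \<subseteq> ?\<phi> ` carrier FG"
  proof
    fix k assume k: "k \<in> V"
    then have kF: "k \<in> carrier FG" by (simp add: V_iff)
    have "finite (insert k ?B)" "insert k ?B \<subseteq> V" using B k by simp_all
    from flat_relations_trivial[OF flat this] obtain \<eta> where \<eta>: "\<eta> \<in> module_hom R FG FG"
      "\<And>v. v \<in> carrier FG \<Longrightarrow> v \<ominus>\<^bsub>FG\<^esub> \<eta> v \<in> V" "\<eta> k = \<zero>\<^bsub>FG\<^esub>" "\<forall>v\<in>?B. \<eta> v = \<zero>\<^bsub>FG\<^esub>"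
      by auto
    have \<eta>\<theta>: "\<eta> (\<theta> w) = \<zero>\<^bsub>FG\<^esub>" if w: "w \<in> carrier FG" "\<eta> w = \<zero>\<^bsub>FG\<^esub>" for w
    proof -
      \<comment> \<open>The difference w - \<theta> w is killed by \<eta>, so \<theta> preserves the
        kernel of \<eta>.\<close>
      have "\<eta> w = \<eta> (\<theta> w)"
        using kills[OF \<eta>(1,4) w(1)] module_hom_minus[OF FG.module_axioms FG.module_axioms \<eta>(1) w(1) t[OF w(1)]]
        by (intro FG.M.minus_zeroD[OF _ module_hom_closed[OF \<eta>(1) w(1)] module_hom_closed[OF \<eta>(1) t[OF w(1)]]]) simp
      then show ?thesis using w(2) by simp
    qed
    \<comment> \<open>The values of 1 - \<eta> lie in \<open>V\<close>, where \<theta> has nilpotent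
      coefficients; so all coefficients of this composite are nilpotent, which is not known of
      \<theta> itself.\<close>
    define N where "N v = \<theta> (v \<ominus>\<^bsub>FG\<^esub> \<eta> v)" for v
    have N: "N \<in> module_hom R FG FG"
      unfolding N_def by (rule module_hom_comp[OF diff_hom[OF \<eta>(1)] \<theta>(1)])
    obtain r where r: "\<forall>v\<in>carrier FG. (N ^^ r) v = \<zero>\<^bsub>FG\<^esub>"
      using nilpotent_endo[OF N] nil[OF \<theta>(1,3) \<eta>(2)] unfolding N_def by blast
    have pow: "(\<theta> ^^ n) k \<in> carrier FG" for n
      by (rule module_hom_closed[OF module_hom_funpow[OF \<theta>(1)] kF])
    \<comment> \<open>The iterates of \<open>k\<close> under \<theta> stay in the kernel of \<eta>,
      where \<open>N\<close> and \<theta> agree.\<close>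
    have "(N ^^ n) k = (\<theta> ^^ n) k \<and> \<eta> ((\<theta> ^^ n) k) = \<zero>\<^bsub>FG\<^esub>" for n
    proof (induction n)
      case 0
      then show ?case using \<eta>(3) by simp
    next
      case (Suc n)
      have "N ((\<theta> ^^ n) k) = \<theta> ((\<theta> ^^ n) k)"
        using Suc pow[of n] by (simp add: N_def FG.M.minus_eq FG.M.uminus_zero del: free_module_simps)
      then show ?case using Suc \<eta>\<theta>[OF pow[of n]] by simp
    qed
    then have zero: "(\<theta> ^^ r) k = \<zero>\<^bsub>FG\<^esub>" using r kF by metis
    \<comment> \<open>Telescoping: k - \<theta>^n k is the sum of the values of 1 - \<theta> at the
      earlier iterates.\<close>
    have "k \<ominus>\<^bsub>FG\<^esub> (\<theta> ^^ n) k \<in> ?\<phi> ` carrier FG" for n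
    proof (induction n)
      case 0
      then show ?case
        using kF submodule_zero[OF D] by (simp add: FG.M.minus_eq FG.M.r_neg del: free_module_simps)
    next
      case (Suc n)
      have "k \<ominus>\<^bsub>FG\<^esub> (\<theta> ^^ Suc n) k = (k \<ominus>\<^bsub>FG\<^esub> (\<theta> ^^ n) k) \<oplus>\<^bsub>FG\<^esub> ?\<phi> ((\<theta> ^^ n) k)"
        using kF pow[of n] t[OF pow[of n]]
        by (simp add: FG.M.minus_eq FG.M.a_assoc FG.M.r_neg2 FG.M.r_neg1 del: free_module_simps)
      then show ?case
        using FG.submoduleE(5)[OF D Suc imageI[OF pow]] by simp
    qed
    from this[of r] show "k \<in> ?\<phi> ` carrier FG"
      unfolding zero using kF by (simp add: FG.M.minus_eq FG.M.uminus_zero del: free_module_simps)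
  qed
  \<comment> \<open>Every relation now lies in the image of 1 - \<theta>, so a fresh \<eta> chosen
    for the finite set \<open>?B\<close> alone kills all of \<open>V\<close>.\<close>
  obtain \<eta> where \<eta>: "\<eta> \<in> module_hom R FG FG" "\<And>v. v \<in> carrier FG \<Longrightarrow> v \<ominus>\<^bsub>FG\<^esub> \<eta> v \<in> V"
    "\<forall>v\<in>?B. \<eta> v = \<zero>\<^bsub>FG\<^esub>"
    using flat_relations_trivial[OF flat B] by blast
  show ?thesis
  proof (rule projective_if_relations_killed[OF \<eta>(1,2)])
    fix v assume "v \<in> V"
    then obtain w where "w \<in> carrier FG" "v = ?\<phi> w" using V_sub by blast
    then show "\<eta> v = \<zero>\<^bsub>FG\<^esub>" using kills[OF \<eta>(1,3)] by simp
  qed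
qed

end

theorem corollary3p8:
  fixes R :: "('r, 'x) ring_scheme"
    and M :: "('r, 'm, 'y) module_scheme"
  assumes "cring R"
    and "finitely_generated_module R M"
    and "flat_module TYPE(('r, nat) coset_type) R M"
    and "\<exists>S. S \<subseteq> carrier R \<and>
           projective_module
             TYPE(('r pointwise, ('r, 'm, 'r pointwise) tensor) coset_type)
             (pointwise_localization R S)
             (base_change R M (pointwise_localization R S))"
  shows "projective_module TYPE('u) R M"
proof -
  obtain G where "module R M" "finite G" "G \<subseteq> carrier M" "generated_submodule R M G = carrier M"
    using assms(2) unfolding finitely_generated_module_def by blast
  then interpret generated_module R M G
    by (intro generated_module.intro generated_module_axioms.intro)
  obtain S where S: "S \<subseteq> carrier R" and P: "projective_module
      TYPE(('r pointwise, ('r, 'm, 'r pointwise) tensor) coset_type)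
      (pointwise_localization R S) (base_change R M (pointwise_localization R S))"
    using assms(4) by blast
  let ?A = "pointwise_localization R S"
  interpret A: algebra R ?A by (rule R.pointwise_localization_algebra[OF S])
  interpret GB: generated_base_change R M G ?A
    by unfold_locales (rule A.smult_assoc2)
  show ?thesis
  proof (cases "\<one>\<^bsub>R\<^esub> = \<zero>\<^bsub>R\<^esub>")
    \<comment> \<open>Over the zero ring the free module is zero and the identity kills all
      relations. The case is apart because the embedding of A^G in the other case distinguishes
      functions by their values 0 and 1.\<close>
    case True
    have M0: "x = \<zero>\<^bsub>M\<^esub>" if "x \<in> carrier M" for x
      using smult_one[OF that] smult_l_null[OF that] True by simp
    show ?thesis
    proof (rule projective_if_relations_killed[OF module_hom_id])
      show "v \<ominus>\<^bsub>FG\<^esub> v \<in> V" if "v \<in> carrier FG" for v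
        using that by (intro minus_mem_V) simp_all
      show "v = \<zero>\<^bsub>FG\<^esub>" if "v \<in> V" for v
      proof -
        have "v \<in> carrier FG" using that by (simp add: V_iff)
        from FG.smult_one[OF this] FG.smult_l_null[OF this] show ?thesis unfolding True by (rule trans[OF sym])
      qed
    qed
  next
    case False
    txt \<open>For \<open>0 \<noteq> 1\<close> in \<open>R\<close> the index type of \<open>A\<^sup>G\<close> embeds into the type of tensors, so that
      \<open>A\<^sup>G\<close> is among the modules for which projectivity of \<open>M \<otimes> A\<close> is assumed.\<close>
    define m where "m x = {\<lambda>p :: 'm \<times> 'r pointwise. if fst p = x then \<one>\<^bsub>R\<^esub> else \<zero>\<^bsub>R\<^esub>}" for x
    have m: "inj m"
    proof (rule injI)
      fix x y assume "m x = m y"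
      from fun_cong[OF singleton_inject[OF this[unfolded m_def]], of "(x, undefined)"]
      show "x = y" using False by (simp split: if_splits)
    qed
    \<comment> \<open>A family indexed by elements of M is reindexed by tensors along
      \<open>m\<close> and wrapped into a singleton to reach the test type.\<close>
    define e1 where "e1 v = {\<lambda>t. v (inv_into UNIV m t)}" for v :: "'m \<Rightarrow> 'r pointwise"
    have e1: "inj e1"
    proof (rule injI, rule ext)
      fix v w x assume "e1 v = e1 w"
      from fun_cong[OF singleton_inject[OF this[unfolded e1_def]], of "m x"]
      show "v x = w x" using m by simp
    qed
    \<comment> \<open>The indicator function of \<open>t\<close>; the sets \<open>UNIV\<close> and
      \<open>{}\<close> serve as two distinct values of the type of A.\<close>
    define e2 where "e2 t = {\<lambda>t'. if t' = t then UNIV else {} :: 'r pointwise}"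
      for t :: "('r, 'm, 'r pointwise) tensor"
    have e2: "inj e2"
    proof (rule injI)
      fix s t :: "('r, 'm, 'r pointwise) tensor"
      assume "e2 s = e2 t"
      from fun_cong[OF singleton_inject[OF this[unfolded e2_def]], of s]
      show "s = t" by (simp split: if_splits)
    qed
    obtain V0 where V0: "finite V0" "V0 \<subseteq> V" and kill: "\<forall>\<theta>\<in>module_hom R FG FG.
        (\<forall>v\<in>V0. \<theta> v = \<zero>\<^bsub>FG\<^esub>) \<longrightarrow> (\<forall>v\<in>V. \<forall>i. GB.\<iota> (\<theta> v i) = \<zero>\<^bsub>?A\<^esub>)"
      using GB.projective_base_change_relations[OF P inj_on_subset[OF e1 subset_UNIV] inj_on_subset[OF e2 subset_UNIV]]
      by (elim exE conjE)
    show ?thesis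
    proof (rule projective_descent[OF assms(3) V0])
      fix \<theta> v i
      assume \<theta>: "\<theta> \<in> module_hom R FG FG" "\<forall>v\<in>V0. \<theta> v = \<zero>\<^bsub>FG\<^esub>" and v: "v \<in> V"
      have "v \<in> carrier FG" using v by (simp add: V_iff)
      then have "\<theta> v i \<in> carrier R" by (intro FG_coeff module_hom_closed[OF \<theta>(1)])
      then show "\<exists>n::nat. \<theta> v i [^]\<^bsub>R\<^esub> n = \<zero>\<^bsub>R\<^esub>"
        using kill[rule_format, OF \<theta>(1) _ v, of i] \<theta>(2) unfolding GB.\<iota>_def
        by (intro R.pointwise_localization_kernel_nilpotent[OF S]) blast+
    qed
  qed
qed

end
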